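(* Let $X$ be a reflexive complex Banach space and let $(T(t))_{t\geq 0}$ be a $C_0$ semigroup on $X$ with infinitesimal generator $A$. Suppose that there exists $t_0>0$ such that $AT(t_0)$ is bounded. Then for every $t>0$, $$\sigma_{ub}(T(t))\setminus\{0\}=\{e^{\lambda t} : \lambda\in\sigma_{ub}(A)\},$$ $$\sigma_{lb}(T(t))\setminus\{0\}=\{e^{\lambda t} : \lambda\in\sigma_{lb}(A)\},$$ $$\sigma_{b}(T(t))\setminus\{0\}=\{e^{\lambda t} : \lambda\in\sigma_{b}(A)\}.$$
   Context: "$AT(t_0)$ is bounded" means that $T(t_0)X\subseteq D(A)$ and $AT(t_0)$ is a bounded linear operator on $X$. For a closed linear operator $S$ on $X$ with domain $D(S)$, $N(S)$ is its null space and $R(S)$ its range. $S$ is upper semi-Fredholm if $\dim N(S)<\infty$ and $R(S)$ is closed; lower semi-Fredholm if $\operatorname{codim} R(S)<\infty$. The ascent of $S$ is $\operatorname{asc}(S)=\inf\{n\in\mathbb{N}: N(S^n)=N(S^{n+1})\}$ and the descent is $\operatorname{des}(S)=\inf\{n\in\mathbb{N}: R(S^n)=R(S^{n+1})\}$, with $\inf\emptyset=\infty$. $S$ is upper semi-Browder if it is upper semi-Fredholm with finite ascent, lower semi-Browder if it is lower semi-Fredholm with finite descent, and Browder if it is both upper and lower semi-Browder. The spectra $\sigma_{ub}(S)$, $\sigma_{lb}(S)$, $\sigma_b(S)$ are the sets of $\lambda\in\mathbb{C}$ such that $S-\lambda I$ is not upper semi-Browder, not lower semi-Browder, not Browder,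 respectively. *)

theory Defs
  imports "HOL-Analysis.Analysis"
begin

section \<open>Complex Banach spaces\<close>

class complex_normed_vector = real_normed_vector +
  fixes scaleC :: "complex \<Rightarrow> 'a \<Rightarrow> 'a"  (infixr \<open>*\<^sub>C\<close> 75)
  assumes scaleC_add_right: "a *\<^sub>C (x + y) = a *\<^sub>C x + a *\<^sub>C y"
    and scaleC_add_left: "(a + b) *\<^sub>C x = a *\<^sub>C x + b *\<^sub>C x"
    and scaleC_scaleC: "a *\<^sub>C (b *\<^sub>C x) = (a * b) *\<^sub>C x"
    and scaleC_of_real: "complex_of_real r *\<^sub>C x = r *\<^sub>R x"
    and norm_scaleC: "norm (a *\<^sub>C x) = cmod a * norm x"

class complex_banach = complex_normed_vector + banach

instantiation complex :: complex_banach
begin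

definition scaleC_complex :: "complex \<Rightarrow> complex \<Rightarrow> complex" where
  "scaleC_complex a x = a * x"

instance
  by standard (simp_all add: scaleC_complex_def algebra_simps norm_mult scaleR_conv_of_real)

end

global_interpretation complex_vector:
  vector_space "scaleC :: complex \<Rightarrow> 'a \<Rightarrow> 'a::complex_normed_vector"
proof
  fix x :: 'a
  show "1 *\<^sub>C x = x"
    using scaleC_of_real[of 1 x] by simp
qed (simp_all add: scaleC_add_right scaleC_add_left scaleC_scaleC)

definition bounded_clinear ::
    "('a::complex_normed_vector \<Rightarrow> 'b::complex_normed_vector) \<Rightarrow> bool" where
  "bounded_clinear f \<longleftrightarrow> bounded_linear f \<and> (\<forall>c x. f (c *\<^sub>C x) = c *\<^sub>C f x)"

text \<open>The dual \<open>X'\<close> carries the operator norm \<^const>\<open>onorm\<close>; an element of the bidual is a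
  \<open>\<complex>\<close>-linear, norm-bounded functional on \<open>X'\<close>.  Its values off \<open>X'\<close> are irrelevant.\<close>

definition cdual :: "('a::complex_normed_vector \<Rightarrow> complex) set" where
  "cdual = {f. bounded_clinear f}"

definition cbidual :: "(('a::complex_normed_vector \<Rightarrow> complex) \<Rightarrow> complex) set" where
  "cbidual = {\<Phi>.
     (\<forall>f\<in>cdual. \<forall>g\<in>cdual. \<Phi> (\<lambda>x. f x + g x) = \<Phi> f + \<Phi> g) \<and>
     (\<forall>c. \<forall>f\<in>cdual. \<Phi> (\<lambda>x. c * f x) = c * \<Phi> f) \<and>
     (\<exists>K. \<forall>f\<in>cdual. cmod (\<Phi> f) \<le> K * onorm f)}"

text \<open>Reflexivity: the canonical embedding \<open>x \<mapsto> (f \<mapsto> f x)\<close> into the bidual is onto.\<close>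

definition reflexive_space :: "'a::complex_normed_vector itself \<Rightarrow> bool" where
  "reflexive_space _ \<longleftrightarrow>
     (\<forall>\<Phi>\<in>cbidual. \<exists>x::'a. \<forall>f\<in>cdual. \<Phi> f = f x)"

definition finite_cdim :: "'a::complex_normed_vector set \<Rightarrow> bool" where
  "finite_cdim V \<longleftrightarrow> (\<exists>B. finite B \<and> B \<subseteq> V \<and> V \<subseteq> complex_vector.span B)"

text \<open>The quotient \<open>X / V\<close> is finite-dimensional: finitely many cosets \<open>b + V\<close> span it.\<close>

definition finite_ccodim :: "'a::complex_normed_vector set \<Rightarrow> bool" where
  "finite_ccodim V \<longleftrightarrow>
     (\<exists>B. finite B \<and> (\<forall>x. \<exists>b\<in>complex_vector.span B. x - b \<in> V))"


section \<open>Unbounded operators\<close>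

text \<open>A partially defined operator \<open>S\<close> is represented by its graph \<open>{(x, S x) | x \<in> D(S)}\<close>.
  Thus \<open>D(S)\<close> is \<^term>\<open>Domain S\<close>, \<open>R(S)\<close> is \<^term>\<open>Range S\<close>, and \<open>S\<^sup>n\<close> on its natural domain
  is the relational power \<^term>\<open>S ^^ n\<close> (with \<open>S\<^sup>0 = I\<close>).  Relational composition is in diagrammatic
  order: \<^term>\<open>S O R\<close> is \<open>R\<close> after \<open>S\<close>.\<close>

type_synonym 'a oper = "('a \<times> 'a) set"

definition op_graph :: "('a \<Rightarrow> 'a) \<Rightarrow> 'a oper" where
  "op_graph f = {(x, f x) | x. True}"

definition null_space :: "'a::zero oper \<Rightarrow> 'a set" where
  "null_space S = {x. (x, 0) \<in> S}"

definition shift :: "'a::complex_normed_vector oper \<Rightarrow> complex \<Rightarrow> 'a oper" where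
  "shift S \<mu> = {(x, y - \<mu> *\<^sub>C x) | x y. (x, y) \<in> S}"

text \<open>In \<^typ>\<open>enat\<close> the infimum of the empty set is \<open>\<infinity>\<close>.\<close>

definition ascent :: "'a::complex_normed_vector oper \<Rightarrow> enat" where
  "ascent S = Inf {enat n | n. null_space (S ^^ n) = null_space (S ^^ (n + 1))}"

definition descent :: "'a::complex_normed_vector oper \<Rightarrow> enat" where
  "descent S = Inf {enat n | n. Range (S ^^ n) = Range (S ^^ (n + 1))}"

text \<open>The following notions are meant for closed linear operators; generators of
  \<open>C\<^sub>0\<close> semigroups, bounded operators, and their shifts are such.\<close>

definition upper_semi_fredholm :: "'a::complex_normed_vector oper \<Rightarrow> bool" where
  "upper_semi_fredholm S \<longleftrightarrow> finite_cdim (null_space S) \<and> closed (Range S)"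

definition lower_semi_fredholm :: "'a::complex_normed_vector oper \<Rightarrow> bool" where
  "lower_semi_fredholm S \<longleftrightarrow> finite_ccodim (Range S)"

definition upper_semi_browder :: "'a::complex_normed_vector oper \<Rightarrow> bool" where
  "upper_semi_browder S \<longleftrightarrow> upper_semi_fredholm S \<and> ascent S < \<infinity>"

definition lower_semi_browder :: "'a::complex_normed_vector oper \<Rightarrow> bool" where
  "lower_semi_browder S \<longleftrightarrow> lower_semi_fredholm S \<and> descent S < \<infinity>"

definition browder :: "'a::complex_normed_vector oper \<Rightarrow> bool" where
  "browder S \<longleftrightarrow> upper_semi_browder S \<and> lower_semi_browder S"

definition sigma_ub :: "'a::complex_normed_vector oper \<Rightarrow> complex set" where
  "sigma_ub S = {\<mu>. \<not> upper_semi_browder (shift S \<mu>)}"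

definition sigma_lb :: "'a::complex_normed_vector oper \<Rightarrow> complex set" where
  "sigma_lb S = {\<mu>. \<not> lower_semi_browder (shift S \<mu>)}"

definition sigma_b :: "'a::complex_normed_vector oper \<Rightarrow> complex set" where
  "sigma_b S = {\<mu>. \<not> browder (shift S \<mu>)}"


section \<open>Semigroups\<close>

text \<open>Only the values \<open>T t\<close> with \<open>t \<ge> 0\<close> matter.\<close>

definition C0_semigroup :: "(real \<Rightarrow> 'a::complex_banach \<Rightarrow> 'a) \<Rightarrow> bool" where
  "C0_semigroup T \<longleftrightarrow>
     (\<forall>t\<ge>0. bounded_clinear (T t)) \<and>
     (\<forall>x. T 0 x = x) \<and>
     (\<forall>s\<ge>0. \<forall>t\<ge>0. \<forall>x. T (s + t) x = T s (T t x)) \<and>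
     (\<forall>x. ((\<lambda>t. T t x) \<longlongrightarrow> x) (at_right 0))"

definition generator :: "(real \<Rightarrow> 'a::complex_banach \<Rightarrow> 'a) \<Rightarrow> 'a oper" where
  "generator T = {(x, y). ((\<lambda>h. (T h x - x) /\<^sub>R h) \<longlongrightarrow> y) (at_right 0)}"

text \<open>\<open>A B\<close> is bounded, for an everywhere defined \<open>B\<close>: \<open>B X \<subseteq> D(A)\<close> and \<open>A B\<close> is a
  bounded linear operator on \<open>X\<close>.\<close>

definition bounded_product :: "'a::complex_banach oper \<Rightarrow> ('a \<Rightarrow> 'a) \<Rightarrow> bool" where
  "bounded_product A B \<longleftrightarrow>
     range B \<subseteq> Domain A \<and> (\<exists>C. bounded_clinear C \<and> op_graph B O A = op_graph C)"

end

theory Submission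
  imports Defs
begin

text \<open>Let \<open>e\<^sup>\<mu>\<^sup>t = z\<close>, let \<open>\<mu>\<^sub>n = \<mu> + 2\<pi>in/t\<close> be all the logarithms, \<open>B = T(t) - z\<close>, and
  \<open>P\<^sub>n = z \<integral>\<^sub>0\<^sup>t e\<^sup>-\<^sup>\<mu>\<^sup>n\<^sup>s T(s) ds\<close>, so that \<open>(A - \<mu>\<^sub>n) P\<^sub>n = B\<close> and \<open>P\<^sub>n (A - \<mu>\<^sub>n) \<subseteq> B\<close>.
  Since \<open>A T(t\<^sub>0)\<close> is bounded, the semigroup is norm Lipschitz from \<open>t\<^sub>0\<close> on; averaging it
  against the trigonometric polynomials \<open>sin\<^sup>2\<^sup>m(\<pi>s/t)\<close> and inverting a small perturbation of the
  identity gives finitely many commuting bounded operators with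
  \<open>I = \<Sum>\<^sub>n P\<^sub>n C\<^sub>n + B C\<^sub>0\<close>.  In a commutative ring comaximality passes to powers, so also
  \<open>I = \<Sum>\<^sub>n P\<^sub>n\<^sup>k D\<^sub>n + B\<^sup>k D\<^sub>0\<close>.  Applied to \<open>N(B\<^sup>k)\<close> and to \<open>\<Inter>\<^sub>n R((A - \<mu>\<^sub>n)\<^sup>k)\<close>, this bounds
  nullities and deficiencies of all powers of \<open>B\<close> by those of the \<open>A - \<mu>\<^sub>n\<close>; the converse
  bounds are immediate.  Closedness of the range is transferred in the form: bounded sequences
  with convergent images have convergent subsequences.\<close>

section \<open>Finite-dimensional subspaces\<close>

text \<open>The number \<open>z\<close> has infinitely many logarithms, and the point is that
  finitely many of the \<open>A - mu_n\<close> already control \<open>B\<close>. Put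
  \<open>U(s) = exp(-mu s) T(s)\<close>. Since \<open>U(t) = I + B/z\<close>, every
  \<open>U(k t)\<close> is the identity modulo multiples of \<open>B\<close>, so it suffices to
  approximate \<open>U(a + t)\<close> in operator norm through combinations of the
  \<open>P_n\<close>, with \<open>a\<close> a multiple of \<open>t\<close> beyond \<open>t0\<close>.
  The integral over \<open>[0,t]\<close> of \<open>U(s)\<close> against a trigonometric polynomial
  of period \<open>t\<close> is such a combination, and past \<open>t0\<close> the Lipschitz bound
  makes a concentrating kernel converge in norm and not merely strongly. Ascent, descent and closed
  range do not pass directly through a sum such as the Bezout identity. They are therefore recast:
  one set of finite dimension contains the null spaces of all powers; one set of finite codimension
  lies in the ranges of all powers; closedness becomes a subsequence property. All bounded operators
  involved live in the bicommutant of the semigroup, which is commutative and contains the orbit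
  integrals and the inverse of the perturbed identity.\<close>

lemma finite_cdim_subset:
  assumes "finite_cdim V" "U \<subseteq> V"
  shows "finite_cdim U"
proof -
  obtain B where B: "finite B" "V \<subseteq> complex_vector.span B"
    using assms(1) unfolding finite_cdim_def by blast
  \<comment> \<open>Generators have to lie in the set itself, so those of \<open>V\<close> cannot be
    reused; a maximal independent subset of \<open>U\<close> is finite by the exchange
    bound.\<close>
  obtain C where C: "C \<subseteq> U" "complex_vector.independent C" "U \<subseteq> complex_vector.span C"
    using complex_vector.maximal_independent_subset[of U] .
  have "finite C"
    using complex_vector.independent_span_bound[OF B(1) C(2)] C(1) assms(2) B(2) by blast
  with C show ?thesis unfolding finite_cdim_def by blast
qed

lemma finite_cdim_span: "finite B \<Longrightarrow> finite_cdim (complex_vector.span B)"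
  unfolding finite_cdim_def using complex_vector.span_superset[of B] by blast

lemma finite_cdim_span_UN:
  assumes "finite F" "\<And>i. i \<in> F \<Longrightarrow> finite_cdim (V i)"
  shows "finite_cdim (complex_vector.span (\<Union>i\<in>F. V i))"
proof -
  have "\<forall>i\<in>F. \<exists>B. finite B \<and> V i \<subseteq> complex_vector.span B"
    using assms(2) unfolding finite_cdim_def by blast
  then obtain B where B: "\<And>i. i \<in> F \<Longrightarrow> finite (B i) \<and> V i \<subseteq> complex_vector.span (B i)"
    by metis
  have "V i \<subseteq> complex_vector.span (\<Union>i\<in>F. B i)" if "i \<in> F" for i
    using B[OF that] complex_vector.span_mono[of "B i" "\<Union>i\<in>F. B i"] that by blast
  then have "complex_vector.span (\<Union>i\<in>F. V i) \<subseteq> complex_vector.span (\<Union>i\<in>F. B i)"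
    by (intro complex_vector.span_minimal) auto
  moreover have "finite (\<Union>i\<in>F. B i)" using assms(1) B by blast
  ultimately show ?thesis using finite_cdim_span finite_cdim_subset by blast
qed

text \<open>Finite dimension of \<open>V\<close> matters because \<open>dim\<close> is a
  cardinality, hence 0 when bases are infinite. A basis of \<open>U\<close> stays independent after
  adjoining a point of \<open>V\<close> outside \<open>U\<close>, since the subspace
  \<open>U\<close> contains its span.\<close>

lemma dim_psubset:
  assumes "complex_vector.subspace U" "U \<subset> V" "finite_cdim V"
  shows "complex_vector.dim U < complex_vector.dim V"
proof -
  obtain B where B: "finite B" "V \<subseteq> complex_vector.span B"
    using assms(3) unfolding finite_cdim_def by blast
  obtain C where C: "C \<subseteq> U" "complex_vector.independent C" "U \<subseteq> complex_vector.span C"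
      "card C = complex_vector.dim U"
    using complex_vector.basis_exists[of U] .
  obtain x where x: "x \<in> V" "x \<notin> U" using assms(2) by blast
  have "x \<notin> complex_vector.span C"
    using x(2) complex_vector.span_minimal[OF C(1) assms(1)] by blast
  then have "complex_vector.independent (insert x C)"
    using C(2) complex_vector.independent_insertI by blast
  then obtain E where E: "insert x C \<subseteq> E" "E \<subseteq> V" "complex_vector.independent E"
      "V \<subseteq> complex_vector.span E"
    using complex_vector.maximal_independent_subset_extend[of "insert x C" V] C(1) x(1) assms(2)
    by blast
  have fE: "finite E"
    using complex_vector.independent_span_bound[OF B(1) E(3)] E(2) B(2) by blast
  have "finite C" using finite_subset[of C E] fE E(1) by blast
  moreover have "x \<notin> C" using x(2) C(1) by blast
  ultimately have "Suc (card C) = card (insert x C)" by simp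
  also have "\<dots> \<le> card E" using E(1) fE card_mono by blast
  also have "card E = complex_vector.dim V"
    using complex_vector.basis_card_eq_dim E by blast
  finally show ?thesis using C(4) by simp
qed

lemma finite_ccodim_mono: "finite_ccodim W \<Longrightarrow> W \<subseteq> M \<Longrightarrow> finite_ccodim M"
  unfolding finite_ccodim_def by (meson subsetD)

text \<open>Each strict step raises the dimension, so \<open>N k\<close> would have dimension at
  least \<open>k\<close>, against the number of generators of \<open>V\<close>.\<close>

lemma ascending_chain_stabilizes:
  fixes N :: "nat \<Rightarrow> 'a::complex_normed_vector set"
  assumes sub: "\<And>k. complex_vector.subspace (N k)"
    and mono: "\<And>k. N k \<subseteq> N (Suc k)" and V: "\<And>k. N k \<subseteq> V" "finite_cdim V"
  shows "\<exists>k. N k = N (Suc k)"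
proof (rule ccontr)
  assume "\<nexists>k. N k = N (Suc k)"
  then have "N k \<subset> N (Suc k)" for k using mono by blast
  then have step: "complex_vector.dim (N k) < complex_vector.dim (N (Suc k))" for k
    using dim_psubset[OF sub] finite_cdim_subset[OF V(2) V(1)] by blast
  have low: "k \<le> complex_vector.dim (N k)" for k
  proof (induction k)
    case (Suc k)
    then show ?case using step[of k] by linarith
  qed simp
  obtain B where B: "finite B" "V \<subseteq> complex_vector.span B"
    using V(2) unfolding finite_cdim_def by blast
  have "complex_vector.dim (N (Suc (card B))) \<le> card B"
    using complex_vector.dim_le_card V(1) B by blast
  with low[of "Suc (card B)"] show False by simp
qed

text \<open>Codimension becomes dimension by intersecting with a finite span that represents all
  cosets of \<open>W\<close>. Strictness survives: a point of \<open>M k\<close> outside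
  \<open>M (Suc k)\<close> differs from a point of \<open>span B\<close> by an element of
  \<open>W\<close>, which lies in both.\<close>

lemma descending_chain_stabilizes:
  fixes M :: "nat \<Rightarrow> 'a::complex_normed_vector set"
  assumes sub: "\<And>k. complex_vector.subspace (M k)"
    and mono: "\<And>k. M (Suc k) \<subseteq> M k" and W: "\<And>k. W \<subseteq> M k" "finite_ccodim W"
  shows "\<exists>k. M k = M (Suc k)"
proof (rule ccontr)
  assume "\<nexists>k. M k = M (Suc k)"
  then have ne: "M (Suc k) \<noteq> M k" for k by metis
  obtain B where B: "finite B" "\<And>x. \<exists>b\<in>complex_vector.span B. x - b \<in> W"
    using W(2) unfolding finite_ccodim_def by blast
  define L where "L k = M k \<inter> complex_vector.span B" for k
  have subL: "complex_vector.subspace (L k)" for k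
    unfolding L_def using sub complex_vector.subspace_inter complex_vector.subspace_span by blast
  have finL: "finite_cdim (L k)" for k
    unfolding L_def using finite_cdim_subset[OF finite_cdim_span[OF B(1)]] by blast
  have "L (Suc k) \<subset> L k" for k
  proof -
    obtain x where x: "x \<in> M k" "x \<notin> M (Suc k)" using ne[of k] mono[of k] by blast
    obtain b where b: "b \<in> complex_vector.span B" "x - b \<in> W" using B(2) by blast
    have "b \<in> M k"
      using complex_vector.subspace_diff[OF sub[of k] x(1), of "x - b"] b(2) W(1)[of k] by auto
    moreover have "b \<notin> M (Suc k)"
      using complex_vector.subspace_add[OF sub[of "Suc k"], of b "x - b"] b(2) W(1)[of "Suc k"] x(2)
      by auto
    ultimately show ?thesis using b(1) mono unfolding L_def by blast
  qed
  then have step: "complex_vector.dim (L (Suc k)) < complex_vector.dim (L k)" for k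
    using dim_psubset[OF subL] finL by blast
  have "complex_vector.dim (L k) + k \<le> complex_vector.dim (L 0)" for k
  proof (induction k)
    case (Suc k)
    then show ?case using step[of k] by linarith
  qed simp
  from this[of "Suc (complex_vector.dim (L 0))"] show False by simp
qed

section \<open>Linear relations\<close>

text \<open>Complex subspaces of the product, written as closure rules. Relations may be
  multivalued, so the class is stable under converses and serves for preimages as well as
  images.\<close>

definition clinear_rel :: "('a::complex_normed_vector \<times> 'b::complex_normed_vector) set \<Rightarrow> bool" where
  "clinear_rel S \<longleftrightarrow> (0, 0) \<in> S \<and>
     (\<forall>x y x' y'. (x, y) \<in> S \<longrightarrow> (x', y') \<in> S \<longrightarrow> (x + x', y + y') \<in> S) \<and>
     (\<forall>c x y. (x, y) \<in> S \<longrightarrow> (c *\<^sub>C x, c *\<^sub>C y) \<in> S)"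

lemma clinear_rel_zero: "clinear_rel S \<Longrightarrow> (0, 0) \<in> S"
  and clinear_rel_add: "clinear_rel S \<Longrightarrow> (x, y) \<in> S \<Longrightarrow> (x', y') \<in> S \<Longrightarrow> (x + x', y + y') \<in> S"
  and clinear_rel_scale: "clinear_rel S \<Longrightarrow> (x, y) \<in> S \<Longrightarrow> (c *\<^sub>C x, c *\<^sub>C y) \<in> S"
  unfolding clinear_rel_def by blast+

lemma clinear_rel_diff:
  assumes "clinear_rel S" "(x, y) \<in> S" "(x', y') \<in> S"
  shows "(x - x', y - y') \<in> S"
  using clinear_rel_add[OF assms(1,2) clinear_rel_scale[OF assms(1,3), of "-1"]]
  by simp

lemma clinear_rel_scaleR: "clinear_rel S \<Longrightarrow> (x, y) \<in> S \<Longrightarrow> (r *\<^sub>R x, r *\<^sub>R y) \<in> S"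
  using clinear_rel_scale[of S x y "complex_of_real r"] by (simp add: scaleC_of_real)

lemma clinear_rel_relcomp:
  assumes "clinear_rel R" "clinear_rel S"
  shows "clinear_rel (R O S)"
  unfolding clinear_rel_def
proof (intro conjI allI impI)
  show "(0, 0) \<in> R O S" using clinear_rel_zero[OF assms(1)] clinear_rel_zero[OF assms(2)] by blast
  show "(x + x', y + y') \<in> R O S" if "(x, y) \<in> R O S" "(x', y') \<in> R O S" for x y x' y'
    using that clinear_rel_add[OF assms(1)] clinear_rel_add[OF assms(2)] by blast
  show "(c *\<^sub>C x, c *\<^sub>C y) \<in> R O S" if "(x, y) \<in> R O S" for c x y
    using that clinear_rel_scale[OF assms(1)] clinear_rel_scale[OF assms(2)] by blast
qed

lemma clinear_rel_relpow:
  fixes S :: "'a::complex_normed_vector oper"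
  shows "clinear_rel S \<Longrightarrow> clinear_rel (S ^^ k)"
proof (induction k)
  case 0
  then show ?case unfolding clinear_rel_def relpow.simps by simp
next
  case (Suc k)
  then show ?case using clinear_rel_relcomp by auto
qed

lemma clinear_rel_op_graph: "bounded_clinear f \<Longrightarrow> clinear_rel (op_graph f)"
  unfolding clinear_rel_def op_graph_def bounded_clinear_def
  by (simp add: linear_simps)

lemma clinear_rel_shift:
  assumes "clinear_rel S"
  shows "clinear_rel (shift S \<mu>)"
proof -
  have mem: "(x, w) \<in> shift S \<mu> \<longleftrightarrow> (x, w + \<mu> *\<^sub>C x) \<in> S" for x w
    unfolding shift_def by (auto intro!: exI[of _ "w + \<mu> *\<^sub>C x"])
  show ?thesis
    unfolding clinear_rel_def mem
  proof (intro conjI allI impI)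
    show "(0, 0 + \<mu> *\<^sub>C 0) \<in> S" using clinear_rel_zero[OF assms] by simp
    show "(x + x', y + y' + \<mu> *\<^sub>C (x + x')) \<in> S"
      if "(x, y + \<mu> *\<^sub>C x) \<in> S" "(x', y' + \<mu> *\<^sub>C x') \<in> S" for x y x' y'
      using clinear_rel_add[OF assms that] by (simp add: scaleC_add_right algebra_simps)
    show "(c *\<^sub>C x, c *\<^sub>C y + \<mu> *\<^sub>C c *\<^sub>C x) \<in> S" if "(x, y + \<mu> *\<^sub>C x) \<in> S" for c x y
      using clinear_rel_scale[OF assms that, of c]
      by (simp add: scaleC_add_right scaleC_scaleC mult.commute)
  qed
qed

lemma subspace_Image:
  assumes "clinear_rel R" "complex_vector.subspace V"
  shows "complex_vector.subspace (R `` V)"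
  unfolding complex_vector.subspace_def
proof (intro conjI ballI allI)
  show "0 \<in> R `` V" using clinear_rel_zero[OF assms(1)] complex_vector.subspace_0[OF assms(2)] by blast
  show "x + y \<in> R `` V" if "x \<in> R `` V" "y \<in> R `` V" for x y
    using that clinear_rel_add[OF assms(1)] complex_vector.subspace_add[OF assms(2)] by blast
  show "c *\<^sub>C x \<in> R `` V" if "x \<in> R `` V" for c x
    using that clinear_rel_scale[OF assms(1)] complex_vector.subspace_scale[OF assms(2)] by blast
qed

lemma clinear_rel_converse: "clinear_rel R \<Longrightarrow> clinear_rel (R\<inverse>)"
  unfolding clinear_rel_def by blast

lemma subspace_Range: "clinear_rel R \<Longrightarrow> complex_vector.subspace (Range R)"
proof -
  have "Range R = R `` UNIV" by blast
  then show "clinear_rel R \<Longrightarrow> complex_vector.subspace (Range R)"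
    using subspace_Image[OF _ complex_vector.subspace_UNIV] by metis
qed

lemma subspace_Domain: "clinear_rel R \<Longrightarrow> complex_vector.subspace (Domain R)"
  using subspace_Range[OF clinear_rel_converse, of R] by (simp only: Range_converse)

lemma subspace_null_space: "clinear_rel S \<Longrightarrow> complex_vector.subspace (null_space S)"
  unfolding null_space_def complex_vector.subspace_def
  using clinear_rel_zero[of S] clinear_rel_add[of S _ 0 _ 0] clinear_rel_scale[of S _ 0] by simp

text \<open>Preimages of finitely many generators suffice by linearity. This pulls
  finite-dimensionality back through an unbounded, possibly non-injective operator.\<close>

lemma clinear_rel_lift_finite_cdim:
  assumes R: "clinear_rel R" and V: "finite_cdim V"
  obtains C where "finite C" "C \<subseteq> Domain R"
    "\<And>x y. (x, y) \<in> R \<Longrightarrow> y \<in> V \<Longrightarrow> \<exists>x'\<in>complex_vector.span C. (x', y) \<in> R"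
proof -
  obtain B where B: "finite B" "B \<subseteq> V \<inter> Range R" "V \<inter> Range R \<subseteq> complex_vector.span B"
    using finite_cdim_subset[OF V, of "V \<inter> Range R"] unfolding finite_cdim_def by blast
  have "\<forall>b\<in>B. \<exists>x. (x, b) \<in> R" using B(2) by blast
  then obtain f where f: "\<And>b. b \<in> B \<Longrightarrow> (f b, b) \<in> R" by metis
  have "B \<subseteq> R `` complex_vector.span (f ` B)"
    using f complex_vector.span_superset[of "f ` B"] by blast
  then have "complex_vector.span B \<subseteq> R `` complex_vector.span (f ` B)"
    using complex_vector.span_minimal subspace_Image[OF R] complex_vector.subspace_span by blast
  then show thesis
    using that[of "f ` B"] f B by blast
qed

section \<open>Powers, ascent and descent\<close>

lemma enat_Inf_less_infinity: "Inf {enat n | n. P n} < \<infinity> \<longleftrightarrow> (\<exists>n. P n)"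
proof
  assume "\<exists>n. P n"
  then obtain n where "P n" by blast
  then have "Inf {enat n | n. P n} \<le> enat n" by (intro Inf_lower) blast
  then show "Inf {enat n | n. P n} < \<infinity>" using enat_ord_simps(4) order_le_less_trans by blast
next
  assume "Inf {enat n | n. P n} < \<infinity>"
  then show "\<exists>n. P n" by (cases "\<exists>n. P n") (auto simp: top_enat_def)
qed

lemma ascent_finite_iff: "ascent S < \<infinity> \<longleftrightarrow> (\<exists>n. null_space (S ^^ n) = null_space (S ^^ Suc n))"
  unfolding ascent_def enat_Inf_less_infinity by simp

lemma descent_finite_iff: "descent S < \<infinity> \<longleftrightarrow> (\<exists>n. Range (S ^^ n) = Range (S ^^ Suc n))"
  unfolding descent_def enat_Inf_less_infinity by simp

text \<open>Peels off the application of \<open>S\<close> made first, whereas \<open>relpow\<close>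
  itself peels the last one. Null spaces of powers are linked by the first factor, ranges by the
  last.\<close>

lemma mem_null_space_Suc:
  fixes S :: "'a::complex_normed_vector oper"
  shows "x \<in> null_space (S ^^ Suc k) \<longleftrightarrow> (\<exists>y\<in>null_space (S ^^ k). (x, y) \<in> S)"
  unfolding null_space_def relpow.simps relpow_commute[symmetric] by blast

lemma mem_Range_Suc:
  fixes S :: "'a oper"
  shows "y \<in> Range (S ^^ Suc k) \<longleftrightarrow> (\<exists>x\<in>Range (S ^^ k). (x, y) \<in> S)"
  by auto

lemma null_space_relpow_mono:
  fixes S :: "'a::complex_normed_vector oper"
  assumes "clinear_rel S"
  shows "null_space (S ^^ k) \<subseteq> null_space (S ^^ Suc k)"
  using clinear_rel_zero[OF assms] by (auto simp: null_space_def)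

lemma Range_relpow_antimono:
  fixes S :: "'a oper"
  shows "Range (S ^^ Suc k) \<subseteq> Range (S ^^ k)"
  unfolding relpow.simps relpow_commute[symmetric] by blast

lemma null_space_relpow_stable:
  fixes S :: "'a::complex_normed_vector oper"
  assumes "null_space (S ^^ n) = null_space (S ^^ Suc n)"
  shows "null_space (S ^^ (n + j)) = null_space (S ^^ n)"
proof (induction j)
  case (Suc j)
  have "x \<in> null_space (S ^^ (n + Suc j)) \<longleftrightarrow> x \<in> null_space (S ^^ Suc n)" for x
    using mem_null_space_Suc[where S = S and x = x and k = "n + j"] mem_null_space_Suc[where S = S and x = x and k = n] Suc by simp
  then show ?case using assms by blast
qed simp

lemma Range_relpow_stable:
  fixes S :: "'a oper"
  assumes "Range (S ^^ n) = Range (S ^^ Suc n)"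
  shows "Range (S ^^ (n + j)) = Range (S ^^ n)"
proof (induction j)
  case (Suc j)
  have "y \<in> Range (S ^^ (n + Suc j)) \<longleftrightarrow> y \<in> Range (S ^^ Suc n)" for y
    using mem_Range_Suc[where S = S and y = y and k = "n + j"] mem_Range_Suc[where S = S and y = y and k = n] Suc by simp
  then show ?case using assms by blast
qed simp

text \<open>\<open>S\<close> sends the null space of \<open>S ^^ Suc k\<close> into that of
  \<open>S ^^ k\<close>. Once the finite-dimensional image is lifted, two points with the same image
  differ by an element of the null space of \<open>S\<close>.\<close>

lemma finite_cdim_null_space_relpow:
  fixes S :: "'a::complex_normed_vector oper"
  assumes S: "clinear_rel S" and fin: "finite_cdim (null_space S)"
  shows "finite_cdim (null_space (S ^^ k))"
proof (induction k)
  case 0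
  have "null_space (S ^^ 0) \<subseteq> null_space S"
    using clinear_rel_zero[OF S] by (auto simp: null_space_def)
  then show ?case using fin finite_cdim_subset by blast
next
  case (Suc k)
  obtain C where C: "finite C"
    "\<And>x y. (x, y) \<in> S \<Longrightarrow> y \<in> null_space (S ^^ k) \<Longrightarrow> \<exists>x'\<in>complex_vector.span C. (x', y) \<in> S"
    using clinear_rel_lift_finite_cdim[OF S Suc] by metis
  obtain D where D: "finite D" "null_space S \<subseteq> complex_vector.span D"
    using fin unfolding finite_cdim_def by blast
  have "null_space (S ^^ Suc k) \<subseteq> complex_vector.span (C \<union> D)"
  proof
    fix x assume "x \<in> null_space (S ^^ Suc k)"
    then obtain y where y: "y \<in> null_space (S ^^ k)" "(x, y) \<in> S" unfolding mem_null_space_Suc by blast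
    obtain x' where x': "x' \<in> complex_vector.span C" "(x', y) \<in> S" using C(2) y by blast
    have "x - x' \<in> null_space S"
      using clinear_rel_diff[OF S y(2) x'(2)] by (simp add: null_space_def)
    then have "x - x' \<in> complex_vector.span (C \<union> D)"
      using D(2) complex_vector.span_mono[of D "C \<union> D"] by blast
    moreover have "x' \<in> complex_vector.span (C \<union> D)"
      using x'(1) complex_vector.span_mono[of C "C \<union> D"] by blast
    ultimately show "x \<in> complex_vector.span (C \<union> D)"
      using complex_vector.span_add[of "x - x'" _ x'] by fastforce
  qed
  then show ?case using finite_cdim_subset finite_cdim_span C(1) D(1) by blast
qed

text \<open>An operator can be applied to coset representatives only if they lie in its domain; this
  lemma moves them there. The relation \<open>R\<close> pairs a point of \<open>D\<close> with the
  vectors congruent to it modulo \<open>M\<close>, and \<open>span B\<close> is lifted through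
  it.\<close>

lemma finite_ccodim_in_subspace:
  assumes M: "complex_vector.subspace M" "finite_ccodim M" and D: "complex_vector.subspace D"
  obtains C where "finite C" "C \<subseteq> D" "\<And>x. x \<in> D \<Longrightarrow> \<exists>c\<in>complex_vector.span C. x - c \<in> M"
proof -
  obtain B where B: "finite B" "\<And>x. \<exists>b\<in>complex_vector.span B. x - b \<in> M"
    using M(2) unfolding finite_ccodim_def by blast
  define R where "R = {(x, b). x \<in> D \<and> x - b \<in> M}"
  have "clinear_rel R"
    unfolding clinear_rel_def R_def
    using complex_vector.subspace_0[OF M(1)] complex_vector.subspace_0[OF D]
      complex_vector.subspace_add[OF M(1)] complex_vector.subspace_add[OF D]
      complex_vector.subspace_scale[OF M(1)] complex_vector.subspace_scale[OF D]
    by (auto simp: add_diff_add complex_vector.scale_right_diff_distrib[symmetric])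
  then obtain C where C: "finite C" "C \<subseteq> Domain R"
    "\<And>x y. (x, y) \<in> R \<Longrightarrow> y \<in> complex_vector.span B \<Longrightarrow> \<exists>x'\<in>complex_vector.span C. (x', y) \<in> R"
    using clinear_rel_lift_finite_cdim finite_cdim_span[OF B(1)] by metis
  show thesis
  proof (rule that[OF C(1)])
    show "C \<subseteq> D" using C(2) unfolding R_def by blast
    show "\<exists>c\<in>complex_vector.span C. x - c \<in> M" if x: "x \<in> D" for x
    proof -
      obtain b where b: "b \<in> complex_vector.span B" "x - b \<in> M" using B(2) by blast
      then obtain c where c: "c \<in> complex_vector.span C" "c - b \<in> M"
        using C(3)[of x b] x unfolding R_def by blast
      have "x - c \<in> M" using complex_vector.subspace_diff[OF M(1) b(2) c(2)] by simp
      with c(1) show ?thesis by blast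
    qed
  qed
qed

text \<open>A vector is reduced to a value \<open>S x\<close>, then \<open>x\<close> is reduced
  modulo the range of \<open>S ^^ k\<close> to a representative in the domain of \<open>S\<close>.
  The images of these representatives join the generators for the range of \<open>S\<close>.\<close>

lemma finite_ccodim_Range_relpow:
  fixes S :: "'a::complex_normed_vector oper"
  assumes S: "clinear_rel S" and fin: "finite_ccodim (Range S)"
  shows "finite_ccodim (Range (S ^^ k))"
proof (induction k)
  case 0
  have "Range (S ^^ 0) = UNIV" unfolding relpow.simps by simp
  then show ?case by (auto simp: finite_ccodim_def intro!: exI[of _ "{}"])
next
  case (Suc k)
  obtain C where C: "finite C" "C \<subseteq> Domain S"
    "\<And>x. x \<in> Domain S \<Longrightarrow> \<exists>c\<in>complex_vector.span C. x - c \<in> Range (S ^^ k)"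
    using finite_ccodim_in_subspace[OF subspace_Range[OF clinear_rel_relpow[OF S]] Suc subspace_Domain[OF S]]
    by metis
  obtain B where B: "finite B" "\<And>x. \<exists>b\<in>complex_vector.span B. x - b \<in> Range S"
    using fin unfolding finite_ccodim_def by blast
  have "\<forall>c\<in>C. \<exists>y. (c, y) \<in> S" using C(2) by blast
  then obtain f where f: "\<And>c. c \<in> C \<Longrightarrow> (c, f c) \<in> S" by metis
  have sub: "C \<subseteq> S\<inverse> `` complex_vector.span (f ` C)"
    using f complex_vector.span_superset[of "f ` C"] by blast
  have lift: "complex_vector.span C \<subseteq> S\<inverse> `` complex_vector.span (f ` C)"
    by (rule complex_vector.span_minimal[OF sub subspace_Image[OF clinear_rel_converse[OF S]
          complex_vector.subspace_span]])
  have "\<exists>b\<in>complex_vector.span (B \<union> f ` C). y - b \<in> Range (S ^^ Suc k)" for y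
  proof -
    obtain b where b: "b \<in> complex_vector.span B" "y - b \<in> Range S" using B(2) by blast
    then obtain x where x: "(x, y - b) \<in> S" by blast
    obtain c where c: "c \<in> complex_vector.span C" "x - c \<in> Range (S ^^ k)" using C(3) x by blast
    obtain d where d: "d \<in> complex_vector.span (f ` C)" "(c, d) \<in> S" using lift c(1) by blast
    have "(x - c, y - (b + d)) \<in> S"
      using clinear_rel_diff[OF S x d(2)] by (simp add: algebra_simps)
    then have "y - (b + d) \<in> Range (S ^^ Suc k)" unfolding mem_Range_Suc using c(2) by blast
    moreover have "b + d \<in> complex_vector.span (B \<union> f ` C)"
      using b(1) d(1) complex_vector.span_mono[of _ "B \<union> f ` C"]
      by (meson complex_vector.span_add in_mono sup.cobounded1 sup.cobounded2)
    ultimately show ?thesis by blast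
  qed
  then show ?case using B(1) C(1) unfolding finite_ccodim_def by blast
qed

text \<open>A single finite-dimensional bound for all powers can be passed between operators by mere
  inclusions, whereas an equality of consecutive null spaces cannot.\<close>

lemma finite_nullity_ascent_iff:
  fixes S :: "'a::complex_normed_vector oper"
  assumes S: "clinear_rel S"
  shows "finite_cdim (null_space S) \<and> ascent S < \<infinity> \<longleftrightarrow>
    (\<exists>V. finite_cdim V \<and> (\<forall>k. null_space (S ^^ k) \<subseteq> V))"
proof
  assume L: "finite_cdim (null_space S) \<and> ascent S < \<infinity>"
  then obtain n where n: "null_space (S ^^ n) = null_space (S ^^ Suc n)" using ascent_finite_iff by blast
  have "null_space (S ^^ k) \<subseteq> null_space (S ^^ (n + k))" for k
    using lift_Suc_mono_le[of "\<lambda>k. null_space (S ^^ k)" k "n + k"] null_space_relpow_mono[OF S] by simp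
  then have "null_space (S ^^ k) \<subseteq> null_space (S ^^ n)" for k
    using null_space_relpow_stable[OF n] by blast
  then show "\<exists>V. finite_cdim V \<and> (\<forall>k. null_space (S ^^ k) \<subseteq> V)"
    using finite_cdim_null_space_relpow[OF S] L by blast
next
  assume "\<exists>V. finite_cdim V \<and> (\<forall>k. null_space (S ^^ k) \<subseteq> V)"
  then obtain V where V: "finite_cdim V" "\<And>k. null_space (S ^^ k) \<subseteq> V" by blast
  have "null_space S \<subseteq> V" using V(2)[of 1] by simp
  moreover have "\<exists>n. null_space (S ^^ n) = null_space (S ^^ Suc n)"
    by (rule ascending_chain_stabilizes[where N = "\<lambda>n. null_space (S ^^ n)", OF
          subspace_null_space[OF clinear_rel_relpow[OF S]] null_space_relpow_mono[OF S] V(2,1)])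
  ultimately show "finite_cdim (null_space S) \<and> ascent S < \<infinity>"
    using V(1) finite_cdim_subset ascent_finite_iff by blast
qed

text \<open>The dual reformulation; in the forward direction \<open>W\<close> is the stabilized
  range.\<close>

lemma finite_deficiency_descent_iff:
  fixes S :: "'a::complex_normed_vector oper"
  assumes S: "clinear_rel S"
  shows "finite_ccodim (Range S) \<and> descent S < \<infinity> \<longleftrightarrow>
    (\<exists>W. finite_ccodim W \<and> (\<forall>k. W \<subseteq> Range (S ^^ k)))"
    (is "_ \<longleftrightarrow> ?R")
proof
  assume L: "finite_ccodim (Range S) \<and> descent S < \<infinity>"
  then obtain n where n: "Range (S ^^ n) = Range (S ^^ Suc n)" using descent_finite_iff by blast
  have "Range (S ^^ (n + k)) \<subseteq> Range (S ^^ k)" for k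
    by (rule lift_Suc_antimono_le[of "\<lambda>k. Range (S ^^ k)", OF Range_relpow_antimono]) simp
  then show ?R
    using Range_relpow_stable[OF n] finite_ccodim_Range_relpow[OF S] L by blast
next
  assume ?R
  then obtain W where k: "finite_ccodim W" "\<And>j. W \<subseteq> Range (S ^^ j)" by blast
  have "\<exists>n. Range (S ^^ n) = Range (S ^^ Suc n)"
    by (rule descending_chain_stabilizes[where M = "\<lambda>n. Range (S ^^ n)", OF
          subspace_Range[OF clinear_rel_relpow[OF S]] Range_relpow_antimono k(2,1)])
  moreover have "finite_ccodim (Range S)"
    using finite_ccodim_mono[OF k(1) k(2)[of 1]] by simp
  ultimately show "finite_ccodim (Range S) \<and> descent S < \<infinity>" using descent_finite_iff by blast
qed

section \<open>Consequences of the Baire category theorem\<close>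

text \<open>The ball is taken relative to \<open>S\<close>, because the result is applied both to a
  whole space and to a closed range.\<close>

lemma Baire_closed_cover:
  fixes S :: "'a::complete_space set" and F :: "nat \<Rightarrow> 'a set"
  assumes S: "closed S" "S \<noteq> {}" and cover: "S \<subseteq> (\<Union>n. F n)" and F: "\<And>n. closed (F n)"
  obtains n x e where "x \<in> S" "e > 0" "ball x e \<inter> S \<subseteq> F n"
proof -
  define X where "X = subtopology euclidean S"
  have top: "topspace X = S" unfolding X_def by simp
  have cm: "completely_metrizable_space X"
    unfolding X_def using completely_metrizable_space_closedin[OF completely_metrizable_space_euclidean] S(1)
    by simp
  define G where "G = range (\<lambda>n. F n \<inter> S)"
  have "\<exists>n. X interior_of (F n \<inter> S) \<noteq> {}"
  proof (rule ccontr)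
    assume "\<nexists>n. X interior_of (F n \<inter> S) \<noteq> {}"
    then have 1: "X interior_of T = {}" if "T \<in> G" for T using that unfolding G_def by blast
    have 2: "closedin X T" if "T \<in> G" for T
      using that F unfolding G_def X_def by (auto simp: closedin_closed Int_commute)
    have "countable G" unfolding G_def by simp
    then have "X interior_of \<Union>G = {}"
      using Baire_category_alt[of X G] cm 1 2 by blast
    moreover have "\<Union>G = topspace X" using cover top unfolding G_def by auto
    ultimately have "topspace X = {}" by simp
    then show False using S(2) top by simp
  qed
  then obtain n x where x: "x \<in> X interior_of (F n \<inter> S)" by blast
  then obtain T where T: "openin X T" "x \<in> T" "T \<subseteq> F n \<inter> S" unfolding interior_of_def by blast
  then obtain e where e: "e > 0" "ball x e \<inter> S \<subseteq> T"
    unfolding X_def openin_contains_ball by blast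
  show thesis using that[of x e n] e T by blast
qed

lemma uniform_boundedness:
  fixes f :: "nat \<Rightarrow> 'a::banach \<Rightarrow> 'b::real_normed_vector"
  assumes lin: "\<And>n. bounded_linear (f n)" and bdd: "\<And>x. \<exists>K. \<forall>n. norm (f n x) \<le> K"
  obtains K where "K > 0" "\<And>n x. norm (f n x) \<le> K * norm x"
proof -
  define F where "F m = {x. \<forall>n. norm (f n x) \<le> real m}" for m
  have cl: "closed (F m)" for m
    unfolding F_def
    by (intro closed_Collect_all closed_Collect_le continuous_intros
        linear_continuous_on lin)
  have cover: "UNIV \<subseteq> (\<Union>m. F m)"
  proof
    fix x :: 'a
    obtain K where K: "\<And>n. norm (f n x) \<le> K" using bdd by blast
    obtain m where "K \<le> real m" using real_arch_simple by blast
    then have "x \<in> F m" using K order_trans unfolding F_def by blast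
    then show "x \<in> (\<Union>m. F m)" by blast
  qed
  obtain m x0 e where "x0 \<in> UNIV" "e > 0" "ball x0 e \<inter> UNIV \<subseteq> F m"
    by (rule Baire_closed_cover[OF closed_UNIV UNIV_not_empty cover cl])
  then have e: "e > 0" "ball x0 e \<subseteq> F m" by auto
  have bound: "norm (f n x) \<le> (4 * real m / e + 1) * norm x" for n x
  proof (cases "x = 0")
    case True
    then show ?thesis using linear_0[OF bounded_linear.linear[OF lin]] by simp
  next
    case False
    \<comment> \<open>\<open>u\<close> has norm \<open>e / 2\<close>, so \<open>x0 + u\<close> and
      \<open>x0\<close> lie in the ball; two values of norm at most \<open>m\<close> give the factor
      \<open>4 m / e\<close>. The 1 added in the bound makes it positive.\<close>
    define u where "u = (e / (2 * norm x)) *\<^sub>R x"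
    have nu: "norm u = e / 2" using False e(1) unfolding u_def by simp
    have "norm (f n (x0 + u)) \<le> m" "norm (f n x0) \<le> m"
      using e nu subsetD[OF e(2), of "x0 + u"] subsetD[OF e(2), of x0] unfolding F_def
      by (auto simp: dist_norm)
    then have "norm (f n (x0 + u) - f n x0) \<le> 2 * real m"
      using norm_triangle_ineq4[of "f n (x0 + u)" "f n x0"] by linarith
    moreover have "f n (x0 + u) - f n x0 = (e / (2 * norm x)) *\<^sub>R f n x"
      unfolding u_def using lin[of n] by (simp add: linear_simps)
    ultimately have "e / (2 * norm x) * norm (f n x) \<le> 2 * real m" using e(1) by simp
    then have "norm (f n x) \<le> 4 * real m / e * norm x"
      using False e(1) by (simp add: field_simps)
    then show ?thesis unfolding distrib_right mult_1_left using norm_ge_zero[of x] by linarith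
  qed
  have "4 * real m / e + 1 > 0" using e(1) by (simp add: add_nonneg_pos)
  then show thesis using that bound by blast
qed

text \<open>First half of the open mapping theorem, for relations: Baire is applied to the closed
  range as a complete space, covered by the closures of the images of balls. It yields controlled
  approximate preimages only.\<close>

lemma open_mapping_almost:
  fixes G :: "('a::real_normed_vector \<times> 'b::banach) set"
  assumes G: "subspace G" and R: "closed (Range G)"
  obtains K where "K > 0"
    "\<And>y d. y \<in> Range G \<Longrightarrow> d > 0 \<Longrightarrow> \<exists>x y'. (x, y') \<in> G \<and> norm x \<le> K * norm y \<and> norm (y - y') < d"
proof -
  have add: "(x + x', y + y') \<in> G" if "(x, y) \<in> G" "(x', y') \<in> G" for x y x' y'
    using subspace_add[OF G that] by simp
  have diff: "(x - x', y - y') \<in> G" if "(x, y) \<in> G" "(x', y') \<in> G" for x y x' y'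
    using subspace_diff[OF G that] by simp
  have scale: "(c *\<^sub>R x, c *\<^sub>R y) \<in> G" if "(x, y) \<in> G" for c x y
    using subspace_scale[OF G that] by simp
  have zero: "(0, 0) \<in> G" using subspace_0[OF G] by (simp add: zero_prod_def)
  define M where "M n = {y. \<exists>x. (x, y) \<in> G \<and> norm x \<le> real n}" for n
  have cover: "Range G \<subseteq> (\<Union>n. closure (M n))"
  proof
    fix y assume "y \<in> Range G"
    then obtain x where x: "(x, y) \<in> G" by blast
    obtain n where "norm x \<le> real n" using real_arch_simple by blast
    then have "y \<in> M n" using x unfolding M_def by blast
    then show "y \<in> (\<Union>n. closure (M n))" using closure_subset by blast
  qed
  have "Range G \<noteq> {}" using zero by blast
  then obtain n y0 e where y0: "y0 \<in> Range G" "e > 0" "ball y0 e \<inter> Range G \<subseteq> closure (M n)"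
    by (rule Baire_closed_cover[OF R _ cover closed_closure])
  \<comment> \<open>Subtracting approximants of \<open>y0 + y\<close> and of \<open>y0\<close> moves
    the ball to the origin; each has a preimage of norm at most \<open>n\<close>, hence
    \<open>2 n\<close>.\<close>
  have near: "\<exists>x y'. (x, y') \<in> G \<and> norm x \<le> 2 * real n \<and> norm (y - y') < d"
    if y: "y \<in> Range G" "norm y < e" and d: "d > 0" for y d
  proof -
    have "y0 + y \<in> Range G" using y(1) y0(1) add by blast
    then have "y0 + y \<in> closure (M n)" "y0 \<in> closure (M n)"
      using y0 y(2) by (auto simp: dist_norm subset_iff)
    then obtain a b where ab: "a \<in> M n" "b \<in> M n" "dist a (y0 + y) < d / 2" "dist b y0 < d / 2"
      using d unfolding closure_approachable by (meson half_gt_zero)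
    then obtain xa xb where x: "(xa, a) \<in> G" "(xb, b) \<in> G" "norm xa \<le> real n" "norm xb \<le> real n"
      unfolding M_def by blast
    have "norm (y - (a - b)) = norm ((b - y0) - (a - (y0 + y)))" by (simp add: algebra_simps)
    also have "\<dots> \<le> norm (b - y0) + norm (a - (y0 + y))" by (rule norm_triangle_ineq4)
    also have "\<dots> < d" using ab(3,4) by (simp add: dist_norm)
    finally have "norm (y - (a - b)) < d" .
    moreover have "norm (xa - xb) \<le> 2 * real n" using norm_triangle_ineq4[of xa xb] x(3,4) by linarith
    ultimately show ?thesis using diff[OF x(1,2)] by blast
  qed
  \<comment> \<open>Rescaling \<open>y\<close> to norm \<open>e / 2\<close> turns \<open>2 n\<close>
    into \<open>4 n / e\<close> times \<open>norm y\<close>; the 1 ensures positivity when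
    \<open>n\<close> is 0.\<close>
  define K where "K = 4 * real n / e + 1"
  have K: "K > 0" unfolding K_def using y0(2) by (simp add: add_nonneg_pos)
  show thesis
  proof (rule that[OF K])
    fix y d assume y: "y \<in> Range G" and d: "(d::real) > 0"
    show "\<exists>x y'. (x, y') \<in> G \<and> norm x \<le> K * norm y \<and> norm (y - y') < d"
    proof (cases "y = 0")
      case True
      then show ?thesis using zero d by force
    next
      case False
      define c where "c = e / (2 * norm y)"
      have c: "c > 0" using False y0(2) unfolding c_def by simp
      have "norm (c *\<^sub>R y) < e" using False y0(2) unfolding c_def by simp
      moreover have "c *\<^sub>R y \<in> Range G" using y scale by blast
      ultimately obtain x y' where x: "(x, y') \<in> G" "norm x \<le> 2 * real n" "norm (c *\<^sub>R y - y') < c * d"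
        using near[of "c *\<^sub>R y" "c * d"] c d by auto
      have "norm ((1 / c) *\<^sub>R x) \<le> (1 / c) * (2 * real n)" using x(2) c by (simp add: divide_right_mono)
      also have "\<dots> \<le> K * norm y"
        using False y0(2) unfolding c_def K_def by (simp add: field_simps)
      finally have 1: "norm ((1 / c) *\<^sub>R x) \<le> K * norm y" .
      have "y - (1 / c) *\<^sub>R y' = (1 / c) *\<^sub>R (c *\<^sub>R y - y')" using c by (simp add: algebra_simps)
      then have "norm (y - (1 / c) *\<^sub>R y') = norm (c *\<^sub>R y - y') / c" using c by simp
      also have "\<dots> < d" using x(3) c by (simp add: field_simps)
      finally show ?thesis using 1 scale[OF x(1), of "1 / c"] by blast
    qed
  qed
qed

text \<open>Second half: residuals are halved repeatedly, the approximate preimages form a geometric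
  series, and closedness of \<open>G\<close> makes its sum an exact preimage. The ratio 1/2 doubles
  the constant.\<close>

lemma open_mapping_relation:
  fixes G :: "('a::banach \<times> 'b::banach) set"
  assumes G: "subspace G" "closed G" and R: "closed (Range G)"
  obtains c where "c > 0" "\<And>y. y \<in> Range G \<Longrightarrow> \<exists>x. (x, y) \<in> G \<and> norm x \<le> c * norm y"
proof -
  have zero: "(0, 0) \<in> G" using subspace_0[OF G(1)] by (simp add: zero_prod_def)
  obtain K where K: "K > 0"
    "\<And>y d. y \<in> Range G \<Longrightarrow> d > 0 \<Longrightarrow> \<exists>x y'. (x, y') \<in> G \<and> norm x \<le> K * norm y \<and> norm (y - y') < d"
    using open_mapping_almost[OF G(1) R] by blast
  \<comment> \<open>\<open>p y\<close> is an approximate preimage paired with its image. The case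
    \<open>y = 0\<close> is separate because the error margin \<open>norm y / 2\<close> has to be
    positive.\<close>
  have "\<forall>y. \<exists>p. y \<in> Range G \<longrightarrow> p \<in> G \<and> norm (fst p) \<le> K * norm y \<and> norm (y - snd p) \<le> norm y / 2"
  proof
    fix y
    show "\<exists>p. y \<in> Range G \<longrightarrow> p \<in> G \<and> norm (fst p) \<le> K * norm y \<and> norm (y - snd p) \<le> norm y / 2"
    proof (cases "y = 0 \<or> y \<notin> Range G")
      case True
      then show ?thesis using zero by (intro exI[of _ "(0,0)"]) auto
    next
      case False
      then obtain x y' where "(x, y') \<in> G" "norm x \<le> K * norm y" "norm (y - y') < norm y / 2"
        using K(2)[of y "norm y / 2"] by auto
      then show ?thesis by (intro exI[of _ "(x, y')"]) auto
    qed
  qed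
  then obtain p where p: "\<And>y. y \<in> Range G \<Longrightarrow> p y \<in> G \<and> norm (fst (p y)) \<le> K * norm y \<and>
      norm (y - snd (p y)) \<le> norm y / 2" by metis
  show thesis
  proof (rule that[of "2 * K"])
    show "2 * K > 0" using K(1) by simp
    fix y assume y: "y \<in> Range G"
    \<comment> \<open>\<open>r k\<close> is the residual left after \<open>k\<close>
      corrections.\<close>
    define r where "r = rec_nat y (\<lambda>_ z. z - snd (p z))"
    have r0: "r 0 = y" and rS: "r (Suc k) = r k - snd (p (r k))" for k unfolding r_def by simp_all
    have rG: "r k \<in> Range G" for k
    proof (induction k)
      case 0
      then show ?case using y r0 by simp
    next
      case (Suc k)
      obtain x where x: "(x, r k) \<in> G" using Suc by blast
      have "(x, r k) - p (r k) \<in> G" using subspace_diff[OF G(1) x] p[OF Suc] by blast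
      then show ?case unfolding rS by (metis Range.intros prod.collapse snd_conv snd_diff)
    qed
    have rn: "norm (r k) \<le> norm y * (1/2) ^ k" for k
    proof (induction k)
      case (Suc k)
      have "norm (r (Suc k)) \<le> norm (r k) / 2" unfolding rS using p[OF rG] by blast
      with Suc show ?case by simp
    qed (simp add: r0)
    define q where "q k = p (r k)" for k
    have qG: "q k \<in> G" for k unfolding q_def using p[OF rG] by blast
    have fq: "norm (fst (q k)) \<le> K * norm y * (1/2) ^ k" for k
    proof -
      have "norm (fst (q k)) \<le> K * norm (r k)" unfolding q_def using p[OF rG] by blast
      also have "\<dots> \<le> K * (norm y * (1/2) ^ k)" using rn K(1) by (simp add: mult_left_mono)
      finally show ?thesis by (simp add: mult.assoc)
    qed
    have geo: "(\<lambda>k. K * norm y * (1/2::real) ^ k) sums (K * norm y * 2)"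
      using sums_mult[OF geometric_sums[of "1/2::real"], of "K * norm y"] by simp
    have sn: "summable (\<lambda>k. norm (fst (q k)))"
      by (rule summable_comparison_test'[OF sums_summable[OF geo], of 0]) (simp add: fq)
    define x where "x = (\<Sum>k. fst (q k))"
    have sx: "(\<lambda>k. fst (q k)) sums x" unfolding x_def using summable_norm_cancel[OF sn] by (simp add: summable_sums)
    have "norm x \<le> (\<Sum>k. norm (fst (q k)))" unfolding x_def by (rule summable_norm[OF sn])
    also have "\<dots> \<le> K * norm y * 2"
      using suminf_le[OF fq sn sums_summable[OF geo]] sums_unique[OF geo] by simp
    finally have nx: "norm x \<le> 2 * K * norm y" by simp
    have part: "(\<Sum>k<m. snd (q k)) = y - r m" for m
      by (induction m) (simp_all add: r0 rS q_def)
    have "(\<lambda>k. norm y * (1/2::real) ^ k) \<longlonglongrightarrow> norm y * 0"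
      by (intro tendsto_mult_left LIMSEQ_power_zero) simp
    then have "r \<longlonglongrightarrow> 0"
      using Lim_null_comparison[of r "\<lambda>k. norm y * (1/2::real) ^ k" sequentially] rn by simp
    then have "(\<lambda>m. \<Sum>k<m. snd (q k)) \<longlonglongrightarrow> y - 0" unfolding part by (intro tendsto_diff tendsto_const)
    then have "(\<lambda>m. (\<Sum>k<m. fst (q k), \<Sum>k<m. snd (q k))) \<longlonglongrightarrow> (x, y)"
      using sx unfolding sums_def by (intro tendsto_Pair) simp_all
    moreover have "(\<Sum>k<m. fst (q k), \<Sum>k<m. snd (q k)) \<in> G" for m
    proof -
      have "(\<Sum>k<m. q k) \<in> G" using qG by (intro subspace_sum[OF G(1)]) auto
      then show ?thesis by (metis fst_sum snd_sum prod.collapse)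
    qed
    ultimately have "(x, y) \<in> G" by (rule closed_sequentially[OF G(2), rotated])
    then show "\<exists>x. (x, y) \<in> G \<and> norm x \<le> 2 * K * norm y" using nx by blast
  qed
qed

section \<open>Proper relations\<close>

lemma scaleR_scaleC: "r *\<^sub>R (a *\<^sub>C x) = (complex_of_real r * a) *\<^sub>C x"
  by (metis scaleC_of_real scaleC_scaleC)

lemma bounded_linear_scaleC_left:
  fixes b :: "'a::complex_normed_vector"
  shows "bounded_linear (\<lambda>a. a *\<^sub>C b)"
proof (rule bounded_linear_intro[of _ "norm b"])
  show "(r *\<^sub>R a) *\<^sub>C b = r *\<^sub>R (a *\<^sub>C b)" for r a
    by (simp add: scaleR_scaleC scaleR_conv_of_real)
qed (simp_all add: scaleC_add_left norm_scaleC)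

text \<open>Bolzano-Weierstrass for complex spans. The induction hypothesis also makes
  \<open>span B\<close> closed, so a new generator \<open>b\<close> outside it has positive distance
  \<open>d\<close>, and this bounds the coefficients of \<open>b\<close>.\<close>

lemma span_bounded_sequence:
  fixes B :: "'a::complex_normed_vector set"
  assumes "finite B" "bounded (range x)" "\<And>j. x j \<in> complex_vector.span B"
  shows "\<exists>r l. strict_mono (r :: nat \<Rightarrow> nat) \<and> l \<in> complex_vector.span B \<and> (x \<circ> r) \<longlonglongrightarrow> l"
  using assms
proof (induction B arbitrary: x rule: finite_induct)
  case empty
  then have "x j = 0" for j by (metis complex_vector.span_empty singletonD)
  then have "x = (\<lambda>_. 0)" by blast
  then show ?case by (intro exI[of _ id] exI[of _ 0]) (auto simp: strict_mono_def)
next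
  case (insert b B)
  show ?case
  proof (cases "b \<in> complex_vector.span B")
    case True
    then have "complex_vector.span (insert b B) = complex_vector.span B"
      by (rule complex_vector.span_redundant)
    with insert show ?thesis by simp
  next
    case False
    have cl: "closed (complex_vector.span B)"
      unfolding closed_sequential_limits
    proof (intro allI impI, elim conjE)
      fix y l assume y: "\<forall>n. y n \<in> complex_vector.span B" "y \<longlonglongrightarrow> l"
      have "bounded (range y)" using y(2) convergent_imp_bounded by blast
      then obtain r l' where r: "strict_mono (r :: nat \<Rightarrow> nat)" "l' \<in> complex_vector.span B" "(y \<circ> r) \<longlonglongrightarrow> l'"
        using insert.IH[of y] y(1) by blast
      have "(y \<circ> r) \<longlonglongrightarrow> l" using LIMSEQ_subseq_LIMSEQ[OF y(2) r(1)] .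
      then show "l \<in> complex_vector.span B" using LIMSEQ_unique r(2,3) by blast
    qed
    obtain d where d: "d > 0" "ball b d \<subseteq> - complex_vector.span B"
      using cl False open_contains_ball[of "- complex_vector.span B"] by auto
    have dist_b: "d \<le> norm (b - v)" if "v \<in> complex_vector.span B" for v
      using d(2) that by (force simp: dist_norm)
    have "\<forall>j. \<exists>c. x j - c *\<^sub>C b \<in> complex_vector.span B"
      using insert.prems(2) complex_vector.span_breakdown_eq by blast
    then obtain c where c: "\<And>j. x j - c j *\<^sub>C b \<in> complex_vector.span B" by metis
    obtain M where M: "\<And>j. norm (x j) \<le> M" using insert.prems(1) by (auto simp: bounded_iff)
    have cb: "cmod (c j) \<le> M / d" for j
    proof (cases "c j = 0")
      case True
      then show ?thesis using M[of j] d(1) norm_ge_zero[of "x j"] by (simp only: norm_zero) (simp add: order_trans[OF norm_ge_zero])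
    next
      case False
      \<comment> \<open>This writes \<open>x j\<close> as \<open>c j\<close> times the difference of
        \<open>b\<close> and a point of \<open>span B\<close>, a vector of norm at least
        \<open>d\<close>.\<close>
      let ?v = "(- (1 / c j)) *\<^sub>C (x j - c j *\<^sub>C b)"
      have "c j *\<^sub>C (b - ?v) = x j"
        using False by (simp add: complex_vector.scale_right_diff_distrib scaleC_scaleC)
      then have "cmod (c j) * norm (b - ?v) = norm (x j)" using norm_scaleC[of "c j" "b - ?v"] by simp
      moreover have "d \<le> norm (b - ?v)" using dist_b complex_vector.span_scale[OF c] by blast
      ultimately have "cmod (c j) * d \<le> M" using M[of j] mult_left_mono[of d "norm (b - ?v)" "cmod (c j)"] by simp
      then show ?thesis using d(1) by (simp add: field_simps)
    qed
    have "bounded (range c)" unfolding bounded_iff using cb by blast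
    then obtain l r where r: "strict_mono (r :: nat \<Rightarrow> nat)" "(c \<circ> r) \<longlonglongrightarrow> l"
      using bounded_imp_convergent_subsequence by blast
    define v where "v j = x (r j) - c (r j) *\<^sub>C b" for j
    have "norm (v j) \<le> M + M / d * norm b" for j
    proof -
      have "norm (v j) \<le> norm (x (r j)) + cmod (c (r j)) * norm b"
        unfolding v_def using norm_triangle_ineq4[of "x (r j)" "c (r j) *\<^sub>C b"] by (simp add: norm_scaleC)
      then show ?thesis using M[of "r j"] mult_right_mono[OF cb[of "r j"], of "norm b"] by simp
    qed
    then have "bounded (range v)" unfolding bounded_iff by blast
    then obtain s w where s: "strict_mono (s :: nat \<Rightarrow> nat)" "w \<in> complex_vector.span B" "(v \<circ> s) \<longlonglongrightarrow> w"
      using insert.IH[of v] c unfolding v_def by blast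
    have "((c \<circ> r) \<circ> s) \<longlonglongrightarrow> l" using LIMSEQ_subseq_LIMSEQ[OF r(2) s(1)] .
    then have "(\<lambda>j. ((c \<circ> r) \<circ> s) j *\<^sub>C b) \<longlonglongrightarrow> l *\<^sub>C b"
      by (rule bounded_linear.tendsto[OF bounded_linear_scaleC_left])
    then have "(\<lambda>j. (v \<circ> s) j + ((c \<circ> r) \<circ> s) j *\<^sub>C b) \<longlonglongrightarrow> w + l *\<^sub>C b"
      by (rule tendsto_add[OF s(3)])
    then have "(x \<circ> (r \<circ> s)) \<longlonglongrightarrow> w + l *\<^sub>C b"
      unfolding v_def o_def by simp
    moreover have "strict_mono (r \<circ> s)" using r(1) s(1) strict_mono_o by blast
    moreover have "w + l *\<^sub>C b \<in> complex_vector.span (insert b B)"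
      using complex_vector.span_breakdown_eq[of "w + l *\<^sub>C b" b B] s(2) by (metis add_diff_cancel_right')
    ultimately show ?thesis by blast
  qed
qed

text \<open>Stands in for closed range. For closed linear operators on a Banach space, upper
  semi-Fredholm implies it, and it implies closed range; unlike closedness, it can be tested term by
  term in a finite sum by successive extraction.\<close>

definition proper_rel :: "('a::real_normed_vector \<times> 'b::real_normed_vector) set \<Rightarrow> bool" where
  "proper_rel S \<longleftrightarrow> (\<forall>x y. bounded (range x) \<longrightarrow> convergent y \<longrightarrow> (\<forall>j. (x j, y j) \<in> S) \<longrightarrow>
     (\<exists>r. strict_mono (r :: nat \<Rightarrow> nat) \<and> convergent (x \<circ> r)))"

lemma proper_relD:
  assumes "proper_rel S" "bounded (range x)" "convergent y" "\<And>j. (x j, y j) \<in> S"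
  obtains r :: "nat \<Rightarrow> nat" and l where "strict_mono r" "(x \<circ> r) \<longlonglongrightarrow> l"
  using assms unfolding proper_rel_def convergent_def by meson

text \<open>Preimages chosen nearly shortest modulo the null space are bounded: otherwise their
  normalizations cluster at a null vector, and subtracting a multiple of it would shorten them by
  more than the tolerance. Properness then gives a convergent subsequence of preimages.\<close>

lemma proper_imp_closed_Range:
  fixes S :: "('a::complex_normed_vector \<times> 'a) set"
  assumes S: "clinear_rel S" "closed S" and proper: "proper_rel S"
  shows "closed (Range S)"
  unfolding closed_sequential_limits
proof (intro allI impI, elim conjE)
  fix y l assume yR: "\<forall>n. y n \<in> Range S" and yl: "y \<longlonglongrightarrow> l"
  let ?N = "null_space S"
  \<comment> \<open>The slack 1 replaces a minimum of the distance to the null space, which need not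
    be attained.\<close>
  have "\<exists>u. (u, w) \<in> S \<and> (\<forall>n\<in>?N. norm u \<le> norm (u - n) + 1)" if w: "w \<in> Range S" for w
  proof -
    obtain x where x: "(x, w) \<in> S" using w by blast
    define A where "A = (\<lambda>n. norm (x - n)) ` ?N"
    have ne: "A \<noteq> {}" unfolding A_def null_space_def using clinear_rel_zero[OF S(1)] by blast
    have bdd: "bdd_below A" unfolding A_def by (rule bdd_belowI[of _ 0]) auto
    obtain a where a: "a \<in> A" "a < Inf A + 1" using cInf_lessD[OF ne, of "Inf A + 1"] by auto
    then obtain n0 where n0: "n0 \<in> ?N" "norm (x - n0) < Inf A + 1" unfolding A_def by blast
    have "(x - n0, w) \<in> S" using clinear_rel_diff[OF S(1) x, of n0 0] n0(1) unfolding null_space_def by simp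
    moreover have "norm (x - n0) \<le> norm (x - n0 - n) + 1" if "n \<in> ?N" for n
    proof -
      have "n0 + n \<in> ?N" using complex_vector.subspace_add[OF subspace_null_space[OF S(1)]] n0(1) that by blast
      then have "norm (x - (n0 + n)) \<in> A" unfolding A_def by blast
      then have "Inf A \<le> norm (x - (n0 + n))" using cInf_lower bdd by blast
      then show ?thesis using n0(2) by (simp add: algebra_simps)
    qed
    ultimately show ?thesis by blast
  qed
  then have "\<forall>j. \<exists>u. (u, y j) \<in> S \<and> (\<forall>n\<in>?N. norm u \<le> norm (u - n) + 1)" using yR by blast
  then obtain u where u: "\<And>j. (u j, y j) \<in> S" "\<And>j n. n \<in> ?N \<Longrightarrow> norm (u j) \<le> norm (u j - n) + 1"
    by metis
  have "bounded (range u)"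
  proof (rule ccontr)
    assume unb: "\<not> bounded (range u)"
    have "\<exists>i. norm (u i) > real (Suc j)" for j
      using unb unfolding bounded_iff by (auto simp: not_le)
    then obtain i where i: "\<And>j. norm (u (i j)) > real (Suc j)" by metis
    define w where "w j = (1 / norm (u (i j))) *\<^sub>R u (i j)" for j
    define z where "z j = (1 / norm (u (i j))) *\<^sub>R y (i j)" for j
    have upos: "norm (u (i j)) > 0" for j using i[of j] by linarith
    have inv: "1 / norm (u (i j)) \<le> inverse (real (Suc j))" for j
      using i[of j] upos[of j] by (simp add: field_simps)
    have wz: "(w j, z j) \<in> S" for j unfolding w_def z_def using clinear_rel_scaleR[OF S(1) u(1)] .
    have "norm (w j) = 1" for j unfolding w_def using upos[of j] by simp
    then have bw: "bounded (range w)" unfolding bounded_iff by (metis order_refl rangeE)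
    obtain M where M: "\<And>j. norm (y j) \<le> M"
      using convergent_imp_bounded[OF yl] by (auto simp: bounded_iff)
    have inv0: "(\<lambda>j. 1 / norm (u (i j))) \<longlonglongrightarrow> 0"
      using Lim_null_comparison[OF _ LIMSEQ_inverse_real_of_nat, of "\<lambda>j. 1 / norm (u (i j))"] inv by simp
    have "z \<longlonglongrightarrow> 0"
    proof (rule Lim_null_comparison)
      show "(\<lambda>j. 1 / norm (u (i j)) * M) \<longlonglongrightarrow> 0" using tendsto_mult_left_zero[OF inv0] .
      show "\<forall>\<^sub>F j in sequentially. norm (z j) \<le> 1 / norm (u (i j)) * M"
        unfolding z_def using M upos by (auto intro!: always_eventually mult_left_mono divide_right_mono simp: less_imp_le)
    qed
    moreover from this obtain r v where r: "strict_mono (r :: nat \<Rightarrow> nat)" "(w \<circ> r) \<longlonglongrightarrow> v"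
      using proper_relD[OF proper bw, of z] wz unfolding convergent_def by blast
    ultimately have "(\<lambda>j. ((w \<circ> r) j, (z \<circ> r) j)) \<longlonglongrightarrow> (v, 0)"
      using LIMSEQ_subseq_LIMSEQ tendsto_Pair by blast
    then have "(v, 0) \<in> S" by (rule closed_sequentially[OF S(2), rotated]) (simp add: wz)
    then have vN: "v \<in> ?N" unfolding null_space_def by simp
    \<comment> \<open>Near-minimality is tested against \<open>v\<close> scaled by the norm of
      \<open>u (i j)\<close> and divided by that norm; along the subsequence the right side tends to
      0.\<close>
    have key: "1 \<le> norm (w j - v) + 1 / norm (u (i j))" for j
    proof -
      let ?c = "norm (u (i j))"
      have "?c *\<^sub>R v \<in> ?N"
        using complex_vector.subspace_scale[OF subspace_null_space[OF S(1)] vN, of "complex_of_real ?c"]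
        by (simp add: scaleC_of_real)
      then have "?c \<le> norm (u (i j) - ?c *\<^sub>R v) + 1" using u(2) by blast
      also have "u (i j) - ?c *\<^sub>R v = ?c *\<^sub>R (w j - v)"
        unfolding w_def using upos[of j] by (simp add: algebra_simps)
      finally have "?c \<le> ?c * norm (w j - v) + 1" by simp
      then show ?thesis using upos[of j] by (simp add: field_simps)
    qed
    have "(\<lambda>j. norm ((w \<circ> r) j - v) + 1 / norm (u (i (r j)))) \<longlonglongrightarrow> 0 + 0"
      using LIMSEQ_subseq_LIMSEQ[OF inv0 r(1)] r(2)
      by (intro tendsto_add) (simp_all add: o_def LIM_zero tendsto_norm_zero)
    then have "(1::real) \<le> 0 + 0"
      by (rule LIMSEQ_le_const) (use key in auto)
    then show False by simp
  qed
  then obtain r x where r: "strict_mono (r :: nat \<Rightarrow> nat)" "(u \<circ> r) \<longlonglongrightarrow> x"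
    using proper_relD[OF proper, of u y] u(1) yl unfolding convergent_def by blast
  have "(\<lambda>j. ((u \<circ> r) j, (y \<circ> r) j)) \<longlonglongrightarrow> (x, l)"
    using r LIMSEQ_subseq_LIMSEQ[OF yl r(1)] tendsto_Pair by blast
  then have "(x, l) \<in> S" by (rule closed_sequentially[OF S(2), rotated]) (simp add: u(1))
  then show "l \<in> Range S" by blast
qed

text \<open>The open mapping theorem gives preimages \<open>z j\<close> of \<open>y j - l\<close>
  tending to 0. Then \<open>x j - z0 - z j\<close> is a bounded sequence in the finite-dimensional
  null space, where Bolzano-Weierstrass applies.\<close>

lemma upper_semi_fredholm_imp_proper:
  fixes S :: "('a::complex_banach \<times> 'a) set"
  assumes S: "clinear_rel S" "closed S" and usf: "upper_semi_fredholm S"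
  shows "proper_rel S"
  unfolding proper_rel_def
proof (intro allI impI)
  fix x y :: "nat \<Rightarrow> 'a"
  assume bx: "bounded (range x)" and "convergent y" and xy: "\<forall>j. (x j, y j) \<in> S"
  then obtain l where l: "y \<longlonglongrightarrow> l" unfolding convergent_def by blast
  have clR: "closed (Range S)" and fin: "finite_cdim (null_space S)"
    using usf unfolding upper_semi_fredholm_def by auto
  have "l \<in> Range S" by (rule closed_sequentially[OF clR _ l]) (use xy in blast)
  then obtain z0 where z0: "(z0, l) \<in> S" by blast
  have sub: "subspace S"
    unfolding subspace_def
    using clinear_rel_zero[OF S(1)] clinear_rel_add[OF S(1)] clinear_rel_scaleR[OF S(1)]
    by (auto simp: zero_prod_def)
  obtain c where c: "c > 0" "\<And>y. y \<in> Range S \<Longrightarrow> \<exists>x. (x, y) \<in> S \<and> norm x \<le> c * norm y"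
    using open_mapping_relation[OF sub S(2) clR] by blast
  have d: "(x j - z0, y j - l) \<in> S" for j using clinear_rel_diff[OF S(1)] xy z0 by blast
  then have "\<forall>j. \<exists>z. (z, y j - l) \<in> S \<and> norm z \<le> c * norm (y j - l)" using c(2) by blast
  then obtain z where z: "\<And>j. (z j, y j - l) \<in> S" "\<And>j. norm (z j) \<le> c * norm (y j - l)" by metis
  have "(\<lambda>j. c * norm (y j - l)) \<longlonglongrightarrow> 0"
    using l by (intro tendsto_mult_right_zero tendsto_norm_zero LIM_zero)
  then have zl: "z \<longlonglongrightarrow> 0" by (rule Lim_null_comparison[rotated]) (simp add: z(2))
  define v where "v j = x j - z0 - z j" for j
  have vN: "v j \<in> null_space S" for j
    using clinear_rel_diff[OF S(1) d z(1), of j j] unfolding v_def null_space_def by simp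
  obtain B where B: "finite B" "null_space S \<subseteq> complex_vector.span B"
    using fin unfolding finite_cdim_def by blast
  have "bounded (range v)"
  proof -
    obtain M where M: "\<And>j. norm (x j) \<le> M" using bx by (auto simp: bounded_iff)
    obtain M' where M': "\<And>j. norm (z j) \<le> M'"
      using convergent_imp_bounded[OF zl] by (auto simp: bounded_iff)
    have "norm (v j) \<le> M + norm z0 + M'" for j
      unfolding v_def using M[of j] M'[of j] norm_triangle_ineq4[of "x j - z0" "z j"]
        norm_triangle_ineq4[of "x j" z0] by linarith
    then show ?thesis unfolding bounded_iff by blast
  qed
  then obtain r w where r: "strict_mono (r :: nat \<Rightarrow> nat)" "(v \<circ> r) \<longlonglongrightarrow> w"
    using span_bounded_sequence[OF B(1), of v] vN B(2) by blast
  have "(\<lambda>j. (v \<circ> r) j + z0 + (z \<circ> r) j) \<longlonglongrightarrow> w + z0 + 0"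
    by (intro tendsto_add tendsto_const r(2) LIMSEQ_subseq_LIMSEQ[OF zl r(1)])
  moreover have "(\<lambda>j. (v \<circ> r) j + z0 + (z \<circ> r) j) = x \<circ> r" unfolding v_def by auto
  ultimately show "\<exists>r. strict_mono (r :: nat \<Rightarrow> nat) \<and> convergent (x \<circ> r)"
    using r(1) unfolding convergent_def by auto
qed

text \<open>The conditions separate: \<open>V\<close> carries nullity and ascent, properness carries
  the closed range.\<close>

lemma upper_semi_browder_iff:
  fixes S :: "'a::complex_banach oper"
  assumes "clinear_rel S" "closed S"
  shows "upper_semi_browder S \<longleftrightarrow>
    proper_rel S \<and> (\<exists>V. finite_cdim V \<and> (\<forall>k. null_space (S ^^ k) \<subseteq> V))"
  unfolding finite_nullity_ascent_iff[OF assms(1), symmetric] upper_semi_browder_def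
  using upper_semi_fredholm_imp_proper[OF assms] proper_imp_closed_Range[OF assms]
  unfolding upper_semi_fredholm_def by blast

lemma lower_semi_browder_iff:
  fixes S :: "'a::complex_normed_vector oper"
  assumes "clinear_rel S"
  shows "lower_semi_browder S \<longleftrightarrow> (\<exists>W. finite_ccodim W \<and> (\<forall>k. W \<subseteq> Range (S ^^ k)))"
  unfolding finite_deficiency_descent_iff[OF assms, symmetric] lower_semi_browder_def
    lower_semi_fredholm_def by (rule refl)

section \<open>Commuting operators\<close>

text \<open>A commutative semiring of additive maps; raising comaximal elements to powers takes only
  sums and products inside \<open>A\<close>.\<close>

locale commuting_operators =
  fixes A :: "('a::ab_group_add \<Rightarrow> 'a) set"
  assumes op_add: "f \<in> A \<Longrightarrow> f (x + y) = f x + f y"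
    and op_commute: "f \<in> A \<Longrightarrow> g \<in> A \<Longrightarrow> f (g x) = g (f x)"
    and id_mem: "(\<lambda>x. x) \<in> A"
    and zero_mem: "(\<lambda>x. 0) \<in> A"
    and add_mem: "f \<in> A \<Longrightarrow> g \<in> A \<Longrightarrow> (\<lambda>x. f x + g x) \<in> A"
    and comp_mem: "f \<in> A \<Longrightarrow> g \<in> A \<Longrightarrow> (\<lambda>x. f (g x)) \<in> A"
begin

lemma op_zero: "f \<in> A \<Longrightarrow> f 0 = 0"
  using op_add[of f 0 0] by simp

lemma op_sum: "f \<in> A \<Longrightarrow> f (\<Sum>i\<in>I. g i) = (\<Sum>i\<in>I. f (g i))"
  by (induction I rule: infinite_finite_induct) (simp_all add: op_zero op_add)

lemma sum_mem: "(\<And>i. i \<in> I \<Longrightarrow> g i \<in> A) \<Longrightarrow> (\<lambda>x. \<Sum>i\<in>I. g i x) \<in> A"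
  by (induction I rule: infinite_finite_induct) (simp_all add: zero_mem add_mem)

lemma funpow_mem: "f \<in> A \<Longrightarrow> f ^^ k \<in> A"
proof (induction k)
  case 0
  then show ?case using id_mem by (simp add: id_def)
next
  case (Suc k)
  then show ?case using comp_mem[of f "f ^^ k"] by (simp add: o_def)
qed

text \<open>With \<open>q = p c\<close> and \<open>h = 1 - q\<close>, this is
  \<open>1 - q^k = h (1 + q + ... + q^(k-1))\<close> together with \<open>q^k = p^k c^k\<close>,
  which holds by commutativity.\<close>

lemma comaximal_power_step:
  assumes unity: "\<And>x. x = h x + p (c x)" and p: "p \<in> A" and c: "c \<in> A"
  obtains g where "g \<in> A" "\<And>x. x = h (g x) + (p ^^ k) ((c ^^ k) x)"
proof -
  define q where "q x = p (c x)" for x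
  have q: "q \<in> A" using comp_mem[OF p c] unfolding q_def[abs_def] .
  define g where "g x = (\<Sum>j<k. (q ^^ j) x)" for x
  have "g \<in> A" unfolding g_def[abs_def] using funpow_mem[OF q] by (intro sum_mem) blast
  moreover have "x = h (g x) + (p ^^ k) ((c ^^ k) x)" for x
  proof -
    have "q (g x) = (\<Sum>j<k. (q ^^ Suc j) x)" unfolding g_def op_sum[OF q] by simp
    then have "g x - q (g x) = (\<Sum>j<k. (q ^^ j) x - (q ^^ Suc j) x)"
      unfolding g_def sum_subtractf by simp
    also have "\<dots> = x - (q ^^ k) x" using sum_lessThan_telescope'[of "\<lambda>j. (q ^^ j) x" k] by simp
    finally have "g x - q (g x) = x - (q ^^ k) x" .
    moreover have "g x - q (g x) = h (g x)" using unity[of "g x"] unfolding q_def by (metis add_diff_cancel_right')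
    moreover have "(q ^^ k) x = (p ^^ k) ((c ^^ k) x)"
    proof (induction k)
      case (Suc k)
      then show ?case using op_commute[OF c funpow_mem[OF p]] by (simp add: q_def)
    qed simp
    ultimately show ?thesis by (metis diff_add_cancel)
  qed
  ultimately show thesis using that by blast
qed

text \<open>The remainder \<open>r\<close> is kept general so that the induction can hide the
  product for the new index in it, raise the other factors, and raise \<open>p n\<close> last. Each
  raise composes the remaining cofactors with a further operator on the inside.\<close>

lemma comaximal_powers:
  assumes "finite F" and "\<And>i. p i \<in> A" and "\<And>i. c i \<in> A" and "r \<in> A"
    and "\<And>x. x = (\<Sum>i\<in>F. p i (c i x)) + r x"
  shows "\<exists>d s. (\<forall>i. d i \<in> A) \<and> s \<in> A \<and> (\<forall>x. x = (\<Sum>i\<in>F. (p i ^^ k) (d i x)) + r (s x))"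
  using assms
proof (induction F arbitrary: r rule: finite_induct)
  case empty
  then show ?case using id_mem by (intro exI[of _ c] exI[of _ "\<lambda>x. x"]) simp
next
  case (insert n F)
  define r' where "r' x = p n (c n x) + r x" for x
  have "r' \<in> A" unfolding r'_def[abs_def]
    by (rule add_mem[OF comp_mem[OF insert.prems(1,2)] insert.prems(3)])
  moreover have "x = (\<Sum>i\<in>F. p i (c i x)) + r' x" for x
    using insert.prems(4)[of x] insert.hyps unfolding r'_def by (simp add: ac_simps)
  ultimately obtain d s where ds: "\<And>i. d i \<in> A" "s \<in> A"
    "\<And>x. x = (\<Sum>i\<in>F. (p i ^^ k) (d i x)) + r' (s x)"
    using insert.IH insert.prems(1,2) by blast
  have "x = ((\<Sum>i\<in>F. (p i ^^ k) (d i x)) + r (s x)) + p n (c n (s x))" for x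
    using ds(3)[of x] unfolding r'_def by (simp add: ac_simps)
  then obtain g where g: "g \<in> A"
    "\<And>x. x = ((\<Sum>i\<in>F. (p i ^^ k) (d i (g x))) + r (s (g x))) + (p n ^^ k) (((\<lambda>x. c n (s x)) ^^ k) x)"
    using comaximal_power_step[of "\<lambda>x. (\<Sum>i\<in>F. (p i ^^ k) (d i x)) + r (s x)" "p n" "\<lambda>x. c n (s x)" k]
      insert.prems(1,2) comp_mem ds(2) by blast
  define d' where "d' i = (if i = n then (\<lambda>x. c n (s x)) ^^ k else (\<lambda>x. d i (g x)))" for i
  have "x = (\<Sum>i\<in>insert n F. (p i ^^ k) (d' i x)) + r (s (g x))" for x
  proof -
    have "(\<Sum>i\<in>F. (p i ^^ k) (d' i x)) = (\<Sum>i\<in>F. (p i ^^ k) (d i (g x)))"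
      unfolding d'_def using insert.hyps(2) by (intro sum.cong) auto
    then have "(\<Sum>i\<in>insert n F. (p i ^^ k) (d' i x)) =
        (p n ^^ k) (((\<lambda>x. c n (s x)) ^^ k) x) + (\<Sum>i\<in>F. (p i ^^ k) (d i (g x)))"
      using insert.hyps by (simp add: d'_def)
    then show ?thesis using g(2)[of x] by (simp add: ac_simps)
  qed
  moreover have "d' i \<in> A" for i
    unfolding d'_def using funpow_mem comp_mem insert.prems(2) ds(1,2) g(1) by simp
  moreover have "(\<lambda>x. s (g x)) \<in> A" using comp_mem ds(2) g(1) by blast
  ultimately show ?case by (intro exI[of _ d'] exI[of _ "\<lambda>x. s (g x)"]) blast
qed

end

section \<open>Transfer of semi-Browder properties through a factorization\<close>

lemma op_graph_relpow: "op_graph f ^^ k = op_graph (f ^^ k)"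
proof (induction k)
  case (Suc k)
  then show ?case unfolding relpow.simps op_graph_def by auto
qed (auto simp: op_graph_def)

lemma null_space_op_graph: "null_space (op_graph f) = {x. f x = 0}"
  unfolding null_space_def op_graph_def by auto

lemma Range_op_graph: "Range (op_graph f) = range f"
  unfolding op_graph_def by auto

lemma closed_op_graph:
  assumes "bounded_clinear f"
  shows "closed (op_graph f)"
proof -
  have "continuous_on UNIV f" using assms unfolding bounded_clinear_def by (simp add: linear_continuous_on)
  then have "closed {z. snd z = f (fst z)}"
    by (intro closed_Collect_eq continuous_on_snd continuous_on_id
        continuous_on_compose2[OF _ continuous_on_fst[OF continuous_on_id]]) auto
  moreover have "op_graph f = {z. snd z = f (fst z)}" unfolding op_graph_def by auto
  ultimately show ?thesis by simp
qed

lemma finite_ccodim_Int: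
  assumes "complex_vector.subspace M" "complex_vector.subspace N" "finite_ccodim M" "finite_ccodim N"
  shows "finite_ccodim (M \<inter> N)"
proof -
  obtain B where B: "finite B" "\<And>x. \<exists>b\<in>complex_vector.span B. x - b \<in> M"
    using assms(3) unfolding finite_ccodim_def by blast
  obtain C where C: "finite C" "C \<subseteq> M" "\<And>x. x \<in> M \<Longrightarrow> \<exists>c\<in>complex_vector.span C. x - c \<in> N"
    using finite_ccodim_in_subspace[OF assms(2,4,1)] by blast
  have "\<exists>b\<in>complex_vector.span (B \<union> C). x - b \<in> M \<inter> N" for x
  proof -
    obtain b where b: "b \<in> complex_vector.span B" "x - b \<in> M" using B(2) by blast
    obtain c where c: "c \<in> complex_vector.span C" "x - b - c \<in> N" using C(3)[OF b(2)] by blast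
    have "c \<in> M" using complex_vector.span_minimal[OF C(2) assms(1)] c(1) by blast
    then have "x - b - c \<in> M" using complex_vector.subspace_diff[OF assms(1) b(2)] by blast
    moreover have "b + c \<in> complex_vector.span (B \<union> C)"
      using b(1) c(1) complex_vector.span_mono[of B "B \<union> C"] complex_vector.span_mono[of C "B \<union> C"]
      by (intro complex_vector.span_add) auto
    ultimately show ?thesis using c(2) by (intro bexI[of _ "b + c"]) (simp_all add: diff_diff_eq)
  qed
  then show ?thesis unfolding finite_ccodim_def using B(1) C(1) by (intro exI[of _ "B \<union> C"]) simp
qed

lemma finite_ccodim_INT:
  assumes "finite F" "\<And>i. i \<in> F \<Longrightarrow> complex_vector.subspace (M i)" "\<And>i. i \<in> F \<Longrightarrow> finite_ccodim (M i)"
  shows "finite_ccodim (\<Inter>i\<in>F. M i)"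
  using assms
proof (induction F rule: finite_induct)
  case empty
  then show ?case by (auto simp: finite_ccodim_def intro!: exI[of _ "{}"])
next
  case (insert n F)
  have "complex_vector.subspace (\<Inter>i\<in>F. M i)"
    using insert.prems(1) by (auto simp: complex_vector.subspace_def)
  then show ?case using finite_ccodim_Int[of "M n" "\<Inter>i\<in>F. M i"] insert by simp
qed

text \<open>In the application \<open>S i\<close> is \<open>A - mu_i\<close> for all integers
  \<open>i\<close>, and \<open>B\<close> is \<open>T(t) - z\<close>. Every \<open>S i\<close> is
  tied to \<open>B\<close> by \<open>P_in_S\<close> and \<open>P_S\<close>, whereas
  \<open>unity\<close> involves only the finite set \<open>F\<close>: \<open>B\<close> controls all
  indices, and those in \<open>F\<close> already control \<open>B\<close>.\<close>

locale operator_factorization = commuting_operators A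
  for A :: "('a::complex_banach \<Rightarrow> 'a) set" +
  fixes S :: "'i \<Rightarrow> 'a oper" and P C :: "'i \<Rightarrow> 'a \<Rightarrow> 'a" and B C0 :: "'a \<Rightarrow> 'a" and F :: "'i set"
  assumes op_bounded: "f \<in> A \<Longrightarrow> bounded_clinear f"
    and S_linear: "clinear_rel (S i)" and S_closed: "closed (S i)"
    and P_mem: "P i \<in> A" and B_mem: "B \<in> A" and C_mem: "C i \<in> A" and C0_mem: "C0 \<in> A"
    and P_in_S: "(P i x, B x) \<in> S i" and P_S: "(x, y) \<in> S i \<Longrightarrow> P i y = B x"
    and F_finite: "finite F"
    and unity: "x = (\<Sum>i\<in>F. P i (C i x)) + B (C0 x)"
begin

text \<open>From \<open>S P = B\<close> follows \<open>S^k P^k = B^k\<close>, because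
  \<open>P\<close> commutes with \<open>B\<close>; the companion below is the inclusion of
  \<open>P^k S^k\<close> in \<open>B^k\<close>.\<close>

lemma funpow_P_in_S: "((P i ^^ k) x, (B ^^ k) x) \<in> S i ^^ k"
proof (induction k arbitrary: x)
  case (Suc k)
  have "((P i ^^ k) (P i x), (B ^^ k) (P i x)) \<in> S i ^^ k" by (rule Suc)
  moreover have "(B ^^ k) (P i x) = P i ((B ^^ k) x)" using op_commute funpow_mem P_mem B_mem by blast
  ultimately show ?case using P_in_S[of i "(B ^^ k) x"] by (auto simp: funpow_swap1)
qed simp

lemma funpow_P_S: "(x, y) \<in> S i ^^ k \<Longrightarrow> (P i ^^ k) y = (B ^^ k) x"
proof (induction k arbitrary: y)
  case (Suc k)
  then obtain z where z: "(x, z) \<in> S i ^^ k" "(z, y) \<in> S i" by auto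
  have "(P i ^^ Suc k) y = (P i ^^ k) (P i y)" by (simp add: funpow_swap1)
  also have "\<dots> = B ((P i ^^ k) z)" using P_S[OF z(2)] op_commute funpow_mem P_mem B_mem by metis
  also have "\<dots> = (B ^^ Suc k) x" using Suc.IH[OF z(1)] by simp
  finally show ?case .
qed simp

text \<open>Exponents are raised first on all \<open>P i\<close>, with \<open>B C0\<close> as
  remainder, and then on \<open>B\<close>, with the whole sum as its partner.\<close>

lemma unity_powers:
  obtains D D0 where "\<And>i. D i \<in> A" "D0 \<in> A"
    "\<And>x. x = (\<Sum>i\<in>F. (P i ^^ k) (D i x)) + (B ^^ k) (D0 x)"
proof -
  have "\<exists>d s. (\<forall>i. d i \<in> A) \<and> s \<in> A \<and> (\<forall>x. x = (\<Sum>i\<in>F. (P i ^^ k) (d i x)) + B (C0 (s x)))"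
    using comaximal_powers[OF F_finite P_mem C_mem comp_mem[OF B_mem C0_mem] unity] .
  then obtain d s where ds: "\<And>i. d i \<in> A" "s \<in> A"
    "\<And>x. x = (\<Sum>i\<in>F. (P i ^^ k) (d i x)) + B (C0 (s x))" by blast
  obtain g where g: "g \<in> A"
    "\<And>x. x = (\<Sum>i\<in>F. (P i ^^ k) (d i (g x))) + (B ^^ k) (((\<lambda>x. C0 (s x)) ^^ k) x)"
    using comaximal_power_step[OF ds(3) B_mem comp_mem[OF C0_mem ds(2)]] by blast
  show thesis
    by (rule that[of "\<lambda>i x. d i (g x)" "(\<lambda>x. C0 (s x)) ^^ k"])
      (use ds(1,2) g comp_mem funpow_mem C0_mem in blast)+
qed

lemma B_linear: "clinear_rel (op_graph B)" and B_closed: "closed (op_graph B)"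
  using clinear_rel_op_graph closed_op_graph op_bounded[OF B_mem] by auto

lemma null_space_S_subset: "null_space (S i ^^ k) \<subseteq> null_space (op_graph B ^^ k)"
  unfolding op_graph_relpow null_space_op_graph
  using funpow_P_S[where y = 0 and i = i and k = k] op_zero[OF funpow_mem[OF P_mem]] by (auto simp: null_space_def)

lemma Range_B_subset: "Range (op_graph B ^^ k) \<subseteq> Range (S i ^^ k)"
  unfolding op_graph_relpow Range_op_graph using funpow_P_in_S by blast

text \<open>On a vector killed by \<open>B^k\<close> the power identity loses its \<open>B^k\<close>
  term, and \<open>S_i^k\<close> sends each summand \<open>P_i^k D_i x\<close> to
  \<open>B^k D_i x = D_i B^k x = 0\<close>.\<close>

lemma null_space_B_subset:
  "null_space (op_graph B ^^ k) \<subseteq> complex_vector.span (\<Union>i\<in>F. null_space (S i ^^ k))"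
proof
  fix x assume "x \<in> null_space (op_graph B ^^ k)"
  then have x: "(B ^^ k) x = 0" unfolding op_graph_relpow null_space_op_graph by simp
  obtain D D0 where D: "\<And>i. D i \<in> A" "D0 \<in> A"
    "\<And>x. x = (\<Sum>i\<in>F. (P i ^^ k) (D i x)) + (B ^^ k) (D0 x)" by (rule unity_powers[of k]) blast
  have kill: "(B ^^ k) (f x) = 0" if "f \<in> A" for f
    using op_commute[OF funpow_mem[OF B_mem] that] op_zero[OF that] x by simp
  have "(P i ^^ k) (D i x) \<in> null_space (S i ^^ k)" for i
    using funpow_P_in_S[where i = i and k = k and x = "D i x"] kill[OF D(1)] unfolding null_space_def by simp
  then have "(\<Sum>i\<in>F. (P i ^^ k) (D i x)) \<in> complex_vector.span (\<Union>i\<in>F. null_space (S i ^^ k))"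
    by (intro complex_vector.span_sum complex_vector.span_base) blast
  moreover have "x = (\<Sum>i\<in>F. (P i ^^ k) (D i x))" using D(3)[of x] kill[OF D(2)] by simp
  ultimately show "x \<in> complex_vector.span (\<Union>i\<in>F. null_space (S i ^^ k))" by simp
qed

text \<open>If \<open>y = S_i^k z_i\<close> for every \<open>i\<close> in \<open>F\<close>, then
  \<open>P_i^k y = B^k z_i\<close>, so each term of the power identity at \<open>y\<close> lies in
  the range of \<open>B^k\<close>. All summands share the same \<open>y\<close>, hence the
  intersection.\<close>

lemma Range_S_subset: "(\<Inter>i\<in>F. Range (S i ^^ k)) \<subseteq> Range (op_graph B ^^ k)"
proof
  fix y assume y: "y \<in> (\<Inter>i\<in>F. Range (S i ^^ k))"
  obtain D D0 where D: "\<And>i. D i \<in> A" "D0 \<in> A"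
    "\<And>x. x = (\<Sum>i\<in>F. (P i ^^ k) (D i x)) + (B ^^ k) (D0 x)" by (rule unity_powers[of k]) blast
  have Bk: "B ^^ k \<in> A" using funpow_mem B_mem by blast
  have "\<forall>i\<in>F. \<exists>z. (z, y) \<in> S i ^^ k" using y by blast
  then obtain z where z: "\<And>i. i \<in> F \<Longrightarrow> (z i, y) \<in> S i ^^ k" by metis
  have "(P i ^^ k) (D i y) = (B ^^ k) (D i (z i))" if "i \<in> F" for i
    using funpow_P_S[OF z[OF that]] op_commute[OF funpow_mem[OF P_mem] D(1)] op_commute[OF Bk D(1)] by simp
  then have "y = (\<Sum>i\<in>F. (B ^^ k) (D i (z i))) + (B ^^ k) (D0 y)" using D(3)[of y] by simp
  also have "\<dots> = (B ^^ k) ((\<Sum>i\<in>F. D i (z i)) + D0 y)" unfolding op_add[OF Bk] op_sum[OF Bk] ..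
  finally show "y \<in> Range (op_graph B ^^ k)" unfolding op_graph_relpow Range_op_graph by blast
qed

lemma op_bounded_linear: "f \<in> A \<Longrightarrow> bounded_linear f"
  using op_bounded unfolding bounded_clinear_def by blast

lemma bounded_range_op:
  assumes f: "f \<in> A" and x: "bounded (range x)"
  shows "bounded (range (\<lambda>j. f (x j)))"
  using bounded_linear_image[OF x op_bounded_linear[OF f]] by (simp add: image_image)

lemma convergent_op:
  assumes "f \<in> A" and "convergent y"
  shows "convergent (\<lambda>j. f (y j))"
  using bounded_linear.tendsto[OF op_bounded_linear[OF assms(1)]] assms(2) unfolding convergent_def by blast

text \<open>\<open>P i\<close> turns the images \<open>y j\<close> into \<open>B (x j)\<close> and
  preserves convergence.\<close>

lemma proper_S:
  assumes "proper_rel (op_graph B)"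
  shows "proper_rel (S i)"
  unfolding proper_rel_def
proof (intro allI impI)
  fix x y :: "nat \<Rightarrow> 'a"
  assume "bounded (range x)" "convergent y" "\<forall>j. (x j, y j) \<in> S i"
  then have "bounded (range x)" "convergent (\<lambda>j. P i (y j))" "\<And>j. (x j, P i (y j)) \<in> op_graph B"
    using convergent_op[OF P_mem] P_S by (auto simp: op_graph_def)
  then show "\<exists>r. strict_mono (r :: nat \<Rightarrow> nat) \<and> convergent (x \<circ> r)"
    using proper_relD[OF assms] unfolding convergent_def by metis
qed

text \<open>\<open>S i\<close> maps \<open>P_i C_i x_j\<close> to
  \<open>C_i B x_j = C_i y_j\<close>, which converges, so each summand of \<open>unity\<close> has a
  convergent subsequence; the last term, \<open>B C0 x_j = C0 y_j\<close>, converges by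
  itself.\<close>

lemma proper_B:
  assumes proper: "\<And>i. i \<in> F \<Longrightarrow> proper_rel (S i)"
  shows "proper_rel (op_graph B)"
  unfolding proper_rel_def
proof (intro allI impI)
  fix x y :: "nat \<Rightarrow> 'a"
  assume bx: "bounded (range x)" and cy: "convergent y" and xy: "\<forall>j. (x j, y j) \<in> op_graph B"
  have y: "y j = B (x j)" for j using xy unfolding op_graph_def by auto
  have sub: "\<exists>r. strict_mono (r :: nat \<Rightarrow> nat) \<and> (\<forall>i\<in>G. convergent (\<lambda>j. P i (C i (x (r j)))))"
    if "finite G" "G \<subseteq> F" for G
    using that
  proof (induction G rule: finite_induct)
    case empty
    then show ?case by (intro exI[of _ id]) (auto simp: strict_mono_def)
  next
    case (insert i G)
    then obtain r where r: "strict_mono (r :: nat \<Rightarrow> nat)" "\<And>i. i \<in> G \<Longrightarrow> convergent (\<lambda>j. P i (C i (x (r j))))"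
      by blast
    have "bounded (range (\<lambda>j. x (r j)))" by (rule bounded_subset[OF bx]) blast
    then have 1: "bounded (range (\<lambda>j. P i (C i (x (r j)))))"
      by (rule bounded_range_op[OF P_mem bounded_range_op[OF C_mem]])
    have "convergent (\<lambda>j. y (r j))" using convergent_subseq_convergent[OF cy r(1)] by (simp add: o_def)
    then have 2: "convergent (\<lambda>j. C i (y (r j)))" by (rule convergent_op[OF C_mem])
    have 3: "(P i (C i (x (r j))), C i (y (r j))) \<in> S i" for j
      using P_in_S[of i "C i (x (r j))"] op_commute[OF B_mem C_mem] unfolding y by simp
    obtain s l where s: "strict_mono (s :: nat \<Rightarrow> nat)" "((\<lambda>j. P i (C i (x (r j)))) \<circ> s) \<longlonglongrightarrow> l"
      using proper_relD[OF proper 1 2 3] insert.prems by blast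
    have "convergent (\<lambda>j. P m (C m (x ((r \<circ> s) j))))" if "m \<in> insert i G" for m
    proof (cases "m = i")
      case True
      then show ?thesis using s(2) by (auto simp: convergent_def o_def)
    next
      case False
      then show ?thesis using convergent_subseq_convergent[OF r(2) s(1)] that by (simp add: o_def)
    qed
    then show ?case using strict_mono_o[OF r(1) s(1)] by blast
  qed
  obtain r where r: "strict_mono (r :: nat \<Rightarrow> nat)" "\<And>i. i \<in> F \<Longrightarrow> convergent (\<lambda>j. P i (C i (x (r j))))"
    using sub[OF F_finite] by blast
  have "convergent (\<lambda>j. C0 (y (r j)))"
    using convergent_op[OF C0_mem convergent_subseq_convergent[OF cy r(1)]] by (simp add: o_def)
  then have "convergent (\<lambda>j. (\<Sum>i\<in>F. P i (C i (x (r j)))) + C0 (y (r j)))"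
    using r(2) by (intro convergent_add convergent_sum) auto
  moreover have "(\<Sum>i\<in>F. P i (C i (x (r j)))) + C0 (y (r j)) = x (r j)" for j
    using unity[of "x (r j)"] op_commute[OF B_mem C0_mem] unfolding y by simp
  ultimately have "convergent (x \<circ> r)" by (simp add: o_def)
  then show "\<exists>r. strict_mono (r :: nat \<Rightarrow> nat) \<and> convergent (x \<circ> r)" using r(1) by blast
qed

lemma upper_semi_browder_factorization:
  "upper_semi_browder (op_graph B) \<longleftrightarrow> (\<forall>i. upper_semi_browder (S i))"
proof
  assume "upper_semi_browder (op_graph B)"
  then obtain V where V: "proper_rel (op_graph B)" "finite_cdim V" "\<And>k. null_space (op_graph B ^^ k) \<subseteq> V"
    unfolding upper_semi_browder_iff[OF B_linear B_closed] by blast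
  have "null_space (S i ^^ k) \<subseteq> V" for i k using null_space_S_subset V(3) by (rule order_trans)
  then show "\<forall>i. upper_semi_browder (S i)"
    unfolding upper_semi_browder_iff[OF S_linear S_closed] using proper_S[OF V(1)] V(2) by blast
next
  assume "\<forall>i. upper_semi_browder (S i)"
  then have "\<forall>i. proper_rel (S i) \<and> (\<exists>V. finite_cdim V \<and> (\<forall>k. null_space (S i ^^ k) \<subseteq> V))"
    unfolding upper_semi_browder_iff[OF S_linear S_closed] .
  then obtain V where V: "\<And>i. proper_rel (S i)" "\<And>i. finite_cdim (V i)" "\<And>i k. null_space (S i ^^ k) \<subseteq> V i"
    by metis
  have "complex_vector.span (\<Union>i\<in>F. null_space (S i ^^ k)) \<subseteq> complex_vector.span (\<Union>i\<in>F. V i)" for k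
    by (intro complex_vector.span_mono UN_mono V(3)) simp
  then have "null_space (op_graph B ^^ k) \<subseteq> complex_vector.span (\<Union>i\<in>F. V i)" for k
    using null_space_B_subset by (rule order_trans[rotated])
  moreover have "finite_cdim (complex_vector.span (\<Union>i\<in>F. V i))"
    by (rule finite_cdim_span_UN[OF F_finite V(2)])
  ultimately show "upper_semi_browder (op_graph B)"
    unfolding upper_semi_browder_iff[OF B_linear B_closed] using proper_B[OF V(1)] by blast
qed

lemma lower_semi_browder_factorization:
  "lower_semi_browder (op_graph B) \<longleftrightarrow> (\<forall>i. lower_semi_browder (S i))"
proof
  assume "lower_semi_browder (op_graph B)"
  then obtain W where W: "finite_ccodim W" "\<And>k. W \<subseteq> Range (op_graph B ^^ k)"
    unfolding lower_semi_browder_iff[OF B_linear] by blast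
  have "W \<subseteq> Range (S i ^^ k)" for i k using W(2) Range_B_subset by (rule order_trans)
  then show "\<forall>i. lower_semi_browder (S i)"
    unfolding lower_semi_browder_iff[OF S_linear] using W(1) by blast
next
  assume L: "\<forall>i. lower_semi_browder (S i)"
  \<comment> \<open>The finite intersection below calls for subspaces, and the sets \<open>W\<close>
    furnished by \<open>lower_semi_browder_iff\<close> need not be such; stabilized ranges
    are.\<close>
  have "\<exists>n. \<forall>k. Range (S i ^^ n) \<subseteq> Range (S i ^^ k)" for i
  proof -
    obtain n where n: "Range (S i ^^ n) = Range (S i ^^ Suc n)"
      using L descent_finite_iff unfolding lower_semi_browder_def by blast
    have "Range (S i ^^ (n + k)) \<subseteq> Range (S i ^^ k)" for k
      by (rule lift_Suc_antimono_le[of "\<lambda>k. Range (S i ^^ k)", OF Range_relpow_antimono]) simp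
    then show ?thesis using Range_relpow_stable[OF n] by blast
  qed
  then obtain n where n: "\<And>i k. Range (S i ^^ n i) \<subseteq> Range (S i ^^ k)" by metis
  have "finite_ccodim (\<Inter>i\<in>F. Range (S i ^^ n i))"
    using L unfolding lower_semi_browder_def lower_semi_fredholm_def
    by (intro finite_ccodim_INT F_finite subspace_Range clinear_rel_relpow S_linear
        finite_ccodim_Range_relpow) blast
  moreover have "(\<Inter>i\<in>F. Range (S i ^^ n i)) \<subseteq> Range (op_graph B ^^ k)" for k
  proof -
    have "(\<Inter>i\<in>F. Range (S i ^^ n i)) \<subseteq> (\<Inter>i\<in>F. Range (S i ^^ k))" by (rule INF_superset_mono[OF order_refl n])
    then show ?thesis using Range_S_subset by (rule order_trans)
  qed
  ultimately show "lower_semi_browder (op_graph B)"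
    unfolding lower_semi_browder_iff[OF B_linear] by blast
qed

end

section \<open>Bicommutants\<close>

lemma scaleC_scaleR: "c *\<^sub>C (r *\<^sub>R x) = r *\<^sub>R (c *\<^sub>C x)"
  by (metis scaleC_of_real scaleC_scaleC mult.commute)

lemma bounded_linear_scaleC: "bounded_linear (\<lambda>x::'a::complex_normed_vector. c *\<^sub>C x)"
proof (rule bounded_linear_intro[of _ "cmod c"])
  show "c *\<^sub>C (r *\<^sub>R x) = r *\<^sub>R (c *\<^sub>C x)" for r and x :: 'a
    by (rule scaleC_scaleR)
qed (simp_all add: scaleC_add_right norm_scaleC mult.commute)

lemma bounded_clinear_add: "bounded_clinear f \<Longrightarrow> f (x + y) = f x + f y"
  and bounded_clinear_scale: "bounded_clinear f \<Longrightarrow> f (c *\<^sub>C x) = c *\<^sub>C f x"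
  and bounded_clinear_bounded: "bounded_clinear f \<Longrightarrow> bounded_linear f"
  unfolding bounded_clinear_def by (simp_all add: linear_simps)

lemma bounded_clinearI:
  fixes f :: "'a::complex_normed_vector \<Rightarrow> 'b::complex_normed_vector"
  assumes "\<And>x y. f (x + y) = f x + f y" "\<And>c x. f (c *\<^sub>C x) = c *\<^sub>C f x" "\<And>x. norm (f x) \<le> norm x * K"
  shows "bounded_clinear f"
  unfolding bounded_clinear_def
  using bounded_linear_intro[of f K] assms by (metis scaleC_of_real)

lemma bounded_clinear_id: "bounded_clinear (\<lambda>x. x)"
  unfolding bounded_clinear_def by (simp add: bounded_linear_ident)

lemma bounded_clinear_zero: "bounded_clinear (\<lambda>x. 0)"
  unfolding bounded_clinear_def by simp

lemma bounded_clinear_plus: "bounded_clinear f \<Longrightarrow> bounded_clinear g \<Longrightarrow> bounded_clinear (\<lambda>x. f x + g x)"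
  unfolding bounded_clinear_def by (simp add: bounded_linear_add scaleC_add_right)

lemma bounded_clinear_comp: "bounded_clinear f \<Longrightarrow> bounded_clinear g \<Longrightarrow> bounded_clinear (\<lambda>x. f (g x))"
  unfolding bounded_clinear_def by (simp add: bounded_linear_compose)

lemma bounded_clinear_scaleC: "bounded_clinear f \<Longrightarrow> bounded_clinear (\<lambda>x. c *\<^sub>C f x)"
  unfolding bounded_clinear_def
  using bounded_linear_compose[OF bounded_linear_scaleC] by (auto simp: scaleC_scaleC mult.commute)

definition commutant :: "('a::complex_normed_vector \<Rightarrow> 'a) set \<Rightarrow> ('a \<Rightarrow> 'a) set" where
  "commutant M = {f. bounded_clinear f \<and> (\<forall>g\<in>M. \<forall>x. f (g x) = g (f x))}"

abbreviation "bicommutant M \<equiv> commutant (commutant M)"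

lemma commutantI: "bounded_clinear f \<Longrightarrow> (\<And>g x. g \<in> M \<Longrightarrow> f (g x) = g (f x)) \<Longrightarrow> f \<in> commutant M"
  and commutantD: "f \<in> commutant M \<Longrightarrow> g \<in> M \<Longrightarrow> f (g x) = g (f x)"
  and commutant_bounded: "f \<in> commutant M \<Longrightarrow> bounded_clinear f"
  unfolding commutant_def by simp_all

lemma bicommutant_superset:
  assumes "f \<in> M" "bounded_clinear f"
  shows "f \<in> bicommutant M"
  using assms commutantD[of _ M f] by (intro commutantI) simp_all

lemma bicommutant_scaleC:
  assumes "f \<in> bicommutant M"
  shows "(\<lambda>x. c *\<^sub>C f x) \<in> bicommutant M"
proof (rule commutantI[OF bounded_clinear_scaleC[OF commutant_bounded[OF assms]]])
  show "c *\<^sub>C f (g x) = g (c *\<^sub>C f x)" if "g \<in> commutant M" for g x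
    using commutantD[OF assms that] bounded_clinear_scale[OF commutant_bounded[OF that]] by simp
qed

text \<open>A commuting family lies in its own commutant, so its bicommutant is contained in its
  commutant and is commutative. The commutant itself need not be.\<close>

lemma commuting_operators_bicommutant:
  assumes bounded: "\<And>f. f \<in> M \<Longrightarrow> bounded_clinear f"
    and commute: "\<And>f g x. f \<in> M \<Longrightarrow> g \<in> M \<Longrightarrow> f (g x) = g (f x)"
  shows "commuting_operators (bicommutant M)"
proof
  have sub: "f \<in> commutant M" if "f \<in> bicommutant M" for f
  proof (rule commutantI[OF commutant_bounded[OF that]])
    show "f (g x) = g (f x)" if g: "g \<in> M" for g x
      using commutantD[OF \<open>f \<in> bicommutant M\<close>, of g] commutantI[OF bounded[OF g], of M] commute[OF g]
      by blast
  qed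
  show "f (g x) = g (f x)" if "f \<in> bicommutant M" "g \<in> bicommutant M" for f g x
    using commutantD[OF that(1) sub[OF that(2)]] .
  show "f (x + y) = f x + f y" if "f \<in> bicommutant M" for f x y
    by (rule bounded_clinear_add[OF commutant_bounded[OF that]])
  show "(\<lambda>x. x) \<in> bicommutant M" by (rule commutantI[OF bounded_clinear_id]) simp
  show "(\<lambda>x. 0) \<in> bicommutant M"
  proof (rule commutantI[OF bounded_clinear_zero])
    show "0 = g 0" if "g \<in> commutant M" for g
      using bounded_clinear_add[OF commutant_bounded[OF that], of 0 0] by simp
  qed
  show "(\<lambda>x. f x + g x) \<in> bicommutant M" if "f \<in> bicommutant M" "g \<in> bicommutant M" for f g
  proof (rule commutantI[OF bounded_clinear_plus[OF that[THEN commutant_bounded]]])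
    show "f (h x) + g (h x) = h (f x + g x)" if "h \<in> commutant M" for h x
      unfolding bounded_clinear_add[OF commutant_bounded[OF that]]
      using commutantD[OF _ that] \<open>f \<in> _\<close> \<open>g \<in> _\<close> by simp
  qed
  show "(\<lambda>x. f (g x)) \<in> bicommutant M" if "f \<in> bicommutant M" "g \<in> bicommutant M" for f g
  proof (rule commutantI[OF bounded_clinear_comp[OF that[THEN commutant_bounded]]])
    show "f (g (h x)) = h (f (g x))" if "h \<in> commutant M" for h x
      using commutantD[OF _ that] \<open>f \<in> _\<close> \<open>g \<in> _\<close> by simp
  qed
qed

text \<open>\<open>J\<close> inverts \<open>I + E\<close>. It is the fixed point of
  \<open>y = x - E y\<close> rather than a Neumann series: uniqueness of the solution yields both
  linearity and commutation with the commutant.\<close>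

lemma bicommutant_inverse:
  fixes E :: "'a::complex_banach \<Rightarrow> 'a"
  assumes E: "E \<in> bicommutant M" and q: "0 \<le> q" "q < 1" and bound: "\<And>x. norm (E x) \<le> q * norm x"
  obtains J where "J \<in> bicommutant M" "\<And>x. J x + E (J x) = x"
proof -
  note Eb = commutant_bounded[OF E]
  have Ediff: "E (x - y) = E x - E y" for x y
    using linear_diff[OF bounded_linear.linear[OF bounded_clinear_bounded[OF Eb]]] .
  have "\<exists>!y. x - E y = y" for x
  proof (rule banach_fix_type[OF q], intro allI)
    fix u v
    have "dist (x - E u) (x - E v) = norm (E (v - u))" unfolding dist_norm Ediff by simp
    also have "\<dots> \<le> q * dist u v" using bound[of "v - u"] by (simp add: dist_norm norm_minus_commute)
    finally show "dist (x - E u) (x - E v) \<le> q * dist u v" .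
  qed
  then have ex1: "\<exists>!y. y + E y = x" for x by (metis add_diff_cancel_right' diff_add_cancel)
  define J where "J x = (THE y. y + E y = x)" for x
  have J: "J x + E (J x) = x" for x unfolding J_def by (rule theI'[OF ex1])
  have J_eq: "J x = y" if "y + E y = x" for x y using ex1 J that by blast
  have "bounded_clinear J"
  proof (rule bounded_clinearI)
    show "J (x + y) = J x + J y" for x y
    proof (rule J_eq)
      have "J x + J y + E (J x + J y) = (J x + E (J x)) + (J y + E (J y))"
        unfolding bounded_clinear_add[OF Eb] by (simp add: ac_simps)
      then show "J x + J y + E (J x + J y) = x + y" unfolding J .
    qed
    show "J (c *\<^sub>C x) = c *\<^sub>C J x" for c x
      by (rule J_eq) (metis J bounded_clinear_scale[OF Eb] scaleC_add_right)
    show "norm (J x) \<le> norm x * (1 / (1 - q))" for x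
    proof -
      have "norm (J x) \<le> norm x + norm (E (J x))"
        using norm_triangle_ineq4[of x "E (J x)"] J[of x] by (metis add_diff_cancel_right')
      then have "norm (J x) * (1 - q) \<le> norm x" using bound[of "J x"] by (simp add: algebra_simps)
      then show ?thesis using q(2) by (simp add: field_simps)
    qed
  qed
  then have "J \<in> bicommutant M"
  proof (rule commutantI)
    show "J (g x) = g (J x)" if g: "g \<in> commutant M" for g x
    proof (rule J_eq)
      have "g (J x) + E (g (J x)) = g (J x + E (J x))"
        unfolding bounded_clinear_add[OF commutant_bounded[OF g]] using commutantD[OF E g] by simp
      then show "g (J x) + E (g (J x)) = g x" unfolding J .
    qed
  qed
  then show thesis using that J by blast
qed

section \<open>Strongly continuous semigroups\<close>

locale c0_semigroup =
  fixes T :: "real \<Rightarrow> 'a::complex_banach \<Rightarrow> 'a"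
  assumes C0: "C0_semigroup T"
begin

lemma T_bounded_clinear: "0 \<le> t \<Longrightarrow> bounded_clinear (T t)"
  and T_zero: "T 0 x = x"
  and T_semigroup: "0 \<le> s \<Longrightarrow> 0 \<le> t \<Longrightarrow> T (s + t) x = T s (T t x)"
  and T_tendsto: "((\<lambda>t. T t x) \<longlongrightarrow> x) (at_right 0)"
  using C0 unfolding C0_semigroup_def by auto

lemma T_bounded_linear: "0 \<le> t \<Longrightarrow> bounded_linear (T t)"
  using T_bounded_clinear bounded_clinear_bounded by blast

lemma T_diff: "0 \<le> t \<Longrightarrow> T t (x - y) = T t x - T t y"
  using linear_diff[OF bounded_linear.linear[OF T_bounded_linear]] .

lemma T_commute: "0 \<le> s \<Longrightarrow> 0 \<le> t \<Longrightarrow> T s (T t x) = T t (T s x)"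
  using T_semigroup by (metis add.commute)

lemma T_near_zero:
  assumes "e > 0"
  obtains d where "d > 0" "\<And>s. 0 \<le> s \<Longrightarrow> s < d \<Longrightarrow> norm (T s x - x) < e"
proof -
  have "eventually (\<lambda>s. dist (T s x) x < e) (at_right 0)"
    using T_tendsto assms by (rule tendstoD)
  then obtain d where d: "d > 0" "\<And>s. 0 < s \<Longrightarrow> s < d \<Longrightarrow> dist (T s x) x < e"
    unfolding eventually_at_right_field by auto
  have "norm (T s x - x) < e" if "0 \<le> s" "s < d" for s
    using d(2)[of s] that assms T_zero by (cases "s = 0") (auto simp: dist_norm)
  then show thesis using that d(1) by blast
qed

text \<open>Otherwise there are times \<open>s n\<close> tending to 0 at which the operator norm
  exceeds \<open>n\<close>, although \<open>T (s n) x\<close> converges for each \<open>x\<close>;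
  this contradicts uniform boundedness.\<close>

lemma bound_near_zero:
  obtains d K where "d > 0" "\<And>s x. 0 \<le> s \<Longrightarrow> s \<le> d \<Longrightarrow> norm (T s x) \<le> K * norm x"
proof (rule ccontr)
  assume neg: "\<not> thesis"
  have "\<exists>s x. 0 \<le> s \<and> s \<le> inverse (real (Suc n)) \<and> norm (T s x) > real n * norm x" for n
  proof (rule ccontr)
    assume "\<nexists>s x. 0 \<le> s \<and> s \<le> inverse (real (Suc n)) \<and> norm (T s x) > real n * norm x"
    then have "norm (T s x) \<le> real n * norm x" if "0 \<le> s" "s \<le> inverse (real (Suc n))" for s x
      using that not_le by blast
    moreover have "inverse (real (Suc n)) > 0" by simp
    ultimately show False using neg that by blast
  qed
  then obtain s u where s: "\<And>n. 0 \<le> s n" "\<And>n. s n \<le> inverse (real (Suc n))"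
    and u: "\<And>n. norm (T (s n) (u n)) > real n * norm (u n)" by metis
  have s0: "s \<longlonglongrightarrow> 0"
    by (rule tendsto_sandwich[OF _ _ tendsto_const LIMSEQ_inverse_real_of_nat]) (simp_all add: s del: of_nat_Suc)
  have "\<exists>K. \<forall>n. norm (T (s n) x) \<le> K" for x
  proof -
    have "(\<lambda>n. T (s n) x) \<longlonglongrightarrow> x"
    proof (rule LIMSEQ_I)
      fix e :: real assume "0 < e"
      then obtain d where d: "d > 0" "\<And>s. 0 \<le> s \<Longrightarrow> s < d \<Longrightarrow> norm (T s x - x) < e"
        using T_near_zero by blast
      obtain N where "\<And>n. n \<ge> N \<Longrightarrow> norm (s n - 0) < d" using LIMSEQ_D[OF s0 d(1)] by blast
      then have "\<And>n. n \<ge> N \<Longrightarrow> norm (T (s n) x - x) < e" using d(2) s(1) by simp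
      then show "\<exists>N. \<forall>n\<ge>N. norm (T (s n) x - x) < e" by blast
    qed
    then show ?thesis using convergent_imp_bounded bounded_iff by (metis rangeI)
  qed
  then obtain K where K: "K > 0" "\<And>n x. norm (T (s n) x) \<le> K * norm x"
    using uniform_boundedness[of "\<lambda>n. T (s n)"] T_bounded_linear s(1) by blast
  obtain n where n: "K \<le> real n" using real_arch_simple by blast
  have "norm (T (s n) (u n)) \<le> real n * norm (u n)"
    using K(2)[of n "u n"] mult_right_mono[OF n, of "norm (u n)"] by simp
  then show False using u[of n] by simp
qed

text \<open>The semigroup law propagates the bound in steps of length \<open>d\<close>, one factor
  \<open>K\<close> per step; \<open>K >= 1\<close> lets short times absorb the higher
  powers.\<close>

lemma local_bound:
  obtains K where "K \<ge> 1" "\<And>s x. 0 \<le> s \<Longrightarrow> s \<le> b \<Longrightarrow> norm (T s x) \<le> K * norm x"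
proof -
  obtain d K0 where d: "d > 0" "\<And>s x. 0 \<le> s \<Longrightarrow> s \<le> d \<Longrightarrow> norm (T s x) \<le> K0 * norm x"
    using bound_near_zero by blast
  define K where "K = max 1 K0"
  have K: "K \<ge> 1" unfolding K_def by simp
  have bd: "norm (T s x) \<le> K * norm x" if "0 \<le> s" "s \<le> d" for s x
    using d(2)[OF that, of x] mult_right_mono[of K0 K "norm x"] unfolding K_def by simp
  have "norm (T s x) \<le> K ^ Suc n * norm x" if "0 \<le> s" "s \<le> real (Suc n) * d" for n s x
    using that
  proof (induction n arbitrary: s)
    case 0
    then show ?case using bd by simp
  next
    case (Suc n)
    show ?case
    proof (cases "s \<le> d")
      case True
      have "norm (T s x) \<le> K * norm x" using bd True Suc.prems by simp
      also have "\<dots> \<le> K ^ Suc (Suc n) * norm x"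
        using power_increasing[of 1 "Suc (Suc n)" K] K by (intro mult_right_mono) simp_all
      finally show ?thesis .
    next
      case False
      have "norm (T s x) = norm (T d (T (s - d) x))" using T_semigroup[of d "s - d" x] d(1) False by simp
      also have "\<dots> \<le> K * norm (T (s - d) x)" using bd d(1) by simp
      also have "\<dots> \<le> K * (K ^ Suc n * norm x)"
        using Suc.IH[of "s - d"] Suc.prems False K by (intro mult_left_mono) (simp_all add: algebra_simps)
      finally show ?thesis by simp
    qed
  qed
  moreover obtain n where "b / d \<le> real n" using real_arch_simple by blast
  then have "b \<le> real (Suc n) * d" using d(1) by (simp add: field_simps)
  moreover have "K ^ Suc n \<ge> 1" using K one_le_power by blast
  ultimately show thesis using that[of "K ^ Suc n"] by (meson order_trans)
qed

text \<open>Continuity is assumed from the right at 0 only. Both sides reduce to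
  \<open>T v x - T u x = T u (T (v - u) x - x)\<close> with \<open>u <= v\<close>, where the local
  bound controls the outer factor.\<close>

lemma orbit_continuous: "continuous_on {0..b} (\<lambda>s. T s x)"
  unfolding continuous_on_iff
proof (intro ballI allI impI)
  fix r e :: real assume r: "r \<in> {0..b}" and e: "0 < e"
  obtain K where K: "K \<ge> 1" "\<And>s x. 0 \<le> s \<Longrightarrow> s \<le> b \<Longrightarrow> norm (T s x) \<le> K * norm x"
    using local_bound[where b = b] by blast
  obtain d where d: "d > 0" "\<And>s. 0 \<le> s \<Longrightarrow> s < d \<Longrightarrow> norm (T s x - x) < e / K"
    using T_near_zero[of "e / K" x] e K(1) by auto
  have main: "norm (T v x - T u x) < e" if "0 \<le> u" "u \<le> v" "v \<le> b" "v - u < d" for u v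
  proof -
    have "T v x - T u x = T u (T (v - u) x - x)"
      using T_semigroup[of u "v - u" x] T_diff that by simp
    then have "norm (T v x - T u x) \<le> K * norm (T (v - u) x - x)" using K(2) that by simp
    also have "\<dots> < K * (e / K)" using d(2)[of "v - u"] that K(1) by (intro mult_strict_left_mono) simp_all
    finally show ?thesis using K(1) by simp
  qed
  have "dist (T s x) (T r x) < e" if "s \<in> {0..b}" "dist s r < d" for s
    using main[of s r] main[of r s] r that
    by (cases "s \<le> r") (auto simp: dist_norm norm_minus_commute)
  then show "\<exists>d>0. \<forall>s\<in>{0..b}. dist s r < d \<longrightarrow> dist (T s x) (T r x) < e" using d(1) by blast
qed

lemma orbit_integrable: "(\<lambda>s. T s x) integrable_on {0..b}"
  by (rule integrable_continuous_real[OF orbit_continuous])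

end

text \<open>Bridge from the derivative of an integral within an interval to the one-sided quotients
  in the definition of \<open>generator\<close>.\<close>

lemma vector_derivative_right_quotient:
  fixes f :: "real \<Rightarrow> 'a::real_normed_vector"
  assumes f: "(f has_vector_derivative D) (at c within {a..d})" and c: "a \<le> c" "c < d"
  shows "((\<lambda>h. (f (c + h) - f c) /\<^sub>R h) \<longlongrightarrow> D) (at_right 0)"
proof (rule tendstoI)
  fix e :: real assume e: "0 < e"
  have "\<exists>k>0. \<forall>y\<in>{a..d}. norm (y - c) < k \<longrightarrow> norm (f y - f c - (y - c) *\<^sub>R D) \<le> e / 2 * norm (y - c)"
    using f e unfolding has_vector_derivative_def has_derivative_within_alt by (meson half_gt_zero)
  then obtain k where k: "k > 0"
    "\<And>y. y \<in> {a..d} \<Longrightarrow> norm (y - c) < k \<Longrightarrow> norm (f y - f c - (y - c) *\<^sub>R D) \<le> e / 2 * norm (y - c)"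
    by blast
  have "dist ((f (c + h) - f c) /\<^sub>R h) D < e" if h: "0 < h" "h < min k (d - c)" for h
  proof -
    have le: "norm (f (c + h) - f c - h *\<^sub>R D) \<le> e / 2 * h" using k(2)[of "c + h"] h c by simp
    have "(f (c + h) - f c) /\<^sub>R h - D = (f (c + h) - f c - h *\<^sub>R D) /\<^sub>R h"
      using h(1) by (simp add: scaleR_diff_right)
    then have "norm ((f (c + h) - f c) /\<^sub>R h - D) = norm (f (c + h) - f c - h *\<^sub>R D) / h"
      using h(1) by (simp add: divide_inverse mult.commute)
    also have "\<dots> \<le> (e / 2 * h) / h" using le h(1) by (intro divide_right_mono) simp_all
    also have "\<dots> < e" using h(1) e by simp
    finally show ?thesis by (simp add: dist_norm)
  qed
  moreover have "min k (d - c) > 0" using k(1) c by simp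
  ultimately show "\<forall>\<^sub>F h in at_right 0. dist ((f (c + h) - f c) /\<^sub>R h) D < e"
    unfolding eventually_at_right_field by blast
qed

section \<open>Integrated orbits, closedness of the generator, Lipschitz continuity in norm\<close>

context c0_semigroup begin

definition orbit_integral :: "real \<Rightarrow> 'a \<Rightarrow> 'a" where
  "orbit_integral b x = integral {0..b} (\<lambda>s. T s x)"

lemma orbit_integral_bound:
  assumes "0 \<le> b" and K: "\<And>s x. 0 \<le> s \<Longrightarrow> s \<le> b \<Longrightarrow> norm (T s x) \<le> K * norm x"
  shows "norm (orbit_integral b x) \<le> b * K * norm x"
proof -
  have "norm (orbit_integral b x) \<le> K * norm x * (b - 0)"
    unfolding orbit_integral_def
    using integral_bound[OF assms(1) orbit_continuous] K by auto
  then show ?thesis by (simp add: ac_simps)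
qed

lemma orbit_integral_add: "orbit_integral b (x + y) = orbit_integral b x + orbit_integral b y"
proof -
  have "integral {0..b} (\<lambda>s. T s (x + y)) = integral {0..b} (\<lambda>s. T s x + T s y)"
    using bounded_clinear_add[OF T_bounded_clinear] by (intro integral_cong) simp
  then show ?thesis unfolding orbit_integral_def by (simp add: integral_add orbit_integrable)
qed

lemma bounded_linear_orbit_integral:
  assumes "bounded_linear f"
  shows "f (orbit_integral b x) = integral {0..b} (\<lambda>s. f (T s x))"
  using integral_linear[OF orbit_integrable assms] unfolding orbit_integral_def by (simp add: o_def)

lemma bounded_clinear_orbit_integral:
  assumes "0 \<le> b"
  shows "bounded_clinear (orbit_integral b)"
proof -
  obtain K where "K \<ge> 1" and K: "\<And>s x. 0 \<le> s \<Longrightarrow> s \<le> b \<Longrightarrow> norm (T s x) \<le> K * norm x"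
    using local_bound[where b = b] by blast
  show ?thesis
  proof (rule bounded_clinearI)
    show "orbit_integral b (x + y) = orbit_integral b x + orbit_integral b y" for x y
      by (rule orbit_integral_add)
    show "orbit_integral b (c *\<^sub>C x) = c *\<^sub>C orbit_integral b x" for c x
      unfolding bounded_linear_orbit_integral[OF bounded_linear_scaleC]
      unfolding orbit_integral_def using bounded_clinear_scale[OF T_bounded_clinear]
      by (intro integral_cong) simp
    show "norm (orbit_integral b x) \<le> norm x * (b * K)" for x
      using orbit_integral_bound[OF assms K, where x = x] by (simp add: ac_simps)
  qed
qed

text \<open>\<open>T h\<close> translates the integral to \<open>[h, b + h]\<close>. The difference
  is regrouped into increments at \<open>b\<close> and at 0, whose quotients by \<open>h\<close>
  have known limits.\<close>

lemma orbit_integral_shift: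
  assumes "0 \<le> b" "0 \<le> h"
  shows "T h (orbit_integral b x) - orbit_integral b x =
    orbit_integral (b + h) x - orbit_integral b x - orbit_integral h x"
proof -
  have "T h (orbit_integral b x) = integral {0..b} (\<lambda>s. T h (T s x))"
    by (rule bounded_linear_orbit_integral[OF T_bounded_linear[OF assms(2)]])
  also have "\<dots> = integral {0..b} ((\<lambda>s. T s x) \<circ> (+) h)"
    using T_semigroup assms(2) by (intro integral_cong) simp
  also have "\<dots> = integral {0 + h..b + h} (\<lambda>s. T s x)" by (rule integral_shift_Icc_real)
  finally have "T h (orbit_integral b x) = integral {h..b + h} (\<lambda>s. T s x)" by simp
  moreover have "integral {0..h} (\<lambda>s. T s x) + integral {h..b + h} (\<lambda>s. T s x) =
      integral {0..b + h} (\<lambda>s. T s x)"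
    using Henstock_Kurzweil_Integration.integral_combine[OF assms(2) _ orbit_integrable] assms(1) by simp
  ultimately show ?thesis unfolding orbit_integral_def by (simp add: algebra_simps)
qed

lemma orbit_integral_quotient:
  assumes "0 \<le> b"
  shows "((\<lambda>h. (orbit_integral (b + h) x - orbit_integral b x) /\<^sub>R h) \<longlongrightarrow> T b x) (at_right 0)"
  using vector_derivative_right_quotient[OF
      integral_has_vector_derivative[OF orbit_continuous, of b "b + 1"]] assms
  unfolding orbit_integral_def by simp

lemma orbit_integral_in_generator:
  assumes "0 \<le> b"
  shows "(orbit_integral b x, T b x - x) \<in> generator T"
proof -
  have "((\<lambda>h. (orbit_integral (b + h) x - orbit_integral b x) /\<^sub>R h -
      (orbit_integral (0 + h) x - orbit_integral 0 x) /\<^sub>R h) \<longlongrightarrow> T b x - T 0 x) (at_right 0)"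
    by (intro tendsto_diff orbit_integral_quotient assms order_refl)
  moreover have "\<forall>\<^sub>F h in at_right 0. (orbit_integral (b + h) x - orbit_integral b x) /\<^sub>R h -
      (orbit_integral (0 + h) x - orbit_integral 0 x) /\<^sub>R h =
      (T h (orbit_integral b x) - orbit_integral b x) /\<^sub>R h"
    using eventually_at_right_less[of 0]
  proof eventually_elim
    case (elim h)
    have "orbit_integral 0 x = 0" unfolding orbit_integral_def by simp
    then show ?case
      using orbit_integral_shift[OF assms, of h x] elim by (simp add: scaleR_diff_right)
  qed
  ultimately show ?thesis
    unfolding generator_def using T_zero by (simp add: tendsto_cong)
qed

text \<open>The bounded operator \<open>orbit_integral b\<close> commutes with \<open>T h\<close>,
  so it passes through the limit defining \<open>y\<close> and produces the quotient of the
  preceding lemma.\<close>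

lemma orbit_integral_generator:
  assumes xy: "(x, y) \<in> generator T" and b: "0 \<le> b"
  shows "orbit_integral b y = T b x - x"
proof -
  have "((\<lambda>h. orbit_integral b ((T h x - x) /\<^sub>R h)) \<longlongrightarrow> orbit_integral b y) (at_right 0)"
    using xy bounded_linear.tendsto[OF bounded_clinear_bounded[OF bounded_clinear_orbit_integral[OF b]]]
    unfolding generator_def by auto
  moreover have "\<forall>\<^sub>F h in at_right 0. orbit_integral b ((T h x - x) /\<^sub>R h) =
      (T h (orbit_integral b x) - orbit_integral b x) /\<^sub>R h"
    using eventually_at_right_less[of 0]
  proof eventually_elim
    case (elim h)
    then have h: "0 \<le> h" by simp
    have "T h (orbit_integral b x) = orbit_integral b (T h x)"
      unfolding bounded_linear_orbit_integral[OF T_bounded_linear[OF h]]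
      unfolding orbit_integral_def using T_commute h by (intro integral_cong) simp
    then show ?case
      using bounded_clinear_bounded[OF bounded_clinear_orbit_integral[OF b]] by (simp add: linear_simps)
  qed
  ultimately have "((\<lambda>h. (T h (orbit_integral b x) - orbit_integral b x) /\<^sub>R h) \<longlongrightarrow> orbit_integral b y) (at_right 0)"
    by (rule Lim_transform_eventually)
  moreover have "((\<lambda>h. (T h (orbit_integral b x) - orbit_integral b x) /\<^sub>R h) \<longlongrightarrow> T b x - x) (at_right 0)"
    using orbit_integral_in_generator[OF b] unfolding generator_def by simp
  ultimately show ?thesis by (rule tendsto_unique[rotated]) simp
qed

lemma generatorI:
  assumes "(f \<longlongrightarrow> y) (at_right 0)" "\<forall>\<^sub>F h in at_right 0. f h = (T h x - x) /\<^sub>R h"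
  shows "(x, y) \<in> generator T"
  unfolding generator_def using Lim_transform_eventually[OF assms] by simp

lemma clinear_rel_generator: "clinear_rel (generator T)"
  unfolding clinear_rel_def
proof (intro conjI allI impI)
  have ev: "\<forall>\<^sub>F h in at_right 0. (0::real) \<le> h"
    using eventually_at_right_less[of 0] by eventually_elim simp
  have "\<forall>\<^sub>F h in at_right 0. 0 = (T h 0 - 0) /\<^sub>R h"
    using ev
  proof eventually_elim
    case (elim h)
    then show ?case using T_diff[of h 0 0] by simp
  qed
  then show "(0, 0) \<in> generator T" by (rule generatorI[OF tendsto_const])
  show "(x + x', y + y') \<in> generator T" if "(x, y) \<in> generator T" "(x', y') \<in> generator T" for x y x' y'
  proof -
    have "((\<lambda>h. (T h x - x) /\<^sub>R h + (T h x' - x') /\<^sub>R h) \<longlongrightarrow> y + y') (at_right 0)"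
      using that unfolding generator_def by (intro tendsto_add) auto
    moreover have "\<forall>\<^sub>F h in at_right 0.
        (T h x - x) /\<^sub>R h + (T h x' - x') /\<^sub>R h = (T h (x + x') - (x + x')) /\<^sub>R h"
      using ev
    proof eventually_elim
      case (elim h)
      then show ?case
        using bounded_clinear_add[OF T_bounded_clinear] by (simp add: algebra_simps)
    qed
    ultimately show ?thesis by (rule generatorI)
  qed
  show "(c *\<^sub>C x, c *\<^sub>C y) \<in> generator T" if "(x, y) \<in> generator T" for c x y
  proof -
    have "((\<lambda>h. c *\<^sub>C ((T h x - x) /\<^sub>R h)) \<longlongrightarrow> c *\<^sub>C y) (at_right 0)"
      using that bounded_linear.tendsto[OF bounded_linear_scaleC] unfolding generator_def by auto
    moreover have "\<forall>\<^sub>F h in at_right 0.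
        c *\<^sub>C ((T h x - x) /\<^sub>R h) = (T h (c *\<^sub>C x) - c *\<^sub>C x) /\<^sub>R h"
      using ev
    proof eventually_elim
      case (elim h)
      then show ?case
        using bounded_clinear_scale[OF T_bounded_clinear]
        by (simp add: complex_vector.scale_right_diff_distrib
            linear_cmul[OF bounded_linear.linear[OF bounded_linear_scaleC]])
    qed
    ultimately show ?thesis by (rule generatorI)
  qed
qed

text \<open>The integrated identity \<open>orbit_integral h y = T h x - x\<close> involves only
  bounded operators and so survives limits; differentiating it at \<open>h = 0\<close> recovers
  membership in the generator.\<close>

lemma closed_generator: "closed (generator T)"
  unfolding closed_sequential_limits
proof (intro allI impI, elim conjE)
  fix p l assume p: "\<forall>n. p n \<in> generator T" and l: "p \<longlonglongrightarrow> l"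
  define x y where "x = fst l" and "y = snd l"
  have xy: "(\<lambda>n. fst (p n)) \<longlonglongrightarrow> x" "(\<lambda>n. snd (p n)) \<longlonglongrightarrow> y"
    unfolding x_def y_def using l by (auto intro: tendsto_fst tendsto_snd)
  have eq: "orbit_integral h y = T h x - x" if h: "0 \<le> h" for h
  proof -
    have "(\<lambda>n. orbit_integral h (snd (p n))) \<longlonglongrightarrow> orbit_integral h y"
      by (rule bounded_linear.tendsto[OF bounded_clinear_bounded[OF bounded_clinear_orbit_integral[OF h]] xy(2)])
    moreover have "orbit_integral h (snd (p n)) = T h (fst (p n)) - fst (p n)" for n
      using orbit_integral_generator[OF _ h] p by (metis prod.collapse)
    moreover have "(\<lambda>n. T h (fst (p n)) - fst (p n)) \<longlonglongrightarrow> T h x - x"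
      by (intro tendsto_diff xy(1) bounded_linear.tendsto[OF T_bounded_linear[OF h]])
    ultimately show ?thesis using LIMSEQ_unique by simp
  qed
  have "((\<lambda>h. (orbit_integral (0 + h) y - orbit_integral 0 y) /\<^sub>R h) \<longlongrightarrow> y) (at_right 0)"
    using orbit_integral_quotient[of 0 y] T_zero by simp
  moreover have "\<forall>\<^sub>F h in at_right 0. (orbit_integral (0 + h) y - orbit_integral 0 y) /\<^sub>R h = (T h x - x) /\<^sub>R h"
    using eventually_at_right_less[of 0]
  proof eventually_elim
    case (elim h)
    then show ?case using eq[of h] eq[of 0] T_zero by simp
  qed
  ultimately have "(x, y) \<in> generator T" by (rule generatorI)
  then show "l \<in> generator T" unfolding x_def y_def by simp
qed

text \<open>With \<open>y = A T(t0) x\<close>, the increment \<open>T s x - T r x\<close> is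
  \<open>T (r - t0)\<close> applied to the orbit integral of \<open>y\<close> over a time
  \<open>s - r\<close>. The bound on \<open>y\<close> makes this uniform over bounded sets of
  \<open>x\<close>, beyond what strong continuity gives.\<close>

lemma eventually_lipschitz:
  assumes t0: "0 \<le> t0" and smooth: "\<And>x. \<exists>y. (T t0 x, y) \<in> generator T \<and> norm y \<le> K * norm x"
  obtains L where "L \<ge> 0"
    "\<And>r s x. t0 \<le> r \<Longrightarrow> t0 \<le> s \<Longrightarrow> r \<le> b \<Longrightarrow> s \<le> b \<Longrightarrow> norm (T s x - T r x) \<le> L * \<bar>s - r\<bar> * norm x"
proof -
  obtain M where M: "M \<ge> 1" "\<And>s x. 0 \<le> s \<Longrightarrow> s \<le> b \<Longrightarrow> norm (T s x) \<le> M * norm x"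
    using local_bound[where b = b] by blast
  have main: "norm (T s x - T r x) \<le> M * M * \<bar>K\<bar> * \<bar>s - r\<bar> * norm x" if "t0 \<le> r" "r \<le> s" "s \<le> b" for r s x
  proof -
    obtain y where y: "(T t0 x, y) \<in> generator T" "norm y \<le> K * norm x" using smooth by blast
    have r: "T r x = T (r - t0) (T t0 x)" using T_semigroup[of "r - t0" t0] that t0 by simp
    have "T s x = T (r - t0) (T (s - r) (T t0 x))"
      using T_semigroup[of "r - t0" "s - r" "T t0 x"] T_semigroup[of "s - t0" t0] that t0 by simp
    then have "T s x - T r x = T (r - t0) (orbit_integral (s - r) y)"
      using orbit_integral_generator[OF y(1)] T_diff r that by simp
    then have "norm (T s x - T r x) \<le> M * norm (orbit_integral (s - r) y)" using M(2) that t0 by simp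
    also have "\<dots> \<le> M * ((s - r) * M * norm y)"
      using orbit_integral_bound[of "s - r" M y] M that t0 by (intro mult_left_mono) simp_all
    also have "\<dots> \<le> M * ((s - r) * M * (\<bar>K\<bar> * norm x))"
      using y(2) mult_right_mono[OF abs_ge_self[of K], of "norm x"] M(1) that
      by (intro mult_left_mono) simp_all
    finally show ?thesis using that by (simp add: ac_simps)
  qed
  show thesis
  proof (rule that[of "M * M * \<bar>K\<bar>"])
    show "0 \<le> M * M * \<bar>K\<bar>" using M(1) by simp
    show "norm (T s x - T r x) \<le> M * M * \<bar>K\<bar> * \<bar>s - r\<bar> * norm x"
      if "t0 \<le> r" "t0 \<le> s" "r \<le> b" "s \<le> b" for r s x
      using main[of r s x] main[of s r x] that by (cases "r \<le> s") (auto simp: norm_minus_commute abs_minus_commute)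
  qed
qed

end

section \<open>A concentrating family of trigonometric polynomials\<close>

text \<open>On this interval \<open>abs x <= 2\<close>, so the cubic Taylor error is at most 2/3 of
  \<open>abs x\<close>; the crude constant 1/3 is what remains.\<close>

lemma abs_sin_ge:
  fixes x :: real
  assumes "\<bar>x\<bar> \<le> pi / 2"
  shows "\<bar>x\<bar> / 3 \<le> \<bar>sin x\<bar>"
proof -
  have "\<bar>sin x - (\<Sum>m<3. sin_coeff m * x ^ m)\<bar> \<le> inverse (fact 3) * \<bar>x\<bar> ^ 3"
    by (rule Maclaurin_sin_bound)
  then have "\<bar>sin x - x\<bar> \<le> \<bar>x\<bar> ^ 3 / 6"
    by (simp add: eval_nat_numeral sin_coeff_def)
  moreover have "\<bar>x\<bar> ^ 3 \<le> 4 * \<bar>x\<bar>"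
  proof -
    have "\<bar>x\<bar> \<le> 2" using assms pi_less_4 by linarith
    then have "\<bar>x\<bar> * \<bar>x\<bar> \<le> 2 * 2" by (intro mult_mono) simp_all
    then have "\<bar>x\<bar> * \<bar>x\<bar> * \<bar>x\<bar> \<le> 4 * \<bar>x\<bar>" by (intro mult_right_mono) simp_all
    then show ?thesis by (simp only: power3_eq_cube)
  qed
  ultimately show ?thesis by linarith
qed

text \<open>Normalizing constant of the kernel, a rescaled Wallis integral; its recursion and its
  positivity replace a closed form.\<close>

definition sine_mass :: "real \<Rightarrow> nat \<Rightarrow> real" where
  "sine_mass t m = integral {0..t} (\<lambda>s. sin (pi * s / t) ^ (2 * m))"

lemma sine_power_integrable:
  assumes "t > 0"
  shows "(\<lambda>s. sin (pi * s / t) ^ (2 * m)) integrable_on {0..t}"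
  using assms by (intro integrable_continuous_real continuous_intros) auto

text \<open>Wallis' recursion, obtained by integrating the derivative of \<open>cos \<theta> sin\<^sup>2\<^sup>m\<^sup>+\<^sup>1 \<theta>\<close> over a period.\<close>

lemma sine_mass_Suc:
  assumes t: "t > 0"
  shows "real (2 * m + 1) * sine_mass t m = real (2 * m + 2) * sine_mass t (Suc m)"
proof -
  let ?f = "\<lambda>s. (t / pi) * (cos (pi * s / t) * sin (pi * s / t) ^ (2 * m + 1))"
  let ?g = "\<lambda>s. real (2 * m + 1) * sin (pi * s / t) ^ (2 * m) - real (2 * m + 2) * sin (pi * s / t) ^ (2 * Suc m)"
  have "(?f has_vector_derivative ?g s) (at s within {0..t})" for s
  proof -
    let ?S = "sin (pi * s / t)" and ?C = "cos (pi * s / t)"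
    have S: "((\<lambda>s. sin (pi * s / t)) has_real_derivative ?C * (pi / t)) (at s within {0..t})"
      using t by (auto intro!: derivative_eq_intros)
    have C: "((\<lambda>s. cos (pi * s / t)) has_real_derivative - ?S * (pi / t)) (at s within {0..t})"
      using t by (auto intro!: derivative_eq_intros)
    have "(?f has_real_derivative (t / pi) * (- ?S * (pi / t) * ?S ^ Suc (2 * m) +
        (1 + real (2 * m)) * (?C * (pi / t) * ?S ^ (2 * m)) * ?C)) (at s within {0..t})"
      using DERIV_cmult[OF DERIV_mult[OF C DERIV_power_Suc[OF S, of "2 * m"]], of "t / pi"]
      by simp
    also have "(t / pi) * (- ?S * (pi / t) * ?S ^ Suc (2 * m) +
        (1 + real (2 * m)) * (?C * (pi / t) * ?S ^ (2 * m)) * ?C)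
        = real (2 * m + 1) * ?S ^ (2 * m) * ?C ^ 2 - ?S ^ (2 * m + 2)"
      using t by (simp add: field_simps power2_eq_square)
    also have "\<dots> = ?g s" unfolding cos_squared_eq by (simp add: algebra_simps power2_eq_square)
    finally show ?thesis by (simp only: has_real_derivative_iff_has_vector_derivative)
  qed
  then have "(?g has_integral (?f t - ?f 0)) {0..t}"
    using t by (intro fundamental_theorem_of_calculus) simp_all
  then have "(?g has_integral 0) {0..t}" using t by simp
  moreover have "(?g has_integral (real (2 * m + 1) * sine_mass t m - real (2 * m + 2) * sine_mass t (Suc m))) {0..t}"
    unfolding sine_mass_def
    by (intro has_integral_diff has_integral_mult_right integrable_integral sine_power_integrable t)
  ultimately have "0 = real (2 * m + 1) * sine_mass t m - real (2 * m + 2) * sine_mass t (Suc m)"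
    by (rule has_integral_unique)
  then show ?thesis by linarith
qed

lemma sine_mass_pos: "t > 0 \<Longrightarrow> sine_mass t m > 0"
proof (induction m)
  case 0
  then show ?case by (simp add: sine_mass_def)
next
  case (Suc m)
  then have "real (2 * m + 2) * sine_mass t (Suc m) > 0"
    using sine_mass_Suc[of t m] by (metis mult_pos_pos of_nat_0_less_iff add_gr_0 zero_less_one)
  then show ?case by (simp add: zero_less_mult_iff)
qed

text \<open>The distance to \<open>t / 2\<close> is at most \<open>t\<close> times
  \<open>abs c\<close> with \<open>c = cos (pi s / t)\<close>, and
  \<open>abs c <= n + c^2 / (4 n)\<close>. Integrating \<open>sin^(2m) c^2\<close> gives a
  difference of consecutive masses, which by the Wallis recursion is the fraction
  \<open>1 / (2m + 2)\<close> of the mass.\<close>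

lemma sine_mass_concentrates:
  assumes t: "t > 0" and e: "e > 0"
  obtains m where
    "integral {0..t} (\<lambda>s. sin (pi * s / t) ^ (2 * m) * \<bar>s - t / 2\<bar>) \<le> e * sine_mass t m"
proof -
  \<comment> \<open>This makes the constant part \<open>t n\<close> equal to \<open>e / 2\<close>;
    \<open>m\<close> is then taken so large that the other part is at most \<open>e / 2\<close>
    too.\<close>
  define n where "n = e / (2 * t)"
  have n: "n > 0" unfolding n_def using t e by simp
  obtain m where m: "t / (4 * n) / (e / 2) \<le> real m" using real_arch_simple by blast
  have "t / (4 * n) \<le> real m * (e / 2)" using m e by (simp only: pos_divide_le_eq half_gt_zero)
  then have "t / (4 * n) \<le> e / 2 * real m" by (simp only: mult.commute)
  also have "\<dots> \<le> e / 2 * real (2 * m + 2)" using e by simp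
  finally have m': "t / (4 * n) / real (2 * m + 2) \<le> e / 2"
    using pos_divide_le_eq[of "real (2 * m + 2)" "t / (4 * n)" "e / 2"] by linarith
  let ?g = "\<lambda>s. sin (pi * s / t) ^ (2 * m)" and ?h = "\<lambda>s. sin (pi * s / t) ^ (2 * Suc m)"
  have pt: "?g s * \<bar>s - t / 2\<bar> \<le> t * n * ?g s + t / (4 * n) * (?g s - ?h s)" if s: "s \<in> {0..t}" for s
  proof -
    define c where "c = cos (pi * s / t)"
    define u where "u = pi * s / t - pi / 2"
    have "\<bar>u\<bar> \<le> pi / 2"
      using s t unfolding u_def abs_le_iff by (auto simp: field_simps)
    then have "\<bar>u\<bar> / 3 \<le> \<bar>sin u\<bar>" by (rule abs_sin_ge)
    moreover have "sin u = - c" unfolding u_def c_def by (simp add: sin_diff)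
    moreover have "\<bar>u\<bar> = pi / t * \<bar>s - t / 2\<bar>"
    proof -
      have "u = pi / t * (s - t / 2)" unfolding u_def using t by (simp add: field_simps)
      then show ?thesis using t by (simp add: abs_mult)
    qed
    ultimately have "pi * \<bar>s - t / 2\<bar> \<le> 3 * (t * \<bar>c\<bar>)" using t by (simp add: field_simps)
    \<comment> \<open>\<open>pi > 3\<close> absorbs the constant 3 of
      \<open>abs_sin_ge\<close>.\<close>
    moreover have "3 * \<bar>s - t / 2\<bar> \<le> pi * \<bar>s - t / 2\<bar>" using pi_gt3 by (intro mult_right_mono) simp_all
    ultimately have "3 * \<bar>s - t / 2\<bar> \<le> 3 * (t * \<bar>c\<bar>)" by (rule order_trans[rotated])
    then have 1: "\<bar>s - t / 2\<bar> \<le> t * \<bar>c\<bar>" by simp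
    have "0 \<le> (2 * n - \<bar>c\<bar>)\<^sup>2" by simp
    then have "4 * n * \<bar>c\<bar> \<le> 4 * n\<^sup>2 + c\<^sup>2" by (simp add: power2_diff)
    then have "\<bar>c\<bar> \<le> n + c\<^sup>2 / (4 * n)" using n by (simp add: field_simps power2_eq_square)
    then have "t * \<bar>c\<bar> \<le> t * (n + c\<^sup>2 / (4 * n))" using t by simp
    with 1 have "\<bar>s - t / 2\<bar> \<le> t * (n + c\<^sup>2 / (4 * n))" by (rule order_trans)
    then have "?g s * \<bar>s - t / 2\<bar> \<le> ?g s * (t * (n + c\<^sup>2 / (4 * n)))"
      by (intro mult_left_mono) simp_all
    also have "\<dots> = t * n * ?g s + t / (4 * n) * (?g s * c\<^sup>2)" by (simp add: algebra_simps)
    also have "?g s * c\<^sup>2 = ?g s - ?h s"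
      unfolding c_def cos_squared_eq by (simp add: algebra_simps power2_eq_square)
    finally show ?thesis .
  qed
  have int: "(\<lambda>s. ?g s * \<bar>s - t / 2\<bar>) integrable_on {0..t}"
    using t by (intro integrable_continuous_real continuous_intros) auto
  have "((\<lambda>s. t * n * ?g s + t / (4 * n) * (?g s - ?h s)) has_integral
      t * n * sine_mass t m + t / (4 * n) * (sine_mass t m - sine_mass t (Suc m))) {0..t}"
    unfolding sine_mass_def
    by (intro has_integral_add has_integral_mult_right has_integral_diff
        integrable_integral sine_power_integrable t)
  then have "integral {0..t} (\<lambda>s. ?g s * \<bar>s - t / 2\<bar>) \<le>
      t * n * sine_mass t m + t / (4 * n) * (sine_mass t m - sine_mass t (Suc m))"
    using has_integral_le[OF integrable_integral[OF int]] pt by blast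
  also have "sine_mass t m - sine_mass t (Suc m) = sine_mass t m / real (2 * m + 2)"
    using sine_mass_Suc[OF t, of m] by (simp add: field_simps)
  also have "t / (4 * n) * (sine_mass t m / real (2 * m + 2)) = t / (4 * n) / real (2 * m + 2) * sine_mass t m"
    by simp
  also have "\<dots> \<le> e / 2 * sine_mass t m"
    using m' sine_mass_pos[OF t, of m] by (intro mult_right_mono) simp_all
  also have "t * n * sine_mass t m + e / 2 * sine_mass t m = e * sine_mass t m"
    unfolding n_def using t by (simp add: field_simps)
  finally show thesis using that[of m] by simp
qed

text \<open>Binomial expansion of Euler's formula. At \<open>x = pi s / t\<close> the exponents have
  frequencies that are integer multiples of \<open>2 pi / t\<close>, exactly the spacing of the
  logarithms.\<close>

lemma sine_power_expansion:
  obtains b :: "nat \<Rightarrow> complex" where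
    "\<And>x::real. complex_of_real (sin x ^ (2 * m)) =
      (\<Sum>k\<le>2 * m. b k * exp (2 * \<i> * complex_of_real x * (of_nat k - of_nat m)))"
proof
  let ?b = "\<lambda>k. of_nat (2 * m choose k) * (- 1) ^ (2 * m - k) / (2 * \<i>) ^ (2 * m)"
  fix x :: real
  let ?w = "\<i> * complex_of_real x"
  have sinx: "complex_of_real (sin x) = (exp ?w + - exp (- ?w)) / (2 * \<i>)"
    using sin_exp_eq[of "complex_of_real x"] by (simp add: sin_of_real)
  have expand: "exp ?w ^ k * (- exp (- ?w)) ^ (2 * m - k) =
      (- 1) ^ (2 * m - k) * exp (2 * ?w * (of_nat k - of_nat m))" if "k \<le> 2 * m" for k
  proof -
    have "exp ?w ^ k * exp (- ?w) ^ (2 * m - k) = exp (of_nat k * ?w + of_nat (2 * m - k) * (- ?w))"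
      by (simp only: exp_add exp_of_nat_mult)
    also have "of_nat k * ?w + of_nat (2 * m - k) * (- ?w) = 2 * ?w * (of_nat k - of_nat m)"
      using that by (simp add: of_nat_diff algebra_simps)
    finally show ?thesis by (subst power_minus) (simp add: ac_simps)
  qed
  have "complex_of_real (sin x ^ (2 * m)) = (exp ?w + - exp (- ?w)) ^ (2 * m) / (2 * \<i>) ^ (2 * m)"
    unfolding of_real_power sinx power_divide ..
  also have "(exp ?w + - exp (- ?w)) ^ (2 * m) =
      (\<Sum>k\<le>2 * m. of_nat (2 * m choose k) * (exp ?w ^ k * (- exp (- ?w)) ^ (2 * m - k)))"
    by (simp only: binomial_ring mult.assoc)
  also have "\<dots> = (\<Sum>k\<le>2 * m. of_nat (2 * m choose k) *
      ((- 1) ^ (2 * m - k) * exp (2 * ?w * (of_nat k - of_nat m))))"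
    by (intro sum.cong refl) (simp only: expand atMost_iff)
  also have "\<dots> / (2 * \<i>) ^ (2 * m) = (\<Sum>k\<le>2 * m. ?b k * exp (2 * ?w * (of_nat k - of_nat m)))"
    unfolding sum_divide_distrib by (intro sum.cong refl) simp
  finally show "complex_of_real (sin x ^ (2 * m)) =
      (\<Sum>k\<le>2 * m. ?b k * exp (2 * \<i> * complex_of_real x * (of_nat k - of_nat m)))"
    by (simp add: mult.assoc)
qed

section \<open>Rescaled semigroups\<close>

lemma bounded_bilinear_scaleC: "bounded_bilinear (\<lambda>a x::'a::complex_normed_vector. a *\<^sub>C x)"
proof
  show "(r *\<^sub>R a) *\<^sub>C x = r *\<^sub>R (a *\<^sub>C x)" for r a and x :: 'a
    by (simp add: scaleR_scaleC scaleR_conv_of_real)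
  show "a *\<^sub>C (r *\<^sub>R x) = r *\<^sub>R (a *\<^sub>C x)" for r a and x :: 'a
    by (rule scaleC_scaleR)
  show "\<exists>K. \<forall>a (x::'a). norm (a *\<^sub>C x) \<le> norm a * norm x * K"
    by (intro exI[of _ 1]) (simp add: norm_scaleC)
qed (simp_all add: scaleC_add_left scaleC_add_right)

text \<open>The factor \<open>exp(-mu s)\<close> moves the generator to \<open>A - mu\<close>, so
  facts about generators apply directly to shifts.\<close>

definition rescale :: "(real \<Rightarrow> 'a::complex_banach \<Rightarrow> 'a) \<Rightarrow> complex \<Rightarrow> real \<Rightarrow> 'a \<Rightarrow> 'a" where
  "rescale T \<mu> s x = exp (- \<mu> * complex_of_real s) *\<^sub>C T s x"

lemma rescale_inverse: "rescale (rescale T \<mu>) (- \<mu>) = T"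
  unfolding rescale_def by (intro ext) (simp add: scaleC_scaleC exp_minus)

context c0_semigroup begin

lemma c0_semigroup_rescale: "c0_semigroup (rescale T \<mu>)"
proof
  show "C0_semigroup (rescale T \<mu>)"
    unfolding C0_semigroup_def
  proof (intro conjI allI impI)
    show "bounded_clinear (rescale T \<mu> t)" if "0 \<le> t" for t
      unfolding rescale_def[abs_def] using bounded_clinear_scaleC[OF T_bounded_clinear[OF that]] .
    show "rescale T \<mu> 0 x = x" for x unfolding rescale_def by (simp add: T_zero)
    show "rescale T \<mu> (s + t) x = rescale T \<mu> s (rescale T \<mu> t x)" if "0 \<le> s" "0 \<le> t" for s t x
      unfolding rescale_def bounded_clinear_scale[OF T_bounded_clinear[OF that(1)]] T_semigroup[OF that]
      by (simp add: scaleC_scaleC exp_add[symmetric] algebra_simps)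
    show "((\<lambda>t. rescale T \<mu> t x) \<longlongrightarrow> x) (at_right 0)" for x
    proof -
      have "((\<lambda>t. exp (- \<mu> * complex_of_real t)) \<longlongrightarrow> exp (- \<mu> * complex_of_real 0)) (at_right 0)"
        by (intro tendsto_intros)
      from bounded_bilinear.tendsto[OF bounded_bilinear_scaleC this T_tendsto[of x]]
      show ?thesis unfolding rescale_def by simp
    qed
  qed
qed

lemma generator_rescale_aux:
  assumes xy: "(x, y) \<in> generator T"
  shows "(x, y - \<mu> *\<^sub>C x) \<in> generator (rescale T \<mu>)"
proof -
  let ?e = "\<lambda>h. exp (- \<mu> * complex_of_real h)"
  have e0: "(?e \<longlongrightarrow> ?e 0) (at_right 0)" by (intro tendsto_intros)
  have "((\<lambda>z. exp (- \<mu> * z)) has_field_derivative - \<mu>) (at 0)"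
    by (auto intro!: derivative_eq_intros)
  then have D: "((\<lambda>z. (exp (- \<mu> * (0 + z)) - exp (- \<mu> * 0)) / z) \<longlongrightarrow> - \<mu>) (at 0)"
    unfolding DERIV_def .
  have "filterlim complex_of_real (at (complex_of_real 0)) (at_right 0)"
    unfolding filterlim_at
  proof
    show "\<forall>\<^sub>F h in at_right 0. complex_of_real h \<in> UNIV \<and> complex_of_real h \<noteq> complex_of_real 0"
      by (rule eventually_mono[OF eventually_at_right_less[of 0]]) simp
    show "(complex_of_real \<longlongrightarrow> complex_of_real 0) (at_right 0)"
      by (intro tendsto_of_real tendsto_ident_at)
  qed
  then have D': "((\<lambda>h. (?e h - 1) / complex_of_real h) \<longlongrightarrow> - \<mu>) (at_right 0)"
    using filterlim_compose[OF D, of complex_of_real "at_right 0"] by simp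
  have "((\<lambda>h. ?e h *\<^sub>C ((T h x - x) /\<^sub>R h) + ((?e h - 1) / complex_of_real h) *\<^sub>C x)
      \<longlongrightarrow> ?e 0 *\<^sub>C y + (- \<mu>) *\<^sub>C x) (at_right 0)"
    using xy unfolding generator_def
    by (intro tendsto_add bounded_bilinear.tendsto[OF bounded_bilinear_scaleC] e0 D' tendsto_const) auto
  moreover have "?e 0 *\<^sub>C y + (- \<mu>) *\<^sub>C x = y - \<mu> *\<^sub>C x" by simp
  moreover have "\<forall>\<^sub>F h in at_right 0. ?e h *\<^sub>C ((T h x - x) /\<^sub>R h) + ((?e h - 1) / complex_of_real h) *\<^sub>C x
      = (rescale T \<mu> h x - x) /\<^sub>R h"
    using eventually_at_right_less[of 0]
  proof eventually_elim
    case (elim h)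
    have "?e h *\<^sub>C ((T h x - x) /\<^sub>R h) = (?e h *\<^sub>C T h x - ?e h *\<^sub>C x) /\<^sub>R h"
      unfolding scaleC_scaleR complex_vector.scale_right_diff_distrib ..
    moreover have "((?e h - 1) / complex_of_real h) *\<^sub>C x = (?e h *\<^sub>C x - x) /\<^sub>R h"
    proof -
      have "(?e h - 1) / complex_of_real h = complex_of_real (inverse h) * (?e h - 1)"
        by (simp add: divide_inverse mult.commute)
      then have "((?e h - 1) / complex_of_real h) *\<^sub>C x = inverse h *\<^sub>R ((?e h - 1) *\<^sub>C x)"
        by (simp only: scaleR_scaleC)
      then show ?thesis
        by (simp only: complex_vector.scale_left_diff_distrib complex_vector.scale_one)
    qed
    ultimately show ?case unfolding rescale_def by (simp add: scaleR_add_right[symmetric])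
  qed
  ultimately show ?thesis
    using c0_semigroup.generatorI[OF c0_semigroup_rescale] by simp
qed

lemma generator_rescale: "generator (rescale T \<mu>) = shift (generator T) \<mu>"
proof
  show "shift (generator T) \<mu> \<subseteq> generator (rescale T \<mu>)"
    unfolding shift_def using generator_rescale_aux by blast
  \<comment> \<open>The forward inclusion for the rescaled semigroup and \<open>-mu\<close>, which
    undoes the rescaling.\<close>
  show "generator (rescale T \<mu>) \<subseteq> shift (generator T) \<mu>"
  proof
    fix p assume p: "p \<in> generator (rescale T \<mu>)"
    obtain x y where xy: "p = (x, y)" by (cases p)
    have "(x, y - (- \<mu>) *\<^sub>C x) \<in> generator T"
      using c0_semigroup.generator_rescale_aux[OF c0_semigroup_rescale, of x y \<mu> "- \<mu>"] p xy
      by (simp add: rescale_inverse)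
    then show "p \<in> shift (generator T) \<mu>"
      unfolding shift_def xy by (auto intro!: exI[of _ "y - (- \<mu>) *\<^sub>C x"])
  qed
qed

lemma orbit_integral_bicommutant:
  assumes b: "0 \<le> b" and mem: "\<And>s. 0 \<le> s \<Longrightarrow> T s \<in> bicommutant M"
  shows "orbit_integral b \<in> bicommutant M"
proof (rule commutantI[OF bounded_clinear_orbit_integral[OF b]])
  fix g x assume g: "g \<in> commutant M"
  have "g (orbit_integral b x) = integral {0..b} (\<lambda>s. g (T s x))"
    by (rule bounded_linear_orbit_integral[OF bounded_clinear_bounded[OF commutant_bounded[OF g]]])
  also have "\<dots> = orbit_integral b (g x)"
    unfolding orbit_integral_def using commutantD[OF mem g] by (intro integral_cong) simp
  finally show "orbit_integral b (g x) = g (orbit_integral b x)" by simp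
qed

text \<open>The kernel \<open>sin\<^sup>2\<^sup>m (\<pi>s/t)\<close> concentrates at \<open>s = t/2\<close>, where the orbit is Lipschitz uniformly on
  bounded sets, so the averages converge in operator norm.\<close>

lemma sine_average_approximates:
  assumes t: "t > 0" and e: "e > 0" and a: "t0 \<le> a" "0 \<le> t0"
    and smooth: "\<And>x. \<exists>y. (T t0 x, y) \<in> generator T \<and> norm y \<le> K * norm x"
  shows "\<exists>m. \<forall>x. norm (inverse (sine_mass t m) *\<^sub>R
      integral {0..t} (\<lambda>s. sin (pi * s / t) ^ (2 * m) *\<^sub>R T s (T a x)) - T (a + t / 2) x) \<le> e * norm x"
proof -
  obtain L where L: "L \<ge> 0" "\<And>r s x. t0 \<le> r \<Longrightarrow> t0 \<le> s \<Longrightarrow> r \<le> a + t \<Longrightarrow> s \<le> a + t \<Longrightarrow>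
      norm (T s x - T r x) \<le> L * \<bar>s - r\<bar> * norm x"
    using eventually_lipschitz[OF a(2) smooth, where b = "a + t"] by blast
  \<comment> \<open>\<open>L + 1\<close> replaces \<open>L\<close> because \<open>L\<close> may be
    0.\<close>
  have "e / (L + 1) > 0" using e L(1) by simp
  then obtain m where m: "integral {0..t} (\<lambda>s. sin (pi * s / t) ^ (2 * m) * \<bar>s - t / 2\<bar>)
      \<le> e / (L + 1) * sine_mass t m"
    using sine_mass_concentrates[OF t] by blast
  let ?g = "\<lambda>s. sin (pi * s / t) ^ (2 * m)" and ?k = "sine_mass t m"
  have k: "?k > 0" by (rule sine_mass_pos[OF t])
  have gcont: "continuous_on {0..t} ?g" using t by (intro continuous_intros) auto
  have "norm (inverse ?k *\<^sub>R integral {0..t} (\<lambda>s. ?g s *\<^sub>R T s (T a x)) - T (a + t / 2) x) \<le> e * norm x" for x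
  proof -
    let ?I = "integral {0..t} (\<lambda>s. ?g s *\<^sub>R T s (T a x))"
    have i1: "(\<lambda>s. ?g s *\<^sub>R T s (T a x)) integrable_on {0..t}"
      by (intro integrable_continuous_real continuous_on_scaleR gcont orbit_continuous)
    have i2: "(\<lambda>s. ?g s *\<^sub>R T (a + t / 2) x) integrable_on {0..t}"
      by (intro integrable_continuous_real continuous_on_scaleR gcont continuous_on_const)
    have "integral {0..t} (\<lambda>s. ?g s *\<^sub>R T (a + t / 2) x) = ?k *\<^sub>R T (a + t / 2) x"
      using integral_linear[OF sine_power_integrable[OF t, of m] bounded_linear_scaleR_left[of "T (a + t / 2) x"]]
      unfolding sine_mass_def o_def by simp
    then have "?I - ?k *\<^sub>R T (a + t / 2) x = integral {0..t} (\<lambda>s. ?g s *\<^sub>R T s (T a x) - ?g s *\<^sub>R T (a + t / 2) x)"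
      using Henstock_Kurzweil_Integration.integral_diff[OF i1 i2] by simp
    moreover have "norm (integral {0..t} (\<lambda>s. ?g s *\<^sub>R T s (T a x) - ?g s *\<^sub>R T (a + t / 2) x))
        \<le> integral {0..t} (\<lambda>s. L * norm x * (?g s * \<bar>s - t / 2\<bar>))"
    proof (rule Henstock_Kurzweil_Integration.integral_norm_bound_integral)
      show "(\<lambda>s. ?g s *\<^sub>R T s (T a x) - ?g s *\<^sub>R T (a + t / 2) x) integrable_on {0..t}"
        by (rule Henstock_Kurzweil_Integration.integrable_diff[OF i1 i2])
      show "(\<lambda>s. L * norm x * (?g s * \<bar>s - t / 2\<bar>)) integrable_on {0..t}"
        by (intro integrable_continuous_real continuous_on_mult gcont continuous_intros)
      fix s assume s: "s \<in> {0..t}"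
      \<comment> \<open>Starting the orbit at \<open>T a x\<close> keeps it past \<open>t0\<close>,
        where the Lipschitz bound holds; at \<open>s = t / 2\<close> it passes through
        \<open>T (a + t / 2) x\<close>.\<close>
      have "T s (T a x) = T (s + a) x" using T_semigroup[of s a] s a by simp
      then have "norm (T s (T a x) - T (a + t / 2) x) \<le> L * \<bar>s - t / 2\<bar> * norm x"
        using L(2)[of "a + t / 2" "s + a" x] s a t by simp
      moreover have g0: "0 \<le> ?g s" by simp
      ultimately have "?g s * norm (T s (T a x) - T (a + t / 2) x) \<le> ?g s * (L * \<bar>s - t / 2\<bar> * norm x)"
        by (intro mult_left_mono)
      then show "norm (?g s *\<^sub>R T s (T a x) - ?g s *\<^sub>R T (a + t / 2) x) \<le> L * norm x * (?g s * \<bar>s - t / 2\<bar>)"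
        unfolding scaleR_diff_right[symmetric] norm_scaleR abs_of_nonneg[OF g0] by (simp only: ac_simps)
    qed
    moreover have "integral {0..t} (\<lambda>s. L * norm x * (?g s * \<bar>s - t / 2\<bar>))
        = L * norm x * integral {0..t} (\<lambda>s. ?g s * \<bar>s - t / 2\<bar>)"
      by (simp only: integral_mult_right)
    ultimately have "norm (?I - ?k *\<^sub>R T (a + t / 2) x)
        \<le> L * norm x * integral {0..t} (\<lambda>s. ?g s * \<bar>s - t / 2\<bar>)"
      by (simp only:)
    also have "\<dots> \<le> L * norm x * (e / (L + 1) * ?k)"
      using m L(1) by (intro mult_left_mono) simp_all
    also have "\<dots> \<le> ?k * (e * norm x)"
    proof -
      have "L / (L + 1) \<le> 1" using L(1) by simp
      then have "L / (L + 1) * (?k * (e * norm x)) \<le> 1 * (?k * (e * norm x))"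
        using k e by (intro mult_right_mono) simp_all
      then show ?thesis by (simp add: ac_simps)
    qed
    finally have le: "norm (?I - ?k *\<^sub>R T (a + t / 2) x) \<le> ?k * (e * norm x)" .
    have "inverse ?k *\<^sub>R ?I - T (a + t / 2) x = inverse ?k *\<^sub>R (?I - ?k *\<^sub>R T (a + t / 2) x)"
      using k by (simp add: scaleR_diff_right)
    then have "norm (inverse ?k *\<^sub>R ?I - T (a + t / 2) x) = inverse ?k * norm (?I - ?k *\<^sub>R T (a + t / 2) x)"
      using k by simp
    also have "\<dots> \<le> inverse ?k * (?k * (e * norm x))" using le k by (intro mult_left_mono) simp_all
    also have "\<dots> = e * norm x" using k by simp
    finally show ?thesis .
  qed
  then show ?thesis by (intro exI[of _ m] allI)
qed

end

section \<open>The factorization of \<open>T(t) - e\<^sup>\<mu>\<^sup>t\<close>\<close>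

text \<open>The solutions \<open>nu\<close> of \<open>exp(nu t) = exp(mu t)\<close>, spaced by
  \<open>2 pi i / t\<close>.\<close>

definition lattice_point :: "complex \<Rightarrow> real \<Rightarrow> int \<Rightarrow> complex" where
  "lattice_point \<mu> t n = \<mu> + 2 * complex_of_real pi * \<i> * of_int n / complex_of_real t"

lemma exp_eq_lattice_point:
  assumes "t > 0"
  shows "exp (\<nu> * complex_of_real t) = exp (\<mu> * complex_of_real t) \<longleftrightarrow> (\<exists>n. \<nu> = lattice_point \<mu> t n)"
proof -
  have "\<nu> * complex_of_real t = \<mu> * complex_of_real t + complex_of_real (of_int (2 * n) * pi) * \<i>
      \<longleftrightarrow> \<nu> = lattice_point \<mu> t n" for n
    using assms unfolding lattice_point_def by (simp add: field_simps)
  then show ?thesis unfolding exp_eq by simp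
qed

context c0_semigroup begin

lemma factorization:
  fixes \<mu> :: complex
  assumes t: "t > 0" and t0: "t0 > 0" and bp: "bounded_product (generator T) (T t0)"
  shows "\<exists>A P C C0 F. operator_factorization A (\<lambda>n. shift (generator T) (lattice_point \<mu> t n)) P C
    (\<lambda>x. T t x - exp (\<mu> * complex_of_real t) *\<^sub>C x) C0 F"
proof -
  interpret R: c0_semigroup "rescale T \<nu>" for \<nu> by (rule c0_semigroup_rescale)
  define A where "A = bicommutant (T ` {0..})"
  interpret A: commuting_operators A
    unfolding A_def
    by (rule commuting_operators_bicommutant) (auto intro: T_bounded_clinear T_commute)
  define z where "z = exp (\<mu> * complex_of_real t)"
  define U where "U = rescale T \<mu>"
  define B where "B x = T t x - z *\<^sub>C x" for x
  have z: "z \<noteq> 0" unfolding z_def by simp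
  have A_bounded: "bounded_clinear f" if "f \<in> A" for f
    using commutant_bounded that unfolding A_def .
  have scale_mem: "(\<lambda>x. c *\<^sub>C f x) \<in> A" if "f \<in> A" for c f
    using bicommutant_scaleC that unfolding A_def .
  have T_mem: "T s \<in> A" if "0 \<le> s" for s
    unfolding A_def by (rule bicommutant_superset[OF _ T_bounded_clinear[OF that]]) (simp add: that)
  have R_mem: "rescale T \<nu> s \<in> A" if "0 \<le> s" for \<nu> s
    unfolding rescale_def[abs_def] by (rule scale_mem[OF T_mem[OF that]])
  have U_mem: "U s \<in> A" if "0 \<le> s" for s unfolding U_def by (rule R_mem[OF that])
  have U_add: "U s (x + y) = U s x + U s y" if "0 \<le> s" for s x y by (rule A.op_add[OF U_mem[OF that]])
  have U_semigroup: "U (r + s) x = U r (U s x)" if "0 \<le> r" "0 \<le> s" for r s x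
    unfolding U_def by (rule R.T_semigroup[OF that])
  have B_mem: "B \<in> A"
    using A.add_mem[OF T_mem[of t] scale_mem[OF A.id_mem, of "- z"]] t unfolding B_def[abs_def] by simp

  \<comment> \<open>The factor \<open>z\<close> makes the image independent of \<open>n\<close>: as
    \<open>exp(mu_n t) = z\<close>, one has
    \<open>z (exp(-mu_n t) T(t) - I) = T(t) - z\<close>.\<close>
  define P where "P n x = z *\<^sub>C R.orbit_integral (lattice_point \<mu> t n) t x" for n x
  have P_mem: "P n \<in> A" for n
  proof -
    have "R.orbit_integral (lattice_point \<mu> t n) t \<in> A"
      unfolding A_def using R.orbit_integral_bicommutant[of t] R_mem t unfolding A_def by simp
    then show ?thesis unfolding P_def[abs_def] by (rule scale_mem)
  qed
  have z_lattice: "z *\<^sub>C (rescale T (lattice_point \<mu> t n) t x - x) = B x" for n x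
  proof -
    have "exp (lattice_point \<mu> t n * complex_of_real t) = z"
      unfolding z_def exp_eq_lattice_point[OF t] by blast
    then have "z * exp (- lattice_point \<mu> t n * complex_of_real t) = 1" using z by (simp add: exp_minus)
    then show ?thesis
      unfolding B_def rescale_def by (simp add: complex_vector.scale_right_diff_distrib scaleC_scaleC)
  qed
  have P_in_S: "(P n x, B x) \<in> shift (generator T) (lattice_point \<mu> t n)" for n x
    using clinear_rel_scale[OF R.clinear_rel_generator R.orbit_integral_in_generator, of t z "lattice_point \<mu> t n" x] t
    unfolding z_lattice P_def generator_rescale by simp
  have P_S: "P n y = B x" if "(x, y) \<in> shift (generator T) (lattice_point \<mu> t n)" for n x y
    using R.orbit_integral_generator[of x y "lattice_point \<mu> t n" t] that t
    unfolding P_def generator_rescale by (simp add: z_lattice)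

  have U_t: "U t x = x + inverse z *\<^sub>C B x" for x
    unfolding U_def rescale_def B_def z_def
    by (simp add: complex_vector.scale_right_diff_distrib scaleC_scaleC exp_minus)
  \<comment> \<open>Since \<open>U t = I + B / z\<close>, the rescaled semigroup has period
    \<open>t\<close> modulo multiples of \<open>B\<close>; the cofactor accumulates by
    induction.\<close>
  have U_power: "\<exists>D\<in>A. \<forall>x. U (real k * t) x = x + B (D x)" for k
  proof (induction k)
    case 0
    show ?case
      by (rule bexI[OF _ A.zero_mem]) (simp add: U_def R.T_zero A.op_zero[OF B_mem])
  next
    case (Suc k)
    then obtain D where D: "D \<in> A" "\<And>x. U (real k * t) x = x + B (D x)" by blast
    let ?D = "\<lambda>x. inverse z *\<^sub>C x + U t (D x)"
    have "U (real (Suc k) * t) x = x + B (?D x)" for x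
    proof -
      have "U (real (Suc k) * t) x = U t (U (real k * t) x)"
        using U_semigroup[of t "real k * t" x] t by (simp add: algebra_simps)
      also have "\<dots> = U t x + B (U t (D x))"
        unfolding D(2) using U_add[of t] A.op_commute[OF B_mem U_mem[of t]] t by simp
      also have "\<dots> = x + B (inverse z *\<^sub>C x) + B (U t (D x))"
        unfolding U_t[of x] bounded_clinear_scale[OF A_bounded[OF B_mem]] ..
      finally show ?thesis by (simp add: A.op_add[OF B_mem] add.assoc)
    qed
    moreover have "?D \<in> A"
      by (rule A.add_mem[OF scale_mem[OF A.id_mem] A.comp_mem[OF U_mem D(1)]]) (use t in simp)
    ultimately show ?case by (intro bexI[of _ ?D] allI)
  qed

  \<comment> \<open>\<open>a\<close> is a multiple of \<open>t\<close>, so that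
    \<open>U (a + t)\<close> is congruent to the identity, and at least \<open>t0\<close>, so that
    the Lipschitz estimate applies.\<close>
  obtain N where N: "t0 / t \<le> real N" using real_arch_simple by blast
  define a where "a = real N * t"
  have a: "t0 \<le> a" "0 \<le> a" using N t t0 unfolding a_def by (simp_all add: field_simps)
  have a_t: "real (Suc N) * t = a + t" unfolding a_def by (simp add: algebra_simps)
  obtain D where D: "D \<in> A" "\<And>x. U (a + t) x = x + B (D x)"
    using U_power[of "Suc N"] unfolding a_t by blast
  obtain Q where Q: "bounded_clinear Q" "op_graph (T t0) O generator T = op_graph Q"
    using bp unfolding bounded_product_def by blast
  \<comment> \<open>\<open>Q'\<close> is \<open>(A - mu) U(t0)\<close>, the bounded product carried
    over to the rescaled semigroup.\<close>
  define Q' where "Q' x = exp (- \<mu> * complex_of_real t0) *\<^sub>C (Q x + (- \<mu>) *\<^sub>C T t0 x)" for x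
  have "(T t0 x, Q x) \<in> generator T" for x
  proof -
    have "(x, Q x) \<in> op_graph (T t0) O generator T" unfolding Q(2) by (simp add: op_graph_def)
    then show ?thesis by (auto simp: op_graph_def)
  qed
  then have "(T t0 x, Q x + (- \<mu>) *\<^sub>C T t0 x) \<in> generator U" for x
    unfolding U_def generator_rescale shift_def by force
  then have Q'_gen: "(U t0 x, Q' x) \<in> generator U" for x
    using clinear_rel_scale[OF R.clinear_rel_generator, of "T t0 x" "Q x + (- \<mu>) *\<^sub>C T t0 x" \<mu>]
    unfolding U_def Q'_def rescale_def[of T \<mu> t0] by blast
  have "bounded_clinear Q'"
    unfolding Q'_def[abs_def]
    by (rule bounded_clinear_scaleC[OF bounded_clinear_plus[OF Q(1)
          bounded_clinear_scaleC[OF T_bounded_clinear]]]) (use t0 in simp)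
  then obtain K where K: "\<And>x. norm (Q' x) \<le> K * norm x"
    using bounded_linear.bounded[OF bounded_clinear_bounded] by (metis mult.commute)
  have smooth: "\<exists>y. (U t0 x, y) \<in> generator U \<and> norm y \<le> K * norm x" for x
    using Q'_gen K by blast
  obtain K1 where K1: "K1 \<ge> 1" "\<And>s x. 0 \<le> s \<Longrightarrow> s \<le> t / 2 \<Longrightarrow> norm (U s x) \<le> K1 * norm x"
    unfolding U_def using R.local_bound[where b = "t / 2"] by blast
  \<comment> \<open>The approximation error is later hit by \<open>U (t / 2)\<close>, of norm at
    most \<open>K1\<close>; accuracy \<open>1 / (2 K1)\<close> thus leaves \<open>E\<close> with
    norm at most 1/2.\<close>
  have e: "1 / (2 * K1) > 0" and t0': "0 \<le> t0" using K1(1) t0 by simp_all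
  obtain m where m: "\<And>x. norm (inverse (sine_mass t m) *\<^sub>R
      integral {0..t} (\<lambda>s. sin (pi * s / t) ^ (2 * m) *\<^sub>R U s (U a x)) - U (a + t / 2) x)
      \<le> 1 / (2 * K1) * norm x"
    using R.sine_average_approximates[OF t e a(1) t0' smooth[unfolded U_def], folded U_def] by blast
  obtain b :: "nat \<Rightarrow> complex" where b: "\<And>x::real. complex_of_real (sin x ^ (2 * m)) =
      (\<Sum>k\<le>2 * m. b k * exp (2 * \<i> * complex_of_real x * (of_nat k - of_nat m)))"
    using sine_power_expansion[of m] by blast
  define F where "F = {- int m..int m}"
  \<comment> \<open>The expansion index \<open>k\<close> corresponds to \<open>n = m - k\<close>,
    the sign flipping because \<open>rescale\<close> uses \<open>exp(-mu_n s)\<close>. Dividing by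
    \<open>z\<close> cancels the factor built into \<open>P n\<close>.\<close>
  define d where "d n = complex_of_real (inverse (sine_mass t m)) * b (nat (int m - n)) / z" for n
  define G where "G y = (\<Sum>n\<in>F. P n (d n *\<^sub>C y))" for y
  have G_eq: "inverse (sine_mass t m) *\<^sub>R integral {0..t} (\<lambda>s. sin (pi * s / t) ^ (2 * m) *\<^sub>R U s y) = G y" for y
  proof -
    let ?l = "\<lambda>k. lattice_point \<mu> t (int m - int k)"
    have pt: "sin (pi * s / t) ^ (2 * m) *\<^sub>R U s y = (\<Sum>k\<le>2 * m. b k *\<^sub>C rescale T (?l k) s y)" for s
    proof -
      have ex: "exp (2 * \<i> * complex_of_real (pi * s / t) * (of_nat k - of_nat m)) * exp (- \<mu> * complex_of_real s)
          = exp (- ?l k * complex_of_real s)" for k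
        unfolding lattice_point_def exp_add[symmetric] using t
        by (intro arg_cong[where f = exp]) (simp add: field_simps)
      have "sin (pi * s / t) ^ (2 * m) *\<^sub>R U s y = complex_of_real (sin (pi * s / t) ^ (2 * m)) *\<^sub>C U s y"
        by (simp only: scaleC_of_real)
      also have "\<dots> = (\<Sum>k\<le>2 * m. (b k * exp (2 * \<i> * complex_of_real (pi * s / t) * (of_nat k - of_nat m))) *\<^sub>C U s y)"
        unfolding b by (rule complex_vector.scale_sum_left)
      also have "\<dots> = (\<Sum>k\<le>2 * m. b k *\<^sub>C rescale T (?l k) s y)"
        unfolding U_def rescale_def scaleC_scaleC mult.assoc[of "b _" "exp _" "exp _"] ex ..
      finally show ?thesis .
    qed
    have "integral {0..t} (\<lambda>s. sin (pi * s / t) ^ (2 * m) *\<^sub>R U s y)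
        = (\<Sum>k\<le>2 * m. integral {0..t} (\<lambda>s. b k *\<^sub>C rescale T (?l k) s y))"
      unfolding pt
      by (intro Henstock_Kurzweil_Integration.integral_sum finite_atMost
          integrable_linear[OF R.orbit_integrable bounded_linear_scaleC, unfolded o_def])
    also have "\<dots> = (\<Sum>k\<le>2 * m. b k *\<^sub>C R.orbit_integral (?l k) t y)"
      by (intro sum.cong refl R.bounded_linear_orbit_integral[OF bounded_linear_scaleC, symmetric])
    also have "inverse (sine_mass t m) *\<^sub>R \<dots> =
        (\<Sum>k\<le>2 * m. (complex_of_real (inverse (sine_mass t m)) * b k) *\<^sub>C R.orbit_integral (?l k) t y)"
      unfolding scaleR_sum_right scaleR_scaleC ..
    also have "\<dots> = (\<Sum>n\<in>F. (complex_of_real (inverse (sine_mass t m)) * b (nat (int m - n))) *\<^sub>C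
        R.orbit_integral (lattice_point \<mu> t n) t y)"
      unfolding F_def
      by (rule sum.reindex_bij_witness[of _ "\<lambda>n. nat (int m - n)" "\<lambda>k. int m - int k"]) auto
    also have "\<dots> = G y"
      unfolding G_def
    proof (rule sum.cong[OF refl])
      fix n
      have "P n (d n *\<^sub>C y) = d n *\<^sub>C P n y" by (rule bounded_clinear_scale[OF A_bounded[OF P_mem]])
      also have "\<dots> = (complex_of_real (inverse (sine_mass t m)) * b (nat (int m - n))) *\<^sub>C
          R.orbit_integral (lattice_point \<mu> t n) t y"
        unfolding P_def d_def scaleC_scaleC using z by simp
      finally show "(complex_of_real (inverse (sine_mass t m)) * b (nat (int m - n))) *\<^sub>C
          R.orbit_integral (lattice_point \<mu> t n) t y = P n (d n *\<^sub>C y)" by simp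
    qed
    finally show ?thesis .
  qed
  have G_mem: "G \<in> A"
    unfolding G_def[abs_def] by (rule A.sum_mem[OF A.comp_mem[OF P_mem scale_mem[OF A.id_mem]]])

  \<comment> \<open>The kernel concentrates at \<open>t / 2\<close>, so \<open>G (U a x)\<close>
    approximates \<open>U (a + t / 2) x\<close>; the extra \<open>U (t / 2)\<close> completes the
    time to \<open>a + t\<close>, a multiple of \<open>t\<close>.\<close>
  define E where "E x = U (t / 2) (G (U a x)) + (- 1) *\<^sub>C U (a + t) x" for x
  have E_mem: "E \<in> A"
    unfolding E_def[abs_def]
    by (rule A.add_mem[OF A.comp_mem[OF U_mem A.comp_mem[OF G_mem U_mem]] scale_mem[OF U_mem]])
      (use t a in simp_all)
  have "norm (E x) \<le> 1 / 2 * norm x" for x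
  proof -
    have "U (a + t) x = U (t / 2) (U (a + t / 2) x)"
      using U_semigroup[of "t / 2" "a + t / 2" x] t a by (simp add: algebra_simps)
    then have "E x = U (t / 2) (G (U a x)) - U (t / 2) (U (a + t / 2) x)" unfolding E_def by simp
    also have "\<dots> = U (t / 2) (G (U a x) - U (a + t / 2) x)"
      unfolding U_def using R.T_diff[of "t / 2"] t by simp
    finally have "norm (E x) \<le> K1 * norm (G (U a x) - U (a + t / 2) x)" using K1(2) t by simp
    also have "\<dots> \<le> K1 * (1 / (2 * K1) * norm x)"
      using m[of x] K1(1) unfolding G_eq by (intro mult_left_mono) simp_all
    finally show ?thesis using K1(1) by simp
  qed
  then obtain J where J: "J \<in> A" "\<And>x. J x + E (J x) = x"
    using bicommutant_inverse[of E "T ` {0..}" "1 / 2"] E_mem unfolding A_def by auto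
  \<comment> \<open>From \<open>U(t/2) G U(a) = I + E + B D\<close> and \<open>(I + E) J = I\<close>
    follows \<open>I = U(t/2) G U(a) J - B D J\<close>; commuting \<open>G\<close> to the front
    displays the \<open>P n\<close>.\<close>
  define C where "C n x = d n *\<^sub>C U (t / 2) (U a (J x))" for n x
  define C0 where "C0 x = (- 1) *\<^sub>C D (J x)" for x
  have C_mem: "C n \<in> A" for n
    unfolding C_def[abs_def]
    by (rule scale_mem[OF A.comp_mem[OF U_mem A.comp_mem[OF U_mem J(1)]]]) (use t a in simp_all)
  have C0_mem: "C0 \<in> A"
    unfolding C0_def[abs_def] by (rule scale_mem[OF A.comp_mem[OF D(1) J(1)]])
  have unity: "x = (\<Sum>n\<in>F. P n (C n x)) + B (C0 x)" for x
  proof -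
    have "x = J x + (U (t / 2) (G (U a (J x))) - (J x + B (D (J x))))"
      using J(2)[of x] unfolding E_def D(2) by simp
    then have "x = U (t / 2) (G (U a (J x))) - B (D (J x))" by simp
    moreover have "U (t / 2) (G (U a (J x))) = (\<Sum>n\<in>F. P n (C n x))"
      using A.op_commute[OF G_mem U_mem[of "t / 2"], of "U a (J x)"] t
      unfolding G_def C_def by simp
    moreover have "B (C0 x) = - B (D (J x))"
      unfolding C0_def bounded_clinear_scale[OF A_bounded[OF B_mem]] by simp
    ultimately show ?thesis by simp
  qed
  have "operator_factorization A (\<lambda>n. shift (generator T) (lattice_point \<mu> t n)) P C B C0 F"
  proof (intro operator_factorization.intro operator_factorization_axioms.intro)
    show "commuting_operators A" by (rule A.commuting_operators_axioms)
    show "closed (shift (generator T) (lattice_point \<mu> t n))" for n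
      unfolding generator_rescale[symmetric] by (rule R.closed_generator)
    show "finite F" unfolding F_def by simp
  qed (fact A_bounded clinear_rel_shift[OF clinear_rel_generator] P_mem B_mem C_mem C0_mem P_in_S P_S unity)+
  then show ?thesis unfolding B_def[abs_def] z_def by blast
qed

end

text \<open>\<open>Q\<close> is a parameter so that one argument yields all three spectra.\<close>

lemma spectrum_from_factorization:
  assumes t: "t > 0"
    and Q: "\<And>\<mu>. Q (op_graph (\<lambda>x. T t x - exp (\<mu> * complex_of_real t) *\<^sub>C x)) \<longleftrightarrow>
      (\<forall>n. Q (shift (generator T) (lattice_point \<mu> t n)))"
  shows "{z. \<not> Q (shift (op_graph (T t)) z)} - {0} =
    {exp (\<mu> * complex_of_real t) | \<mu>. \<mu> \<in> {\<mu>. \<not> Q (shift (generator T) \<mu>)}}" (is "?L = ?R")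
proof -
  have shift_graph: "shift (op_graph (T t)) z = op_graph (\<lambda>x. T t x - z *\<^sub>C x)" for z
    unfolding shift_def op_graph_def by auto
  show ?thesis
  proof (intro equalityI subsetI)
    fix z assume z: "z \<in> ?L"
    \<comment> \<open>Zero being excluded, \<open>z\<close> has a logarithm; any branch serves,
      since the others appear among its lattice points.\<close>
    define \<mu> where "\<mu> = Ln z / complex_of_real t"
    have "exp (\<mu> * complex_of_real t) = z" using z t unfolding \<mu>_def by (simp add: exp_Ln)
    then obtain n where "\<not> Q (shift (generator T) (lattice_point \<mu> t n))"
      and "exp (lattice_point \<mu> t n * complex_of_real t) = z"
      using z Q[of \<mu>] exp_eq_lattice_point[OF t, of _ \<mu>] unfolding shift_graph by auto
    then show "z \<in> ?R" by blast
  next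
    fix z assume "z \<in> ?R"
    then obtain \<mu> where \<mu>: "z = exp (\<mu> * complex_of_real t)" "\<not> Q (shift (generator T) \<mu>)" by blast
    \<comment> \<open>The given \<open>mu\<close> is its own lattice point of index 0, so failure of
      \<open>Q\<close> there is failure for some index.\<close>
    have "lattice_point \<mu> t 0 = \<mu>" unfolding lattice_point_def by simp
    then have "\<not> Q (op_graph (\<lambda>x. T t x - z *\<^sub>C x))" unfolding \<mu>(1) Q using \<mu>(2) by metis
    then show "z \<in> ?L" unfolding shift_graph using \<mu>(1) by simp
  qed
qed

theorem corollary1:
  fixes T :: "real \<Rightarrow> 'a::complex_banach \<Rightarrow> 'a" and t :: real
  assumes "reflexive_space TYPE('a)"
    and "C0_semigroup T"
    and "\<exists>t0>0. bounded_product (generator T) (T t0)"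
    and "t > 0"
  shows "sigma_ub (op_graph (T t)) - {0} =
           {exp (\<mu> * complex_of_real t) | \<mu>. \<mu> \<in> sigma_ub (generator T)} \<and>
         sigma_lb (op_graph (T t)) - {0} =
           {exp (\<mu> * complex_of_real t) | \<mu>. \<mu> \<in> sigma_lb (generator T)} \<and>
         sigma_b (op_graph (T t)) - {0} =
           {exp (\<mu> * complex_of_real t) | \<mu>. \<mu> \<in> sigma_b (generator T)}"
proof -
  interpret c0_semigroup T by (rule c0_semigroup.intro[OF assms(2)])
  obtain t0 where t0: "t0 > 0" "bounded_product (generator T) (T t0)" using assms(3) by blast
  let ?S = "\<lambda>\<mu> n. shift (generator T) (lattice_point \<mu> t n)"
    and ?B = "\<lambda>\<mu>. op_graph (\<lambda>x. T t x - exp (\<mu> * complex_of_real t) *\<^sub>C x)"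
  have ub: "upper_semi_browder (?B \<mu>) \<longleftrightarrow> (\<forall>n. upper_semi_browder (?S \<mu> n))"
    and lb: "lower_semi_browder (?B \<mu>) \<longleftrightarrow> (\<forall>n. lower_semi_browder (?S \<mu> n))" for \<mu>
    using factorization[OF assms(4) t0, of \<mu>] operator_factorization.upper_semi_browder_factorization
      operator_factorization.lower_semi_browder_factorization by metis+
  have b: "browder (?B \<mu>) \<longleftrightarrow> (\<forall>n. browder (?S \<mu> n))" for \<mu>
    unfolding browder_def ub lb by blast
  show ?thesis
    unfolding sigma_ub_def sigma_lb_def sigma_b_def
    by (intro conjI spectrum_from_factorization[where Q = upper_semi_browder, OF assms(4) ub]
        spectrum_from_factorization[where Q = lower_semi_browder, OF assms(4) lb]
        spectrum_from_factorization[where Q = browder, OF assms(4) b])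
qed

end
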